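(* In the setting below, let $0\le r<R$ and $1\le k\le M_r$. There is a function $\tau^{r,\varepsilon}_k$ with $\tau^{r,\varepsilon}_k\sim\sum_{i:S_i\subseteq S^r_k}\tau^\varepsilon_i\,\mathbb E\big(N^\varepsilon(x,i,r)\big)$ uniformly in $x\in S^r_k$, such that $\lim_{\varepsilon\downarrow0}\mathbb E\,T^{r,\varepsilon}(x,S^r_l)/\tau^{r,\varepsilon}_k=1$ uniformly in $x\in S^r_k$, for each $1\le l\le M_r$ with $P^{r,\varepsilon}_{kl}\not\equiv0$.
   Context: Setting: a Markov renewal process on a metric space $S=S_1\cup\dots\cup S_M$ (disjoint Borel sets), embedded chain $(\mathbf X^{x,\varepsilon}_n,\mathbf T^{x,\varepsilon}_n)$ started at $(x,0)$ with transition kernels $Q^\varepsilon(y,\cdot)$ on $S\times[0,\infty)$ depending only on the spatial state; $P^\varepsilon(x,B)=Q^\varepsilon(x,B\times[0,\infty))$; $T^\varepsilon(x,B)$ has law $Q^\varepsilon(x,B\times\cdot)/P^\varepsilon(x,B)$. It satisfies: (a) $P^\varepsilon(x,S_i)=0$ for $x\in S_i$; for $i\ne j$, $P^\varepsilon(x,S_j)$ is $0$ for all $x\in S_i,\varepsilon$ ($P^\varepsilon_{ij}:\equiv0$) or positive with positive $P^\varepsilon_{ij}$, $P^\varepsilon(x,S_j)/P^\varepsilon_{ij}\to1$ uniformly in $x\in S_i$, $\sum_jP^\varepsilon_{ij}=1$, indices communicate through positive $P^\varepsilon$; (b) positive $\tau^\varepsilon_i$ with $\mathbb ET^\varepsilon(x,S_j)/\tau^\varepsilon_i\to1$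 uniformly in $x\in S_i$ when $P^\varepsilon_{ij}\not\equiv0$; (c) $\mathrm{Var}\,T^\varepsilon(x,S_j)\le C(\tau^\varepsilon_i)^2$ for $\varepsilon\le\varepsilon_0$; (f) $\lim_{\varepsilon\downarrow0}\prod_{k=1}^n\frac{P^\varepsilon_{a_kb_k}}{P^\varepsilon_{a_kd_k}}\frac{\tau^\varepsilon_a}{\tau^\varepsilon_c}\in[0,\infty]$ whenever defined. Hierarchy: $S^0_i=S_i$, $M_0=M$, $P^{0,\varepsilon}=P^\varepsilon$; $\pi^r$ maps a point or subset to its rank-$r$ cluster; $\theta_0^{x,\varepsilon}(r)=0$, $\theta_n^{x,\varepsilon}(r)=\min\{m>\theta_{n-1}(r):\pi^r(\mathbf X_m)\ne\pi^r(\mathbf X_{\theta_{n-1}(r)})\}$; if $M_r>1$, partition $\{1,\dots,M_r\}$ into ergodic classes of the limit matrix $P^{r,0}_{ij}=\lim P^{r,\varepsilon}_{ij}$ and transient singletons $E_1,\dots,E_{M_{r+1}}$; $S^{r+1}_k=\bigcup_{i\in E_k}S^r_i$; $\lambda^r_k$ the invariant probability on $E_k$ (unit mass for a transient singleton); $P^{r+1,\varepsilon}_{kl}=\sum_{i\in E_k,\,S^r_j\subseteq S^{r+1}_l}\lambda^r_k(i)P^{r,\varepsilon}_{ij}\big/\sum_{i\in E_k,\,S^r_j\not\subseteq S^{r+1}_k}\lambda^r_k(i)P^{r,\varepsilon}_{ij}$; $R$ is the first rank with $M_R=1$. For $0\le r<R$: $\mathbf X^{x,r,\varepsilon}_n=\mathbf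 X^{x,\varepsilon}_{\theta_n(r)}$, $\mathbf T^{x,r,\varepsilon}_0=0$, $\mathbf T^{x,r,\varepsilon}_n=\sum_{m=\theta_{n-1}(r)+1}^{\theta_n(r)}\mathbf T^{x,\varepsilon}_m$; $T^{r,\varepsilon}(x,S^r_j)$ has the law of $\mathbf T^{x,r,\varepsilon}_1$ conditioned on $\mathbf X^{x,r,\varepsilon}_1\in S^r_j$. $N^\varepsilon(x,i,r)=\sum_{n=0}^{\theta^{x,\varepsilon}_1(r)}\chi_{S_i}(\mathbf X^{x,\varepsilon}_n)$ for $x\in\pi^r(S_i)$. $f\sim g$ means $f/g\to1$. *)

theory Defs
  imports "HOL-Probability.Probability"
begin

definition unif_to_one :: "(real \<Rightarrow> 'a \<Rightarrow> real) \<Rightarrow> 'a set \<Rightarrow> bool" where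
  "unif_to_one f A \<longleftrightarrow> (\<forall>\<delta>>0. \<forall>\<^sub>F \<epsilon> in at_right 0. \<forall>x\<in>A. \<bar>f \<epsilon> x - 1\<bar> < \<delta>)"

text \<open>P(x,B) = Q(x, B x [0,oo)); the kernel Q(x) is concentrated on S x [0,oo).\<close>
definition kerP :: "('a \<times> real) measure \<Rightarrow> 'a set \<Rightarrow> real" where
  "kerP Qx B = measure Qx (B \<times> {0..})"

text \<open>Moment of g(T(x,B)), where T(x,B) has law Q(x, B x .)/P(x,B).\<close>
definition condMom :: "('a \<times> real) measure \<Rightarrow> 'a set \<Rightarrow> (real \<Rightarrow> real) \<Rightarrow> real" where
  "condMom Qx B g = (\<integral>p. indicator B (fst p) * g (snd p) \<partial>Qx) / kerP Qx B"

definition condVar :: "('a \<times> real) measure \<Rightarrow> 'a set \<Rightarrow> real" where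
  "condVar Qx B = condMom Qx B (\<lambda>t. t\<^sup>2) - (condMom Qx B (\<lambda>t. t))\<^sup>2"

definition history :: "(nat \<Rightarrow> 'w \<Rightarrow> 'a) \<Rightarrow> (nat \<Rightarrow> 'w \<Rightarrow> real) \<Rightarrow> nat \<Rightarrow> 'w \<Rightarrow> (nat \<Rightarrow> 'a \<times> real)" where
  "history X T n \<omega> = (\<lambda>m\<in>{..n}. (X m \<omega>, T m \<omega>))"

text \<open>(X_n, T_n) on the probability space Pr is the Markov renewal chain with
  kernel Q started at (x,0): given the history up to time n, (X_{n+1},T_{n+1})
  has law Q(X_n, .).\<close>
definition MRP_chain ::
  "('a::metric_space \<Rightarrow> ('a \<times> real) measure) \<Rightarrow> 'a \<Rightarrow> 'w measure \<Rightarrow>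
   (nat \<Rightarrow> 'w \<Rightarrow> 'a) \<Rightarrow> (nat \<Rightarrow> 'w \<Rightarrow> real) \<Rightarrow> bool" where
  "MRP_chain Q x Pr X T \<longleftrightarrow>
     prob_space Pr \<and>
     (\<forall>n. X n \<in> Pr \<rightarrow>\<^sub>M borel) \<and> (\<forall>n. T n \<in> Pr \<rightarrow>\<^sub>M borel) \<and>
     (\<forall>\<omega>\<in>space Pr. X 0 \<omega> = x \<and> T 0 \<omega> = 0) \<and>
     (\<forall>n H B. H \<in> sets (PiM {..n} (\<lambda>_. borel \<Otimes>\<^sub>M borel)) \<longrightarrow>
        B \<in> sets (borel \<Otimes>\<^sub>M (borel :: real measure)) \<longrightarrow>
        measure Pr {\<omega>\<in>space Pr. history X T n \<omega> \<in> H \<and> (X (Suc n) \<omega>, T (Suc n) \<omega>) \<in> B}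
        = (\<integral>\<omega>. indicator {\<omega>\<in>space Pr. history X T n \<omega> \<in> H} \<omega> * measure (Q (X n \<omega>)) B \<partial>Pr))"

text \<open>Indices are 0-based: 0,...,m-1.  A is a (limit) stochastic matrix on {..<m}.\<close>

definition reach :: "nat \<Rightarrow> (nat \<Rightarrow> nat \<Rightarrow> real) \<Rightarrow> nat \<Rightarrow> nat \<Rightarrow> bool" where
  "reach m A i j \<longleftrightarrow> (i, j) \<in> {(a, b). a < m \<and> b < m \<and> A a b > 0}\<^sup>*"

definition comm_class :: "nat \<Rightarrow> (nat \<Rightarrow> nat \<Rightarrow> real) \<Rightarrow> nat \<Rightarrow> nat set" where
  "comm_class m A i = {j. j < m \<and> reach m A i j \<and> reach m A j i}"

definition ergodic :: "nat \<Rightarrow> (nat \<Rightarrow> nat \<Rightarrow> real) \<Rightarrow> nat \<Rightarrow> bool" where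
  "ergodic m A i \<longleftrightarrow> i < m \<and>
     (\<forall>j\<in>comm_class m A i. \<forall>l<m. A j l > 0 \<longrightarrow> l \<in> comm_class m A i)"

definition block :: "nat \<Rightarrow> (nat \<Rightarrow> nat \<Rightarrow> real) \<Rightarrow> nat \<Rightarrow> nat set" where
  "block m A i = (if ergodic m A i then comm_class m A i else {i})"

definition rep :: "nat \<Rightarrow> (nat \<Rightarrow> nat \<Rightarrow> real) \<Rightarrow> nat \<Rightarrow> nat" where
  "rep m A i = Min (block m A i)"

text \<open>Blocks E_1,...,E_{M_{r+1}} are enumerated (from 0) by increasing minimal element.\<close>
definition newidx :: "nat \<Rightarrow> (nat \<Rightarrow> nat \<Rightarrow> real) \<Rightarrow> nat \<Rightarrow> nat" where
  "newidx m A i = card {j. j < m \<and> rep m A j = j \<and> j < rep m A i}"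

definition newM :: "nat \<Rightarrow> (nat \<Rightarrow> nat \<Rightarrow> real) \<Rightarrow> nat" where
  "newM m A = card {j. j < m \<and> rep m A j = j}"

text \<open>lambda(i): the invariant probability of the block of i, evaluated at i
  (unit mass for a transient singleton).\<close>
definition lam :: "nat \<Rightarrow> (nat \<Rightarrow> nat \<Rightarrow> real) \<Rightarrow> nat \<Rightarrow> real" where
  "lam m A i = (if ergodic m A i then
      (THE v. (\<forall>j. j \<notin> block m A i \<longrightarrow> v j = 0) \<and> (\<forall>j\<in>block m A i. v j \<ge> 0) \<and>
              sum v (block m A i) = 1 \<and>
              (\<forall>j\<in>block m A i. v j = (\<Sum>l\<in>block m A i. v l * A l j))) i
    else 1)"

definition lim0 :: "(real \<Rightarrow> nat \<Rightarrow> nat \<Rightarrow> real) \<Rightarrow> nat \<Rightarrow> nat \<Rightarrow> real" where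
  "lim0 P i j = Lim (at_right 0) (\<lambda>\<epsilon>. P \<epsilon> i j)"

definition newP :: "nat \<Rightarrow> (nat \<Rightarrow> nat \<Rightarrow> real) \<Rightarrow> (real \<Rightarrow> nat \<Rightarrow> nat \<Rightarrow> real) \<Rightarrow>
    real \<Rightarrow> nat \<Rightarrow> nat \<Rightarrow> real" where
  "newP m A P \<epsilon> k l = (if k = l then 0 else
     (\<Sum>i\<in>{i. i < m \<and> newidx m A i = k}. \<Sum>j\<in>{j. j < m \<and> newidx m A j = l}. lam m A i * P \<epsilon> i j)
   / (\<Sum>i\<in>{i. i < m \<and> newidx m A i = k}. \<Sum>j\<in>{j. j < m \<and> newidx m A j \<noteq> k}. lam m A i * P \<epsilon> i j))"

text \<open>hier M P r = (M_r, map from original index i to its rank-r cluster index, P^{r,eps}).\<close>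
fun hier :: "nat \<Rightarrow> (real \<Rightarrow> nat \<Rightarrow> nat \<Rightarrow> real) \<Rightarrow> nat \<Rightarrow>
    nat \<times> (nat \<Rightarrow> nat) \<times> (real \<Rightarrow> nat \<Rightarrow> nat \<Rightarrow> real)" where
  "hier M P 0 = (M, id, P)"
| "hier M P (Suc r) = (case hier M P r of (m, c, Pr) \<Rightarrow>
     (if m \<le> 1 then (m, c, Pr)
      else (newM m (lim0 Pr), newidx m (lim0 Pr) \<circ> c, newP m (lim0 Pr) Pr)))"

definition Mr :: "nat \<Rightarrow> (real \<Rightarrow> nat \<Rightarrow> nat \<Rightarrow> real) \<Rightarrow> nat \<Rightarrow> nat" where
  "Mr M P r = fst (hier M P r)"

definition clus :: "nat \<Rightarrow> (real \<Rightarrow> nat \<Rightarrow> nat \<Rightarrow> real) \<Rightarrow> nat \<Rightarrow> nat \<Rightarrow> nat" where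
  "clus M P r = fst (snd (hier M P r))"

definition Pmat :: "nat \<Rightarrow> (real \<Rightarrow> nat \<Rightarrow> nat \<Rightarrow> real) \<Rightarrow> nat \<Rightarrow> real \<Rightarrow> nat \<Rightarrow> nat \<Rightarrow> real" where
  "Pmat M P r = snd (snd (hier M P r))"

definition Rtop :: "nat \<Rightarrow> (real \<Rightarrow> nat \<Rightarrow> nat \<Rightarrow> real) \<Rightarrow> nat" where
  "Rtop M P = (LEAST r. Mr M P r = 1)"

definition Sr :: "nat \<Rightarrow> (real \<Rightarrow> nat \<Rightarrow> nat \<Rightarrow> real) \<Rightarrow> (nat \<Rightarrow> 'a set) \<Rightarrow> nat \<Rightarrow> nat \<Rightarrow> 'a set" where
  "Sr M P S r k = (\<Union>i\<in>{i. i < M \<and> clus M P r i = k}. S i)"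

definition piR :: "nat \<Rightarrow> (real \<Rightarrow> nat \<Rightarrow> nat \<Rightarrow> real) \<Rightarrow> (nat \<Rightarrow> 'a set) \<Rightarrow> nat \<Rightarrow> 'a \<Rightarrow> nat" where
  "piR M P S r y = clus M P r (THE i. i < M \<and> y \<in> S i)"

definition theta1 :: "('a \<Rightarrow> nat) \<Rightarrow> (nat \<Rightarrow> 'w \<Rightarrow> 'a) \<Rightarrow> 'w \<Rightarrow> nat" where
  "theta1 p X \<omega> = (LEAST m. m > 0 \<and> p (X m \<omega>) \<noteq> p (X 0 \<omega>))"

definition Xr1 :: "('a \<Rightarrow> nat) \<Rightarrow> (nat \<Rightarrow> 'w \<Rightarrow> 'a) \<Rightarrow> 'w \<Rightarrow> 'a" where
  "Xr1 p X \<omega> = X (theta1 p X \<omega>) \<omega>"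

definition Tr1 :: "('a \<Rightarrow> nat) \<Rightarrow> (nat \<Rightarrow> 'w \<Rightarrow> 'a) \<Rightarrow> (nat \<Rightarrow> 'w \<Rightarrow> real) \<Rightarrow> 'w \<Rightarrow> real" where
  "Tr1 p X T \<omega> = (\<Sum>m\<in>{1..theta1 p X \<omega>}. T m \<omega>)"

definition ETr :: "'w measure \<Rightarrow> ('a \<Rightarrow> nat) \<Rightarrow> (nat \<Rightarrow> 'w \<Rightarrow> 'a) \<Rightarrow> (nat \<Rightarrow> 'w \<Rightarrow> real) \<Rightarrow> 'a set \<Rightarrow> real" where
  "ETr Pr p X T B = (\<integral>\<omega>. Tr1 p X T \<omega> * indicator B (Xr1 p X \<omega>) \<partial>Pr)
                   / measure Pr {\<omega>\<in>space Pr. Xr1 p X \<omega> \<in> B}"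

definition ENr :: "'w measure \<Rightarrow> ('a \<Rightarrow> nat) \<Rightarrow> (nat \<Rightarrow> 'w \<Rightarrow> 'a) \<Rightarrow> 'a set \<Rightarrow> real" where
  "ENr Pr p X A = (\<integral>\<omega>. (\<Sum>n\<in>{0..theta1 p X \<omega>}. indicator A (X n \<omega>)) \<partial>Pr)"

end

theory Submission
  imports Defs
begin

text \<open>
  For the chain started at \<open>x\<close> in a cluster, the expected numbers of visits to the sets \<open>S i\<close> before
  the exit, together with the expected numbers of jumps between them, form a \<^emph>\<open>flow\<close>: they satisfy
  the balance equations of a finite Markov chain whose transition matrix agrees with \<open>P\<^sup>\<epsilon>\<close> up
  to a small relative error, uniformly in \<open>x\<close>. A flow on a cluster of rank \<open>r + 1\<close> restricts to flows
  on its rank-\<open>r\<close> pieces, and these add up to a flow for the matrix of rank \<open>r\<close>. Inside an ergodic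
  class the normalised flow is an almost invariant vector of the limit matrix, hence close to
  \<open>\<lambda>\<close>, and conservation of mass fixes its total. By induction on the rank, occupation numbers and
  exit probabilities are asymptotically independent of the starting point and of the perturbation.

  The occupation sums weighted by the elapsed time form a flow as well, whose source consists of
  the holding times; together with the harmonicity of the exit probability (remove the first
  jump from the flow started at a point) this gives the exit time conditioned on the exit cluster.
\<close>

text \<open>Errors have to be relative: the probability of leaving a cluster tends to 0 with
  \<epsilon>, so a perturbation that is small only in absolute terms could change visit numbers and
  exit probabilities completely. The statement carried through the induction,
  \<open>rank_law\<close>, speaks of every flow within a tolerance, whatever its source, and asserts
  that only the total source mass matters. This generality lets one statement serve for the
  restricted flows in the induction step, for the flow that remains after the first jump, and for
  the time-weighted flow. Limit matrices exist at all ranks only if the quotients forming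
  \<open>newP\<close> converge. This requires a class of functions of \<epsilon> closed under sums
  and quotients, and hypothesis (f) supplies one: the functions asymptotic to a constant times a
  product of ratios of transition probabilities. The mean exit time does not depend on the exit
  cluster, because conditioning on that cluster weights every holding time by approximately the same
  factor, the exit probability, by which one divides in the end.\<close>

section \<open>Relative closeness of real numbers\<close>

text \<open>Written without a quotient, so that \<open>b = 0\<close> is meaningful and forces
  \<open>a = 0\<close>; in this form sums and nonnegative multiples keep the same
  \<open>d\<close>.\<close>

definition near :: "real \<Rightarrow> real \<Rightarrow> real \<Rightarrow> bool" where
  "near d a b \<longleftrightarrow> \<bar>a - b\<bar> \<le> d * b"

lemma near_nonneg: "near d a b \<Longrightarrow> d \<le> 1 \<Longrightarrow> 0 \<le> b \<Longrightarrow> 0 \<le> a"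
  unfolding near_def using mult_right_mono[of d 1 b] by linarith

lemma near_mono: "near d a b \<Longrightarrow> d \<le> e \<Longrightarrow> 0 \<le> b \<Longrightarrow> near e a b"
  unfolding near_def using mult_right_mono[of d e b] by linarith

lemma near_refl: "0 \<le> d \<Longrightarrow> 0 \<le> b \<Longrightarrow> near d b b"
  unfolding near_def by simp

lemma near_sum: "(\<And>i. i \<in> I \<Longrightarrow> near d (f i) (g i)) \<Longrightarrow> near d (sum f I) (sum g I)"
proof -
  assume "\<And>i. i \<in> I \<Longrightarrow> near d (f i) (g i)"
  then have "(\<Sum>i\<in>I. \<bar>f i - g i\<bar>) \<le> (\<Sum>i\<in>I. d * g i)"
    unfolding near_def by (intro sum_mono)
  then show ?thesis
    using sum_abs[of "\<lambda>i. f i - g i" I] unfolding near_def by (simp add: sum_subtractf sum_distrib_left)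
qed

lemma near_cmult: "near d a b \<Longrightarrow> 0 \<le> c \<Longrightarrow> near d (c * a) (c * b)"
  unfolding near_def
  by (metis abs_mult abs_of_nonneg mult.left_commute mult_left_mono right_diff_distrib)

lemma near_upper: "near d a b \<Longrightarrow> a \<le> (1 + d) * b"
  unfolding near_def by (simp add: algebra_simps abs_le_iff)

lemma near_lower: "near d a b \<Longrightarrow> (1 - d) * b \<le> a"
  unfolding near_def by (simp add: algebra_simps abs_le_iff)

text \<open>The factor 3 collects one \<open>d\<close> for the second error and at most two for the
  first, which is measured against \<open>b \<le> 2 * c\<close>. The later constants 18, 54 and 4374
  are products of this 3 and the 2 of \<open>near_sym\<close>.\<close>

lemma near_trans:
  assumes ab: "near d a b" and bc: "near d b c" and d: "0 \<le> d" "d \<le> 1" and c: "0 \<le> c"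
  shows "near (3 * d) a c"
proof -
  have "b \<le> 2 * c"
    using near_upper[OF bc] mult_right_mono[of "1 + d" 2 c] d c by linarith
  then have "d * b \<le> d * (2 * c)" using d by (intro mult_left_mono)
  then show ?thesis using ab bc unfolding near_def by (simp add: algebra_simps)
qed

lemma near_sym:
  assumes "near d a b" "0 \<le> d" "d \<le> 1/2" "0 \<le> b"
  shows "near (2 * d) b a"
proof -
  have "b \<le> 2 * a" using near_lower[OF assms(1)] mult_right_mono[of "1/2" "1 - d" b] assms by linarith
  then have "d * b \<le> d * (2 * a)" using assms by (intro mult_left_mono)
  then show ?thesis using assms(1) unfolding near_def by (simp add: abs_minus_commute)
qed

section \<open>Invariant vectors of finite stochastic matrices\<close>

text \<open>Induction on the number of states: a non-absorbing state \<open>s\<close> is eliminated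
  by observing the chain only outside \<open>s\<close>, and the invariant vector of the smaller
  chain is then extended to \<open>s\<close>. An absorbing state carries a unit mass.\<close>

lemma stationary_exists:
  assumes "finite E" "E \<noteq> {}" "\<forall>i\<in>E. \<forall>j\<in>E. A i j \<ge> (0::real)" "\<forall>i\<in>E. (\<Sum>j\<in>E. A i j) = 1"
  shows "\<exists>v. (\<forall>i\<in>E. v i \<ge> 0) \<and> sum v E > 0 \<and> (\<forall>j\<in>E. v j = (\<Sum>i\<in>E. v i * A i j))"
  using assms
proof (induction E arbitrary: A rule: finite_ne_induct)
  case (singleton s)
  then show ?case by (intro exI[of _ "\<lambda>_. 1"]) auto
next
  case (insert s E)
  have row: "A i s + (\<Sum>j\<in>E. A i j) = 1" if "i \<in> insert s E" for i
    using insert.prems(2) that insert.hyps by auto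
  have nn: "A i j \<ge> 0" if "i \<in> insert s E" "j \<in> insert s E" for i j
    using insert.prems(1) that by auto
  show ?case
  proof (cases "A s s = 1")
    case True
    have "(\<Sum>j\<in>E. A s j) = 0" using row[of s] True by simp
    then have z: "\<forall>j\<in>E. A s j = 0"
      using nn insert.hyps(1) by (subst (asm) sum_nonneg_eq_0_iff) auto
    have "(\<Sum>i\<in>E. of_bool (i = s) * A i j) = 0" for j
      using insert.hyps by (intro sum.neutral) auto
    moreover have "(\<Sum>i\<in>E. of_bool (i = s)) = (0::real)"
      using insert.hyps by (intro sum.neutral) auto
    ultimately show ?thesis using True z insert.hyps
      by (intro exI[of _ "\<lambda>i. of_bool (i = s)"]) auto
  next
    case False
    have "A s s \<le> 1" using row[of s] nn sum_nonneg[of E "A s"] by force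
    with False have q: "1 - A s s > 0" by simp
    \<comment> \<open>The chain censored at \<open>s\<close>: the sojourns at \<open>s\<close> form
      a geometric series, whence the factor \<open>1 / (1 - A s s)\<close>.\<close>
    define A' where "A' i j = A i j + A i s * A s j / (1 - A s s)" for i j
    have "(\<Sum>j\<in>E. A' i j) = 1" if "i \<in> E" for i
    proof -
      have "(\<Sum>j\<in>E. A' i j) = (\<Sum>j\<in>E. A i j) + A i s * (\<Sum>j\<in>E. A s j) / (1 - A s s)"
        by (simp add: A'_def sum.distrib sum_distrib_left sum_divide_distrib)
      also have "(\<Sum>j\<in>E. A s j) = 1 - A s s" using row[of s] by simp
      finally show ?thesis using row[of i] that q by simp
    qed
    moreover have "\<forall>i\<in>E. \<forall>j\<in>E. A' i j \<ge> 0"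
      unfolding A'_def using nn q by auto
    ultimately obtain v where v: "\<forall>i\<in>E. v i \<ge> 0" "sum v E > 0"
      "\<forall>j\<in>E. v j = (\<Sum>i\<in>E. v i * A' i j)" using insert.IH[of A'] by blast
    \<comment> \<open>The value at \<open>s\<close> is forced by the balance equation at
      \<open>s\<close>.\<close>
    define w where "w i = (if i = s then (\<Sum>i\<in>E. v i * A i s) / (1 - A s s) else v i)" for i
    have wE: "w i = v i" if "i \<in> E" for i using that insert.hyps by (auto simp: w_def)
    have ws: "w s \<ge> 0" unfolding w_def using v(1) nn q by (auto intro!: sum_nonneg divide_nonneg_pos)
    have s1: "w s = (\<Sum>i\<in>insert s E. w i * A i s)"
    proof -
      have "(\<Sum>i\<in>E. w i * A i s) = (\<Sum>i\<in>E. v i * A i s)" by (intro sum.cong) (auto simp: wE)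
      also have "\<dots> = w s * (1 - A s s)" using q by (simp add: w_def)
      finally show ?thesis using insert.hyps by (simp add: algebra_simps)
    qed
    have s2: "w j = (\<Sum>i\<in>insert s E. w i * A i j)" if "j \<in> E" for j
    proof -
      have "(\<Sum>i\<in>insert s E. w i * A i j) = w s * A s j + (\<Sum>i\<in>E. v i * A i j)"
        using insert.hyps by (simp add: wE)
      also have "\<dots> = (\<Sum>i\<in>E. v i * A' i j)"
        by (simp add: w_def A'_def algebra_simps sum.distrib sum_distrib_left sum_divide_distrib)
      finally show ?thesis using wE[OF that] v(3)[rule_format, OF that] by presburger
    qed
    have "sum w (insert s E) > 0"
      using ws v(2) insert.hyps wE by simp
    moreover have "\<forall>j\<in>insert s E. w j = (\<Sum>i\<in>insert s E. w i * A i j)" using s1 s2 by blast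
    moreover have "\<forall>i\<in>insert s E. w i \<ge> 0" using ws v(1) wE by auto
    ultimately show ?thesis by blast
  qed
qed

text \<open>The connecting paths must stay inside \<open>E\<close>, unlike those of
  \<open>reach\<close>, so that arguments along a path involve only states of
  \<open>E\<close>.\<close>

definition irred :: "nat set \<Rightarrow> (nat \<Rightarrow> nat \<Rightarrow> real) \<Rightarrow> bool" where
  "irred E A \<longleftrightarrow> (\<forall>i\<in>E. \<forall>j\<in>E. (i, j) \<in> {(a, b). a \<in> E \<and> b \<in> E \<and> A a b > 0}\<^sup>*)"

text \<open>Smallness at one state propagates backwards along the edges of positive weight.\<close>
lemma harnack:
  assumes fin: "finite E" and nn: "\<forall>i\<in>E. \<forall>j\<in>E. A i j \<ge> 0" and irr: "irred E A"
  shows "\<exists>C\<ge>0. \<forall>j\<in>E. \<forall>i0\<in>E. \<forall>u \<kappa>. (\<forall>i\<in>E. u i \<ge> 0) \<longrightarrow> \<kappa> \<ge> 0 \<longrightarrow> u i0 \<le> \<kappa> \<longrightarrow>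
    (\<forall>i\<in>E. \<bar>u i - (\<Sum>l\<in>E. u l * A l i)\<bar> \<le> \<kappa>) \<longrightarrow> u j \<le> C * \<kappa>"
proof -
  define H where "H C j i0 \<longleftrightarrow> (\<forall>u \<kappa>. (\<forall>i\<in>E. u i \<ge> 0) \<longrightarrow> \<kappa> \<ge> 0 \<longrightarrow> u i0 \<le> \<kappa> \<longrightarrow>
    (\<forall>i\<in>E. \<bar>u i - (\<Sum>l\<in>E. u l * A l i)\<bar> \<le> \<kappa>) \<longrightarrow> u j \<le> C * \<kappa>)" for C :: real and j i0
  have ex: "\<exists>C\<ge>0. H C j i0" if "j \<in> E" "i0 \<in> E" for j i0
  proof -
    have "(j, i0) \<in> {(a, b). a \<in> E \<and> b \<in> E \<and> A a b > 0}\<^sup>*"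
      using irr that unfolding irred_def by blast
    then show ?thesis
    proof (induction rule: converse_rtrancl_induct)
      case base
      show ?case by (intro exI[of _ 1]) (auto simp: H_def)
    next
      case (step y z)
      then obtain C where C: "C \<ge> 0" "H C z i0" and yz: "y \<in> E" "z \<in> E" "A y z > 0" by auto
      have "H ((C + 1) / A y z) y i0"
        unfolding H_def
      proof (intro allI impI)
        fix u \<kappa> assume u: "\<forall>i\<in>E. u i \<ge> 0" "\<kappa> \<ge> 0" "u i0 \<le> \<kappa>"
          "\<forall>i\<in>E. \<bar>u i - (\<Sum>l\<in>E. u l * A l i)\<bar> \<le> \<kappa>"
        then have "u z \<le> C * \<kappa>" using C unfolding H_def by blast
        \<comment> \<open>The edge from \<open>y\<close> contributes to the inflow at
          \<open>z\<close>, which exceeds \<open>u z\<close> by at most \<open>\<kappa>\<close>;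
          dividing by the weight of the edge gives the new constant.\<close>
        moreover have "u y * A y z \<le> (\<Sum>l\<in>E. u l * A l z)"
          using fin yz u nn by (intro member_le_sum) auto
        moreover have "\<bar>u z - (\<Sum>l\<in>E. u l * A l z)\<bar> \<le> \<kappa>" using u yz by blast
        ultimately have "u y * A y z \<le> (C + 1) * \<kappa>" by (simp add: algebra_simps)
        then show "u y \<le> (C + 1) / A y z * \<kappa>" using yz by (simp add: field_simps)
      qed
      then show ?case using C yz by (intro exI[of _ "(C + 1) / A y z"]) auto
    qed
  qed
  then have "\<forall>p\<in>E\<times>E. \<exists>C\<ge>0. H C (fst p) (snd p)" by auto
  then obtain c where c: "\<forall>p\<in>E\<times>E. c p \<ge> 0 \<and> H (c p) (fst p) (snd p)" by metis
  have le: "c p \<le> sum c (E \<times> E)" if "p \<in> E \<times> E" for p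
    using c fin that by (intro member_le_sum) auto
  have "H (sum c (E \<times> E)) j i0" if "j \<in> E" "i0 \<in> E" for j i0
    unfolding H_def
  proof (intro allI impI)
    fix u \<kappa> assume u: "\<forall>i\<in>E. u i \<ge> 0" "\<kappa> \<ge> 0" "u i0 \<le> \<kappa>"
      "\<forall>i\<in>E. \<bar>u i - (\<Sum>l\<in>E. u l * A l i)\<bar> \<le> \<kappa>"
    have "H (c (j, i0)) j i0" using c that by fastforce
    then have "u j \<le> c (j, i0) * \<kappa>" using u unfolding H_def by blast
    also have "\<dots> \<le> sum c (E \<times> E) * \<kappa>" using le that u by (intro mult_right_mono) auto
    finally show "u j \<le> sum c (E \<times> E) * \<kappa>" .
  qed
  moreover have "sum c (E \<times> E) \<ge> 0" using c by (intro sum_nonneg) auto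
  ultimately show ?thesis unfolding H_def by blast
qed

text \<open>The case \<open>\<kappa> = 0\<close> of \<open>harnack\<close>: a single zero would
  force the whole vector to vanish.\<close>

lemma stationary_pos:
  assumes fin: "finite E" and nn: "\<forall>i\<in>E. \<forall>j\<in>E. A i j \<ge> 0" and irr: "irred E A"
    and v: "\<forall>i\<in>E. v i \<ge> 0" "sum v E > 0" "\<forall>j\<in>E. v j = (\<Sum>i\<in>E. v i * A i j)"
    and i: "i \<in> E"
  shows "v i > (0::real)"
proof (rule ccontr)
  assume "\<not> v i > 0"
  then have vi: "v i \<le> 0" by simp
  obtain C where C: "\<forall>j\<in>E. \<forall>i0\<in>E. \<forall>u \<kappa>. (\<forall>i\<in>E. u i \<ge> 0) \<longrightarrow> \<kappa> \<ge> 0 \<longrightarrow> u i0 \<le> \<kappa> \<longrightarrow>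
    (\<forall>i\<in>E. \<bar>u i - (\<Sum>l\<in>E. u l * A l i)\<bar> \<le> \<kappa>) \<longrightarrow> u j \<le> C * \<kappa>"
    using harnack[OF fin nn irr] by blast
  have d: "\<bar>v j - (\<Sum>i\<in>E. v i * A i j)\<bar> \<le> 0" if "j \<in> E" for j
    using v(3)[rule_format, OF that] by linarith
  have "v j \<le> C * 0" if "j \<in> E" for j
    using C[rule_format, OF that i, of v 0] v(1) d vi by blast
  then have "sum v E \<le> 0" by (intro sum_nonpos) auto
  then show False using v(2) by simp
qed

text \<open>Quantitative uniqueness of the invariant probability. Subtracting from \<open>v\<close>
  the largest multiple of \<open>w\<close> below it leaves a nonnegative vector that has a zero and
  the same defect as \<open>v\<close>, so \<open>harnack\<close> bounds it.\<close>

lemma stationary_stable: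
  assumes fin: "finite E" and nn: "\<forall>i\<in>E. \<forall>j\<in>E. A i j \<ge> 0" and irr: "irred E A" and ne: "E \<noteq> {}"
  shows "\<exists>C\<ge>0. \<forall>v w \<kappa>. (\<forall>i\<in>E. v i \<ge> 0) \<longrightarrow> sum v E = 1 \<longrightarrow> 0 \<le> \<kappa> \<longrightarrow>
     (\<forall>j\<in>E. \<bar>v j - (\<Sum>i\<in>E. v i * A i j)\<bar> \<le> \<kappa>) \<longrightarrow>
     (\<forall>i\<in>E. w i \<ge> 0) \<longrightarrow> sum w E = 1 \<longrightarrow> (\<forall>j\<in>E. w j = (\<Sum>i\<in>E. w i * A i j)) \<longrightarrow>
     (\<forall>j\<in>E. \<bar>v j - w j\<bar> \<le> C * \<kappa>)"
proof -
  obtain C where C: "C \<ge> 0" "\<forall>j\<in>E. \<forall>i0\<in>E. \<forall>u \<kappa>. (\<forall>i\<in>E. u i \<ge> 0) \<longrightarrow> \<kappa> \<ge> 0 \<longrightarrow> u i0 \<le> \<kappa> \<longrightarrow>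
    (\<forall>i\<in>E. \<bar>u i - (\<Sum>l\<in>E. u l * A l i)\<bar> \<le> \<kappa>) \<longrightarrow> u j \<le> C * \<kappa>"
    using harnack[OF fin nn irr] by blast
  have "\<bar>v j - w j\<bar> \<le> (C + card E * C) * \<kappa>"
    if v: "\<forall>i\<in>E. v i \<ge> 0" "sum v E = 1" "0 \<le> \<kappa>" "\<forall>j\<in>E. \<bar>v j - (\<Sum>i\<in>E. v i * A i j)\<bar> \<le> \<kappa>"
      and w: "\<forall>i\<in>E. w i \<ge> 0" "sum w E = 1" "\<forall>j\<in>E. w j = (\<Sum>i\<in>E. w i * A i j)"
      and j: "j \<in> E" for v w \<kappa> j
  proof -
    have wp: "w i > 0" if "i \<in> E" for i using stationary_pos[OF fin nn irr w(1) _ w(3) that] w(2) by simp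
    define t where "t = Min ((\<lambda>i. v i / w i) ` E)"
    have "t \<in> (\<lambda>i. v i / w i) ` E" unfolding t_def using fin ne by (intro Min_in) auto
    then obtain i0 where i0: "i0 \<in> E" "t = v i0 / w i0" by blast
    have tle: "t \<le> v i / w i" if "i \<in> E" for i unfolding t_def using fin that by simp
    define u where "u i = v i - t * w i" for i
    have u0: "u i \<ge> 0" if "i \<in> E" for i
      using tle[OF that] wp[OF that] by (simp add: u_def field_simps)
    have ui0: "u i0 = 0" using i0 wp[of i0] by (simp add: u_def)
    have eq: "u i - (\<Sum>l\<in>E. u l * A l i) = v i - (\<Sum>l\<in>E. v l * A l i)" if "i \<in> E" for i
    proof -
      have "(\<Sum>l\<in>E. u l * A l i) = (\<Sum>l\<in>E. v l * A l i) - t * (\<Sum>l\<in>E. w l * A l i)"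
        by (simp add: u_def algebra_simps sum_subtractf sum_distrib_left)
      then show ?thesis using w(3)[rule_format, OF that] by (simp add: u_def algebra_simps)
    qed
    have uC: "u i \<le> C * \<kappa>" if "i \<in> E" for i
      using C(2)[rule_format, OF that i0(1), of u \<kappa>] u0 ui0 v(3,4) eq by simp
    \<comment> \<open>The mass of the remainder is \<open>1 - t\<close>, so a small remainder also
      forces \<open>t\<close> to be close to 1.\<close>
    have "sum u E = 1 - t" using v(2) w(2) by (simp add: u_def sum_subtractf flip: sum_distrib_left)
    moreover have "sum u E \<le> card E * (C * \<kappa>)" using uC by (intro sum_bounded_above) auto
    moreover have "sum u E \<ge> 0" using u0 by (intro sum_nonneg) auto
    ultimately have t: "0 \<le> 1 - t" "1 - t \<le> card E * C * \<kappa>" by auto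
    have "w j \<le> 1" using w(1,2) fin j member_le_sum[of j E w] by simp
    then have "(1 - t) * w j \<le> card E * C * \<kappa> * 1" using t w(1) j by (intro mult_mono) auto
    moreover have "0 \<le> (1 - t) * w j" using t w(1) j by simp
    moreover have "v j - w j = u j - (1 - t) * w j" by (simp add: u_def algebra_simps)
    moreover have "0 \<le> C * \<kappa>" using C(1) v(3) by simp
    ultimately show ?thesis using u0[OF j] uC[OF j] by (simp add: algebra_simps abs_le_iff)
  qed
  moreover have "C + card E * C \<ge> 0" using C(1) by simp
  ultimately show ?thesis by blast
qed

section \<open>Blocks of a stochastic matrix\<close>

definition stoch :: "nat \<Rightarrow> (nat \<Rightarrow> nat \<Rightarrow> real) \<Rightarrow> bool" where
  "stoch m A \<longleftrightarrow> (\<forall>i<m. \<forall>j<m. A i j \<ge> 0) \<and> (\<forall>i<m. (\<Sum>j<m. A i j) = 1)"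

lemma reach_refl: "reach m A i i"
  by (simp add: reach_def)

lemma reach_trans: "reach m A i j \<Longrightarrow> reach m A j l \<Longrightarrow> reach m A i l"
  unfolding reach_def by (rule rtrancl_trans)

lemma comm_class_eq: "j \<in> comm_class m A i \<Longrightarrow> comm_class m A j = comm_class m A i"
proof -
  assume "j \<in> comm_class m A i"
  then have ij: "reach m A i j" "reach m A j i" by (simp_all add: comm_class_def)
  have "reach m A j l \<longleftrightarrow> reach m A i l" for l using reach_trans[OF ij(1)] reach_trans[OF ij(2)] by blast
  moreover have "reach m A l j \<longleftrightarrow> reach m A l i" for l
    using reach_trans[OF _ ij(1), of l] reach_trans[OF _ ij(2), of l] by blast
  ultimately show ?thesis by (simp add: comm_class_def)
qed

lemma ergodic_comm_class: "ergodic m A i \<Longrightarrow> j \<in> comm_class m A i \<Longrightarrow> ergodic m A j"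
proof -
  assume e: "ergodic m A i" and j: "j \<in> comm_class m A i"
  have "j < m" using j by (simp add: comm_class_def)
  with e show ?thesis unfolding ergodic_def comm_class_eq[OF j] by (intro conjI) simp_all
qed

lemma block_self: "i < m \<Longrightarrow> i \<in> block m A i"
  by (simp add: block_def comm_class_def reach_refl)

lemma block_less: "i < m \<Longrightarrow> block m A i \<subseteq> {..<m}"
  by (auto simp: block_def comm_class_def)

lemma finite_block: "finite (block m A i)"
  by (simp add: block_def comm_class_def)

lemma block_eq: "j \<in> block m A i \<Longrightarrow> block m A j = block m A i"
proof (cases "ergodic m A i")
  case True
  assume "j \<in> block m A i"
  then have "j \<in> comm_class m A i" using True by (simp add: block_def)
  then show ?thesis
    using True ergodic_comm_class[OF True] comm_class_eq[of j m A i] unfolding block_def by (simp only: if_True)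
qed (simp add: block_def)

lemma rep_in: "i < m \<Longrightarrow> rep m A i \<in> block m A i"
  unfolding rep_def using block_self[of i m A] finite_block[of m A i] by (intro Min_in) auto

lemma rep_less: "i < m \<Longrightarrow> rep m A i < m"
  using rep_in[of i m A] block_less[of i m A] by auto

lemma rep_rep: "i < m \<Longrightarrow> rep m A (rep m A i) = rep m A i"
  unfolding rep_def[of m A "rep m A i"] by (simp add: block_eq[OF rep_in] flip: rep_def)

lemma rep_eq_iff: "i < m \<Longrightarrow> j < m \<Longrightarrow> rep m A i = rep m A j \<longleftrightarrow> block m A i = block m A j"
proof
  assume i: "i < m" and j: "j < m"
  { assume e: "rep m A i = rep m A j"
    have "block m A i = block m A (rep m A i)" using block_eq[OF rep_in[OF i]] by (rule sym)
    also have "\<dots> = block m A j" unfolding e by (rule block_eq[OF rep_in[OF j]])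
    finally show "block m A i = block m A j" . }
qed (simp add: rep_def)

lemma card_initial_less:
  fixes R :: "nat set"
  assumes "finite R" "a \<in> R" "a < b"
  shows "card {j\<in>R. j < a} < card {j\<in>R. j < b}"
  using assms by (intro psubset_card_mono) auto

lemma newidx_alt: "newidx m A i = card {j\<in>{j. j < m \<and> rep m A j = j}. j < rep m A i}"
  by (simp add: newidx_def conj_assoc)

text \<open>Counting the representatives below \<open>rep m A i\<close> is strictly increasing in
  \<open>rep m A i\<close>, hence injective on representatives, and a block is determined by its
  minimum.\<close>

lemma newidx_eq_iff:
  assumes i: "i < m" and j: "j < m"
  shows "newidx m A i = newidx m A j \<longleftrightarrow> block m A i = block m A j"
proof -
  let ?R = "{j. j < m \<and> rep m A j = j}"
  have lt: "newidx m A i < newidx m A j" if "i < m" "rep m A i < rep m A j" for i j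
    unfolding newidx_alt using that by (intro card_initial_less) (simp_all add: rep_less rep_rep)
  have "newidx m A i = newidx m A j \<longleftrightarrow> rep m A i = rep m A j"
    using lt[OF i, of j] lt[OF j, of i] by (cases "rep m A i" "rep m A j" rule: linorder_cases) (simp_all add: newidx_def)
  then show ?thesis using rep_eq_iff[OF i j] by blast
qed

lemma newidx_fibre: "i < m \<Longrightarrow> {j. j < m \<and> newidx m A j = newidx m A i} = block m A i"
proof (intro set_eqI iffI)
  fix j assume i: "i < m"
  { assume "j \<in> {j. j < m \<and> newidx m A j = newidx m A i}"
    then have j: "j < m" and e: "newidx m A j = newidx m A i" by auto
    from e have "block m A j = block m A i" using newidx_eq_iff[OF j i] by blast
    then show "j \<in> block m A i" using block_self[OF j, of A] by (simp only:) }
  { assume jb: "j \<in> block m A i"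
    then have j: "j < m" using block_less[OF i, of A] by auto
    moreover have "newidx m A j = newidx m A i" using newidx_eq_iff[OF j i] block_eq[OF jb] by blast
    ultimately show "j \<in> {j. j < m \<and> newidx m A j = newidx m A i}" by blast }
qed

lemma newidx_less: "i < m \<Longrightarrow> newidx m A i < newM m A"
  unfolding newidx_alt newM_def
proof (intro psubset_card_mono psubsetI)
  assume "i < m"
  then have "rep m A i \<in> {j. j < m \<and> rep m A j = j}" by (simp add: rep_less rep_rep)
  then show "{j \<in> {j. j < m \<and> rep m A j = j}. j < rep m A i} \<noteq> {j. j < m \<and> rep m A j = j}"
    by blast
qed auto

text \<open>Pigeonhole: distinct representatives receive distinct indices below \<open>newM\<close>,
  and there are exactly \<open>newM\<close> of them.\<close>

lemma newidx_surj: "k < newM m A \<Longrightarrow> \<exists>i<m. newidx m A i = k"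
proof -
  assume k: "k < newM m A"
  define R where "R = {j. j < m \<and> rep m A j = j}"
  have inj: "inj_on (newidx m A) R"
  proof (rule inj_onI)
    fix i j assume ij: "i \<in> R" "j \<in> R" "newidx m A i = newidx m A j"
    then have "rep m A i = rep m A j"
      using newidx_eq_iff[of i m j A] rep_eq_iff[of i m j A] unfolding R_def by blast
    then show "i = j" using ij unfolding R_def by simp
  qed
  have "newidx m A ` R \<subseteq> {..<newM m A}" unfolding R_def using newidx_less by auto
  moreover have "card (newidx m A ` R) = newM m A"
    using card_image[OF inj] by (simp add: newM_def R_def)
  ultimately have "newidx m A ` R = {..<newM m A}" by (intro card_subset_eq) auto
  with k have "k \<in> newidx m A ` R" by simp
  then obtain i where "i \<in> R" "k = newidx m A i" by (rule imageE)
  then show ?thesis unfolding R_def by (intro exI[of _ i]) simp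
qed

text \<open>A path between two states of an ergodic class cannot leave it, since the class is closed
  under positive transitions.\<close>

lemma irred_comm_class:
  assumes "ergodic m A i"
  shows "irred (comm_class m A i) A"
  unfolding irred_def
proof (intro ballI)
  let ?E = "comm_class m A i"
  fix a b assume ab: "a \<in> ?E" "b \<in> ?E"
  then have "reach m A a i" "reach m A i b" by (simp_all add: comm_class_def)
  then have "reach m A a b" by (rule reach_trans)
  then have "(a, b) \<in> {(a, b). a < m \<and> b < m \<and> A a b > 0}\<^sup>*" by (simp add: reach_def)
  then show "(a, b) \<in> {(a, b). a \<in> ?E \<and> b \<in> ?E \<and> A a b > 0}\<^sup>*"
    using ab(1)
  proof (induction rule: converse_rtrancl_induct)
    case base
    show ?case by simp
  next
    case (step y z)
    then have yz: "z < m" "A y z > 0" by auto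
    then have "z \<in> ?E" using assms step.prems unfolding ergodic_def by blast
    then have "(z, b) \<in> {(a, b). a \<in> ?E \<and> b \<in> ?E \<and> A a b > 0}\<^sup>*" by (rule step.IH)
    moreover have "(y, z) \<in> {(a, b). a \<in> ?E \<and> b \<in> ?E \<and> A a b > 0}"
      using yz step.prems \<open>z \<in> ?E\<close> by simp
    ultimately show ?case by (rule converse_rtrancl_into_rtrancl[rotated])
  qed
qed

lemma ergodic_closed:
  assumes "stoch m A" "ergodic m A i" "j \<in> block m A i" "l < m" "l \<notin> block m A i"
  shows "A j l = 0"
proof -
  have "j < m" using assms(2,3) block_less[of i m A] unfolding ergodic_def by blast
  then have "A j l \<ge> 0" using assms(1,4) unfolding stoch_def by blast
  moreover have "l \<notin> comm_class m A i" "j \<in> comm_class m A i"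
    using assms(2,3,5) by (simp_all add: block_def)
  then have "\<not> A j l > 0" using assms(2,4) unfolding ergodic_def by blast
  ultimately show "A j l = 0" by linarith
qed

lemma ergodic_row_sum:
  assumes "stoch m A" "ergodic m A i" "j \<in> block m A i"
  shows "(\<Sum>l\<in>block m A i. A j l) = 1"
proof -
  have sub: "block m A i \<subseteq> {..<m}" using assms(2) block_less[of i m A] unfolding ergodic_def by blast
  have "(\<Sum>l\<in>block m A i. A j l) = (\<Sum>l<m. A j l)"
    using sub ergodic_closed[OF assms] by (intro sum.mono_neutral_left) auto
  moreover have "j < m" using sub assms(3) by blast
  ultimately show ?thesis using assms(1) unfolding stoch_def by simp
qed

text \<open>\<open>lam\<close> is a definite description, so existence and uniqueness of the
  invariant probability must be established before any of its properties become available.\<close>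

lemma lam_ergodic:
  assumes st: "stoch m A" and erg: "ergodic m A i"
  shows "sum (lam m A) (block m A i) = 1"
    and "\<forall>j\<in>block m A i. lam m A j > 0"
    and "\<forall>j\<in>block m A i. lam m A j = (\<Sum>l\<in>block m A i. lam m A l * A l j)"
proof -
  let ?E = "block m A i"
  have im: "i < m" using erg by (simp add: ergodic_def)
  have sub: "?E \<subseteq> {..<m}" using im block_less by auto
  have fin: "finite ?E" by (rule finite_block)
  have ne: "?E \<noteq> {}" using block_self im by auto
  have nn: "\<forall>i\<in>?E. \<forall>j\<in>?E. A i j \<ge> 0" using st sub unfolding stoch_def by auto
  have irr: "irred ?E A" using irred_comm_class[OF erg] erg by (simp add: block_def)
  obtain v where v: "\<forall>i\<in>?E. v i \<ge> 0" "sum v ?E > 0" "\<forall>j\<in>?E. v j = (\<Sum>i\<in>?E. v i * A i j)"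
    using stationary_exists[OF fin ne nn] ergodic_row_sum[OF st erg] by blast
  define w where "w j = (if j \<in> ?E then v j / sum v ?E else 0)" for j
  define Inv where "Inv v \<longleftrightarrow> (\<forall>j. j \<notin> ?E \<longrightarrow> v j = 0) \<and> (\<forall>j\<in>?E. v j \<ge> 0) \<and>
              sum v ?E = 1 \<and> (\<forall>j\<in>?E. v j = (\<Sum>l\<in>?E. v l * A l j))" for v
  have w: "Inv w"
    unfolding Inv_def
  proof (intro conjI)
    show "\<forall>j\<in>?E. w j = (\<Sum>l\<in>?E. w l * A l j)"
    proof
      fix j assume j: "j \<in> ?E"
      have "(\<Sum>l\<in>?E. w l * A l j) = (\<Sum>l\<in>?E. v l * A l j) / sum v ?E"
        by (simp add: w_def sum_divide_distrib)
      then show "w j = (\<Sum>l\<in>?E. w l * A l j)" using v(3)[rule_format, OF j] j by (simp only: w_def if_True)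
    qed
    show "sum w ?E = 1" using v(2) by (simp add: w_def flip: sum_divide_distrib)
  qed (use v(1,2) in \<open>auto simp: w_def\<close>)
  have InvD: "\<forall>j. j \<notin> ?E \<longrightarrow> v j = 0" "\<forall>j\<in>?E. v j \<ge> 0" "sum v ?E = 1"
    "\<forall>j\<in>?E. v j = (\<Sum>l\<in>?E. v l * A l j)" if "Inv v" for v
    using that unfolding Inv_def by blast+
  note w' = InvD[OF w]
  have uniq: "u = w" if u: "Inv u" for u
  proof
    fix j
    note u' = InvD[OF u]
    obtain C where C: "\<forall>v w \<kappa>. (\<forall>i\<in>?E. v i \<ge> 0) \<longrightarrow> sum v ?E = 1 \<longrightarrow> 0 \<le> \<kappa> \<longrightarrow>
     (\<forall>j\<in>?E. \<bar>v j - (\<Sum>i\<in>?E. v i * A i j)\<bar> \<le> \<kappa>) \<longrightarrow>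
     (\<forall>i\<in>?E. w i \<ge> 0) \<longrightarrow> sum w ?E = 1 \<longrightarrow> (\<forall>j\<in>?E. w j = (\<Sum>i\<in>?E. w i * A i j)) \<longrightarrow>
     (\<forall>j\<in>?E. \<bar>v j - w j\<bar> \<le> C * \<kappa>)"
      using stationary_stable[OF fin nn irr ne] by blast
    show "u j = w j"
    proof (cases "j \<in> ?E")
      case True
      have d: "\<bar>u j - (\<Sum>i\<in>?E. u i * A i j)\<bar> \<le> 0" if j: "j \<in> ?E" for j
      proof -
        have "u j = (\<Sum>i\<in>?E. u i * A i j)" using u'(4) j by blast
        then show ?thesis by linarith
      qed
      \<comment> \<open>Both vectors are exactly invariant, so the stability bound is used with
        defect 0.\<close>
      have "\<bar>u j - w j\<bar> \<le> C * 0"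
      proof (rule C[rule_format])
        show "sum u ?E = 1" "sum w ?E = 1" by (fact u'(3) w'(3))+
        show "w j = (\<Sum>i\<in>?E. w i * A i j)" if "j \<in> ?E" for j using w'(4) that by blast
      qed (use u'(2) w'(2) d True in blast)+
      then show ?thesis by simp
    next
      case False
      then have "u j = 0" "w j = 0" using u'(1) w'(1) by auto
      then show ?thesis by simp
    qed
  qed
  \<comment> \<open>All states of the class have the same block and therefore share one definite
    description.\<close>
  have lam: "lam m A j = w j" if j: "j \<in> ?E" for j
  proof -
    have "ergodic m A j" using j erg ergodic_comm_class by (auto simp: block_def)
    then have "lam m A j = (THE v. Inv v) j"
      unfolding lam_def Inv_def block_eq[OF j] by simp
    also have "(THE v. Inv v) = w" using w uniq by (rule the_equality)
    finally show ?thesis .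
  qed
  show "sum (lam m A) ?E = 1" using w'(3) lam by simp
  show "\<forall>j\<in>?E. lam m A j = (\<Sum>l\<in>?E. lam m A l * A l j)"
  proof
    fix j assume j: "j \<in> ?E"
    have "(\<Sum>l\<in>?E. lam m A l * A l j) = (\<Sum>l\<in>?E. w l * A l j)"
      by (intro sum.cong) (auto simp: lam)
    then show "lam m A j = (\<Sum>l\<in>?E. lam m A l * A l j)"
      using lam[OF j] w'(4)[rule_format, OF j] by presburger
  qed
  show "\<forall>j\<in>?E. lam m A j > 0"
  proof
    fix j assume j: "j \<in> ?E"
    have "sum w ?E > 0" using w'(3) by simp
    from stationary_pos[OF fin nn irr w'(2) this w'(4) j] show "lam m A j > 0"
      using lam[OF j] by simp
  qed
qed

lemma lam_pos: "stoch m A \<Longrightarrow> i < m \<Longrightarrow> lam m A i > 0"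
  using lam_ergodic(2)[of m A i] block_self[of i m A] by (cases "ergodic m A i") (blast, simp add: lam_def)

section \<open>Flows\<close>

text \<open>\<open>W i\<close> is the expected number of visits to \<open>i\<close>, \<open>F i j\<close> the expected number of jumps from \<open>i\<close> to \<open>j\<close>
  before leaving \<open>K\<close>, and \<open>b\<close> the initial mass. Only relative closeness of \<open>F i j\<close> to \<open>P i j * W i\<close> is
  required, because the kernels of the process depend on the point inside \<open>S i\<close>.\<close>
definition flow :: "nat \<Rightarrow> (nat \<Rightarrow> nat \<Rightarrow> real) \<Rightarrow> real \<Rightarrow> nat set \<Rightarrow>
    (nat \<Rightarrow> real) \<Rightarrow> (nat \<Rightarrow> real) \<Rightarrow> (nat \<Rightarrow> nat \<Rightarrow> real) \<Rightarrow> bool" where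
  "flow m P \<eta> K b W F \<longleftrightarrow> (\<forall>i\<in>K. 0 \<le> b i) \<and> (\<forall>i\<in>K. 0 \<le> W i) \<and> (\<forall>i\<in>K. \<forall>j<m. 0 \<le> F i j) \<and>
    (\<forall>i\<in>K. \<forall>j<m. near \<eta> (F i j) (P i j * W i)) \<and>
    (\<forall>i\<in>K. (\<Sum>j<m. F i j) = W i) \<and> (\<forall>j\<in>K. W j = b j + (\<Sum>i\<in>K. F i j))"

lemma flowD:
  assumes "flow m P \<eta> K b W F"
  shows "i \<in> K \<Longrightarrow> 0 \<le> b i" "i \<in> K \<Longrightarrow> 0 \<le> W i" "i \<in> K \<Longrightarrow> j < m \<Longrightarrow> 0 \<le> F i j"
    "i \<in> K \<Longrightarrow> j < m \<Longrightarrow> near \<eta> (F i j) (P i j * W i)" "i \<in> K \<Longrightarrow> (\<Sum>j<m. F i j) = W i"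
    "j \<in> K \<Longrightarrow> W j = b j + (\<Sum>i\<in>K. F i j)"
  using assms unfolding flow_def by blast+

lemma flow_mono:
  assumes fl: "flow m P \<eta> K b W F" and "\<eta> \<le> \<eta>'" "\<forall>i\<in>K. \<forall>j<m. 0 \<le> P i j"
  shows "flow m P \<eta>' K b W F"
proof -
  have "near \<eta>' (F i j) (P i j * W i)" if "i \<in> K" "j < m" for i j
    using flowD(4)[OF fl that] assms(2) by (rule near_mono) (use that assms(3) flowD(2)[OF fl] in simp)
  then show ?thesis using fl unfolding flow_def by blast
qed

lemma flow_source_cong:
  assumes e: "\<And>j. j \<in> K \<Longrightarrow> b j = b' j" and fl: "flow m P \<eta> K b W F"
  shows "flow m P \<eta> K b' W F"
  unfolding flow_def
proof (intro conjI ballI allI impI)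
  fix j assume j: "j \<in> K"
  show "0 \<le> b' j" using flowD(1)[OF fl j] e[OF j] by simp
  show "W j = b' j + (\<Sum>i\<in>K. F i j)" using flowD(6)[OF fl j] e[OF j] by linarith
qed (fact flowD[OF fl])+

text \<open>The row sums and the balance equations, each added over \<open>K\<close>, both count the
  jumps inside \<open>K\<close>; cancelling these equates the mass that leaves with the mass that
  enters.\<close>

lemma flow_conservation:
  assumes fl: "flow m P \<eta> K b W F" and K: "K \<subseteq> {..<m}"
  shows "(\<Sum>i\<in>K. \<Sum>j\<in>{..<m} - K. F i j) = sum b K"
proof -
  have fin: "finite K" using K finite_subset by blast
  have "sum W K = (\<Sum>i\<in>K. (\<Sum>j\<in>K. F i j) + (\<Sum>j\<in>{..<m} - K. F i j))"
  proof (rule sum.cong)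
    fix i assume "i \<in> K"
    then have "W i = (\<Sum>j<m. F i j)" using flowD(5)[OF fl] by simp
    also have "\<dots> = (\<Sum>j\<in>{..<m} - K. F i j) + (\<Sum>j\<in>K. F i j)" using K by (intro sum.subset_diff) auto
    finally show "W i = (\<Sum>j\<in>K. F i j) + (\<Sum>j\<in>{..<m} - K. F i j)" by simp
  qed simp
  moreover have "sum W K = (\<Sum>j\<in>K. b j + (\<Sum>i\<in>K. F i j))"
    using flowD(6)[OF fl] by (intro sum.cong) auto
  moreover have "(\<Sum>j\<in>K. \<Sum>i\<in>K. F i j) = (\<Sum>i\<in>K. \<Sum>j\<in>K. F i j)" by (rule sum.swap)
  ultimately show ?thesis by (simp add: sum.distrib)
qed

text \<open>Jumps arriving in \<open>L\<close> from the rest of \<open>K\<close> become part of the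
  source.\<close>

lemma flow_restrict:
  assumes fl: "flow m P \<eta> K b W F" and L: "L \<subseteq> K" and K: "K \<subseteq> {..<m}"
  shows "flow m P \<eta> L (\<lambda>j. b j + (\<Sum>i\<in>K - L. F i j)) W F"
proof -
  have fin: "finite K" using K finite_subset by blast
  have "W j = b j + (\<Sum>i\<in>K - L. F i j) + (\<Sum>i\<in>L. F i j)" if "j \<in> L" for j
    using flowD(6)[OF fl, of j] that L sum.subset_diff[OF L fin, of "\<lambda>i. F i j"] by auto
  moreover have "0 \<le> b j + (\<Sum>i\<in>K - L. F i j)" if "j \<in> L" for j
  proof -
    have "j \<in> K" "j < m" using that L K by auto
    then show ?thesis using flowD(1,3)[OF fl] by (intro add_nonneg_nonneg sum_nonneg) auto
  qed
  ultimately show ?thesis using flowD(2-5)[OF fl] L unfolding flow_def by blast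
qed

lemma sum_fibres:
  fixes c :: "nat \<Rightarrow> nat"
  assumes "finite E"
  shows "(\<Sum>a\<in>E. \<Sum>i\<in>{i. i < M \<and> c i = a}. h i) = (\<Sum>i\<in>{i. i < M \<and> c i \<in> E}. h i)"
proof -
  have "(\<Sum>a\<in>E. \<Sum>i\<in>{i. i < M \<and> c i = a}. h i) = (\<Sum>a\<in>E. sum h {i \<in> {i. i < M \<and> c i \<in> E}. c i = a})"
    by (intro sum.cong) auto
  also have "\<dots> = (\<Sum>i\<in>{i. i < M \<and> c i \<in> E}. h i)" using assms by (intro sum.group) auto
  finally show ?thesis .
qed

lemma eventually_pos_at_right: "\<forall>\<^sub>F \<epsilon>::real in at_right 0. 0 < \<epsilon>"
  by (simp add: eventually_at_right_less)

text \<open>By \<open>mono\<close> a tolerance may be decreased, so the minimum of finitely many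
  tolerances serves all indices.\<close>

lemma uniform_eta:
  fixes Q :: "nat \<Rightarrow> real \<Rightarrow> real \<Rightarrow> bool"
  assumes "\<And>k. k < n \<Longrightarrow> \<exists>\<eta>>0. \<forall>\<^sub>F \<epsilon> in at_right 0. Q k \<eta> \<epsilon>"
    and mono: "\<And>k \<eta> \<eta>' \<epsilon>. \<eta> \<le> \<eta>' \<Longrightarrow> 0 < \<epsilon> \<Longrightarrow> Q k \<eta>' \<epsilon> \<Longrightarrow> Q k \<eta> \<epsilon>"
  shows "\<exists>\<eta>>0. \<forall>\<^sub>F \<epsilon> in at_right 0. \<forall>k<n. Q k \<eta> \<epsilon>"
  using assms(1)
proof (induction n)
  case 0
  show ?case by (intro exI[of _ 1]) simp
next
  case (Suc n)
  then obtain \<eta>1 where 1: "\<eta>1 > 0" "\<forall>\<^sub>F \<epsilon> in at_right 0. \<forall>k<n. Q k \<eta>1 \<epsilon>" by force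
  obtain \<eta>2 where 2: "\<eta>2 > 0" "\<forall>\<^sub>F \<epsilon> in at_right 0. Q n \<eta>2 \<epsilon>" using Suc.prems[of n] by blast
  have "\<forall>\<^sub>F \<epsilon> in at_right 0. \<forall>k<Suc n. Q k (min \<eta>1 \<eta>2) \<epsilon>"
    using 1(2) 2(2) eventually_pos_at_right
  proof eventually_elim
    case (elim \<epsilon>)
    show ?case
    proof (intro allI impI)
      fix k assume "k < Suc n"
      then show "Q k (min \<eta>1 \<eta>2) \<epsilon>"
        using mono[of "min \<eta>1 \<eta>2" \<eta>1 \<epsilon> k] mono[of "min \<eta>1 \<eta>2" \<eta>2 \<epsilon> k] elim less_Suc_eq[of k n] by auto
    qed
  qed
  then show ?case using 1 2 by (intro exI[of _ "min \<eta>1 \<eta>2"]) auto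
qed

section \<open>Transition matrices with entries in an asymptotic scale\<close>

text \<open>Abstracts the comparison of orders of magnitude behind hypothesis (f). The closure
  properties are the operations from which \<open>newP\<close> is built. \<open>G_lim\<close> also
  permits divergence to infinity, since a quotient of small quantities may blow up.\<close>

locale asymp_class =
  fixes G :: "(real \<Rightarrow> real) set"
  assumes G_pos: "f \<in> G \<Longrightarrow> 0 < \<epsilon> \<Longrightarrow> 0 < f \<epsilon>"
    and G_cong: "f \<in> G \<Longrightarrow> (\<And>\<epsilon>. 0 < \<epsilon> \<Longrightarrow> g \<epsilon> = f \<epsilon>) \<Longrightarrow> g \<in> G"
    and G_add: "f \<in> G \<Longrightarrow> g \<in> G \<Longrightarrow> (\<lambda>\<epsilon>. f \<epsilon> + g \<epsilon>) \<in> G"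
    and G_cmult: "f \<in> G \<Longrightarrow> 0 < c \<Longrightarrow> (\<lambda>\<epsilon>. c * f \<epsilon>) \<in> G"
    and G_divide: "f \<in> G \<Longrightarrow> g \<in> G \<Longrightarrow> (\<lambda>\<epsilon>. f \<epsilon> / g \<epsilon>) \<in> G"
    and G_lim: "f \<in> G \<Longrightarrow> (\<exists>l. (f \<longlongrightarrow> l) (at_right 0)) \<or> ((\<lambda>\<epsilon>. 1 / f \<epsilon>) \<longlongrightarrow> 0) (at_right 0)"
begin

text \<open>\<open>G\<close> contains only positive functions, which makes division possible;
  identically vanishing entries are added separately.\<close>

definition G0 :: "(real \<Rightarrow> real) \<Rightarrow> bool" where
  "G0 f \<longleftrightarrow> (\<forall>\<epsilon>>0. f \<epsilon> = 0) \<or> f \<in> G"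

lemma G0_nonneg: "G0 f \<Longrightarrow> 0 < \<epsilon> \<Longrightarrow> 0 \<le> f \<epsilon>"
  unfolding G0_def using G_pos by (metis less_imp_le order_refl)

lemma G0_add: "G0 f \<Longrightarrow> G0 g \<Longrightarrow> G0 (\<lambda>\<epsilon>. f \<epsilon> + g \<epsilon>)"
  unfolding G0_def
  using G_add[of f g] G_cong[of f "\<lambda>\<epsilon>. f \<epsilon> + g \<epsilon>"] G_cong[of g "\<lambda>\<epsilon>. f \<epsilon> + g \<epsilon>"] by auto

lemma G0_sum: "finite I \<Longrightarrow> (\<And>i. i \<in> I \<Longrightarrow> G0 (f i)) \<Longrightarrow> G0 (\<lambda>\<epsilon>. \<Sum>i\<in>I. f i \<epsilon>)"
proof (induction I rule: finite_induct)
  case empty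
  then show ?case by (simp add: G0_def)
next
  case (insert i I)
  then show ?case using G0_add[of "f i" "\<lambda>\<epsilon>. \<Sum>i\<in>I. f i \<epsilon>"] by simp
qed

lemma G0_cmult: "G0 f \<Longrightarrow> 0 < c \<Longrightarrow> G0 (\<lambda>\<epsilon>. c * f \<epsilon>)"
  unfolding G0_def using G_cmult[of f c] by auto

lemma G0_divide: "G0 f \<Longrightarrow> g \<in> G \<Longrightarrow> G0 (\<lambda>\<epsilon>. f \<epsilon> / g \<epsilon>)"
  unfolding G0_def using G_divide[of f g] by auto

lemma G0_in_G: "G0 f \<Longrightarrow> 0 < \<epsilon> \<Longrightarrow> 0 < f \<epsilon> \<Longrightarrow> f \<in> G"
  unfolding G0_def by force

text \<open>The properties of a transition matrix that pass from one rank to the next. Communication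
  uses the edges positive for every \<epsilon>, not only those that survive in the limit.\<close>

definition good :: "nat \<Rightarrow> (real \<Rightarrow> nat \<Rightarrow> nat \<Rightarrow> real) \<Rightarrow> bool" where
  "good m P \<longleftrightarrow> (\<forall>\<epsilon>>0. \<forall>i<m. P \<epsilon> i i = 0) \<and> (\<forall>i<m. \<forall>j<m. G0 (\<lambda>\<epsilon>. P \<epsilon> i j)) \<and>
     (\<forall>\<epsilon>>0. \<forall>i<m. (\<Sum>j<m. P \<epsilon> i j) = 1) \<and>
     (\<forall>i<m. \<forall>j<m. (i, j) \<in> {(a, b). a < m \<and> b < m \<and> (\<forall>\<epsilon>>0. P \<epsilon> a b > 0)}\<^sup>*)"

lemma goodD:
  assumes "good m P"
  shows "0 < \<epsilon> \<Longrightarrow> i < m \<Longrightarrow> P \<epsilon> i i = 0" "i < m \<Longrightarrow> j < m \<Longrightarrow> G0 (\<lambda>\<epsilon>. P \<epsilon> i j)"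
    "0 < \<epsilon> \<Longrightarrow> i < m \<Longrightarrow> (\<Sum>j<m. P \<epsilon> i j) = 1"
    "i < m \<Longrightarrow> j < m \<Longrightarrow> (i, j) \<in> {(a, b). a < m \<and> b < m \<and> (\<forall>\<epsilon>>0. P \<epsilon> a b > 0)}\<^sup>*"
  using assms unfolding good_def by blast+

lemma good_nonneg: "good m P \<Longrightarrow> 0 < \<epsilon> \<Longrightarrow> i < m \<Longrightarrow> j < m \<Longrightarrow> 0 \<le> P \<epsilon> i j"
  using G0_nonneg[OF goodD(2)] by blast

lemma good_le_1:
  assumes "good m P" "0 < \<epsilon>" "i < m" "j < m"
  shows "P \<epsilon> i j \<le> 1"
proof -
  have "P \<epsilon> i j \<le> (\<Sum>j<m. P \<epsilon> i j)"
    using assms good_nonneg by (intro member_le_sum) auto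
  then show ?thesis using goodD(3)[OF assms(1-3)] by simp
qed

text \<open>Divergence to infinity, the second alternative of \<open>G_lim\<close>, is excluded
  because the entries are at most 1.\<close>

lemma good_lim:
  assumes g: "good m P" and ij: "i < m" "j < m"
  shows "((\<lambda>\<epsilon>. P \<epsilon> i j) \<longlongrightarrow> lim0 P i j) (at_right 0)"
proof -
  note ev = eventually_pos_at_right
  have "\<exists>l. ((\<lambda>\<epsilon>. P \<epsilon> i j) \<longlongrightarrow> l) (at_right 0)"
  proof (cases "\<forall>\<epsilon>>0. P \<epsilon> i j = 0")
    case True
    then have "\<forall>\<^sub>F \<epsilon> in at_right 0. P \<epsilon> i j = 0" using ev by (auto elim!: eventually_mono)
    then have "((\<lambda>\<epsilon>. P \<epsilon> i j) \<longlongrightarrow> 0) (at_right 0)" by (rule tendsto_eventually)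
    then show ?thesis by blast
  next
    case False
    then have inG: "(\<lambda>\<epsilon>. P \<epsilon> i j) \<in> G" using goodD(2)[OF g ij] unfolding G0_def by blast
    have "\<not> ((\<lambda>\<epsilon>. 1 / P \<epsilon> i j) \<longlongrightarrow> 0) (at_right 0)"
    proof
      assume lim: "((\<lambda>\<epsilon>. 1 / P \<epsilon> i j) \<longlongrightarrow> 0) (at_right 0)"
      have "\<forall>\<^sub>F \<epsilon> in at_right 0. 1 \<le> 1 / P \<epsilon> i j"
        using ev
      proof (rule eventually_mono)
        fix \<epsilon> :: real assume "0 < \<epsilon>"
        then show "1 \<le> 1 / P \<epsilon> i j" using good_le_1[OF g _ ij] G_pos[OF inG] by simp
      qed
      then have "1 \<le> (0::real)" using lim by (intro tendsto_lowerbound[OF lim]) auto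
      then show False by simp
    qed
    then show ?thesis using G_lim[OF inG] by blast
  qed
  then obtain l where l: "((\<lambda>\<epsilon>. P \<epsilon> i j) \<longlongrightarrow> l) (at_right 0)" by blast
  then have "lim0 P i j = l" unfolding lim0_def by (intro tendsto_Lim) auto
  then show ?thesis using l by simp
qed

lemma good_stoch:
  assumes g: "good m P"
  shows "stoch m (lim0 P)"
  unfolding stoch_def
proof (intro conjI allI impI)
  note ev = eventually_pos_at_right
  fix i j assume ij: "i < m" "j < m"
  show "0 \<le> lim0 P i j"
  proof (rule tendsto_lowerbound[OF good_lim[OF g ij]])
    show "\<forall>\<^sub>F \<epsilon> in at_right 0. 0 \<le> P \<epsilon> i j" using ev good_nonneg[OF g _ ij] by (rule eventually_mono)
  qed simp
next
  note ev = eventually_pos_at_right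
  fix i assume i: "i < m"
  have "((\<lambda>\<epsilon>. \<Sum>j<m. P \<epsilon> i j) \<longlongrightarrow> (\<Sum>j<m. lim0 P i j)) (at_right 0)"
    using good_lim[OF g i] by (intro tendsto_sum) auto
  moreover have "\<forall>\<^sub>F \<epsilon> in at_right 0. (\<Sum>j<m. P \<epsilon> i j) = 1"
    using ev goodD(3)[OF g _ i] by (rule eventually_mono)
  then have "((\<lambda>\<epsilon>. \<Sum>j<m. P \<epsilon> i j) \<longlongrightarrow> 1) (at_right 0)" by (rule tendsto_eventually)
  ultimately show "(\<Sum>j<m. lim0 P i j) = 1"
    by (intro tendsto_unique[of "at_right (0::real)"]) auto
qed

section \<open>The cells of one aggregation step and the matrix of the next rank\<close>

definition cell :: "nat \<Rightarrow> (real \<Rightarrow> nat \<Rightarrow> nat \<Rightarrow> real) \<Rightarrow> nat \<Rightarrow> nat set" where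
  "cell m P k = {i. i < m \<and> newidx m (lim0 P) i = k}"

text \<open>The denominator of \<open>newP\<close>: the probability, at the given \<epsilon>, of
  leaving the cell in one step when started from its limiting invariant distribution.\<close>

definition den :: "nat \<Rightarrow> (real \<Rightarrow> nat \<Rightarrow> nat \<Rightarrow> real) \<Rightarrow> real \<Rightarrow> nat \<Rightarrow> real" where
  "den m P \<epsilon> k = (\<Sum>i\<in>cell m P k. \<Sum>j\<in>{..<m} - cell m P k. lam m (lim0 P) i * P \<epsilon> i j)"

lemma cell_block: "k < newM m (lim0 P) \<Longrightarrow> \<exists>i<m. cell m P k = block m (lim0 P) i"
proof -
  assume "k < newM m (lim0 P)"
  then obtain i where i: "i < m" "newidx m (lim0 P) i = k" using newidx_surj by blast
  show ?thesis using newidx_fibre[OF i(1), of "lim0 P"] i unfolding cell_def by auto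
qed

lemma finite_cell: "finite (cell m P k)"
  by (simp add: cell_def)

lemma cell_subset: "cell m P k \<subseteq> {..<m}"
  by (auto simp: cell_def)

lemma newP_eq: "k \<noteq> l \<Longrightarrow> newP m (lim0 P) P \<epsilon> k l =
   (\<Sum>i\<in>cell m P k. \<Sum>j\<in>cell m P l. lam m (lim0 P) i * P \<epsilon> i j) / den m P \<epsilon> k"
proof -
  have e: "{..<m} - cell m P k = {j. j < m \<and> newidx m (lim0 P) j \<noteq> k}" by (auto simp: cell_def)
  assume "k \<noteq> l"
  then show ?thesis unfolding den_def e by (simp add: newP_def cell_def)
qed

lemma rtrancl_leaves:
  assumes "(a, b) \<in> r\<^sup>*" "a \<in> E" "b \<notin> E"
  shows "\<exists>u v. (u, v) \<in> r \<and> u \<in> E \<and> v \<notin> E"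
  using assms by (induction rule: rtrancl_induct) blast+

text \<open>Communication yields an edge leaving the cell, so the sum does not vanish identically;
  by the dichotomy in \<open>G0\<close>, positivity at the single value 1 suffices.\<close>

lemma den_G:
  assumes g: "good m P" and nM: "1 < newM m (lim0 P)" and k: "k < newM m (lim0 P)"
  shows "(\<lambda>\<epsilon>. den m P \<epsilon> k) \<in> G"
proof -
  have lp: "0 < lam m (lim0 P) i" if "i < m" for i using lam_pos[OF good_stoch[OF g] that] .
  have summand: "G0 (\<lambda>\<epsilon>. lam m (lim0 P) i * P \<epsilon> i j)" if "i < m" "j < m" for i j
    using G0_cmult[OF goodD(2)[OF g that] lp[OF that(1)]] .
  have G0: "G0 (\<lambda>\<epsilon>. den m P \<epsilon> k)" unfolding den_def
    by (intro G0_sum summand) (auto simp: cell_def)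
  obtain i where i: "i < m" "newidx m (lim0 P) i = k" using newidx_surj[OF k] by blast
  define l where "l = (if k = 0 then 1 else 0 :: nat)"
  have "l < newM m (lim0 P)" "l \<noteq> k" using nM by (auto simp: l_def)
  then obtain j where j: "j < m" "newidx m (lim0 P) j = l" using newidx_surj by blast
  have "i \<in> cell m P k" "j \<notin> cell m P k" using i j \<open>l \<noteq> k\<close> by (auto simp: cell_def)
  from rtrancl_leaves[OF goodD(4)[OF g i(1) j(1)] this]
  obtain u v where uv: "u \<in> cell m P k" "v \<notin> cell m P k" "u < m" "v < m" "\<forall>\<epsilon>>0. P \<epsilon> u v > 0" by auto
  have nn: "0 \<le> lam m (lim0 P) i * P 1 i j" if "i < m" "j < m" for i j
    using G0_nonneg[OF summand[OF that], of 1] by simp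
  have "0 < lam m (lim0 P) u * P 1 u v" using uv lp by simp
  also have "\<dots> \<le> (\<Sum>j\<in>{..<m} - cell m P k. lam m (lim0 P) u * P 1 u j)"
    using uv nn by (intro member_le_sum) auto
  also have "\<dots> \<le> den m P 1 k" unfolding den_def
    using uv nn cell_subset[of m P k] finite_cell
    by (intro member_le_sum[of u _ "\<lambda>i. \<Sum>j\<in>{..<m} - cell m P k. lam m (lim0 P) i * P 1 i j"] sum_nonneg) auto
  finally show ?thesis using G0_in_G[OF G0, of 1] by simp
qed

lemma newP_G0:
  assumes g: "good m P" and nM: "1 < newM m (lim0 P)" and k: "k < newM m (lim0 P)"
  shows "G0 (\<lambda>\<epsilon>. newP m (lim0 P) P \<epsilon> k l)"
proof (cases "k = l")
  case True
  then show ?thesis by (simp add: G0_def newP_def)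
next
  case False
  have lp: "0 < lam m (lim0 P) i" if "i < m" for i using lam_pos[OF good_stoch[OF g] that] .
  have "G0 (\<lambda>\<epsilon>. lam m (lim0 P) i * P \<epsilon> i j)" if "i < m" "j < m" for i j
    using G0_cmult[OF goodD(2)[OF g that] lp[OF that(1)]] .
  then have "G0 (\<lambda>\<epsilon>. \<Sum>i\<in>cell m P k. \<Sum>j\<in>cell m P l. lam m (lim0 P) i * P \<epsilon> i j)"
    by (intro G0_sum) (auto simp: cell_def)
  from G0_divide[OF this den_G[OF g nM k]] show ?thesis using newP_eq[OF False] by simp
qed

text \<open>Rows sum to 1 because the denominator collects the numerators of all other cells.
  Communication survives since every edge either stays inside a cell or projects to an edge between
  cells.\<close>

lemma good_newP:
  assumes g: "good m P" and nM: "1 < newM m (lim0 P)"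
  shows "good (newM m (lim0 P)) (newP m (lim0 P) P)"
  unfolding good_def
proof (intro conjI allI impI)
  fix k l assume "k < newM m (lim0 P)" "l < newM m (lim0 P)"
  then show "G0 (\<lambda>\<epsilon>. newP m (lim0 P) P \<epsilon> k l)" using newP_G0[OF g nM] by blast
next
  fix \<epsilon> :: real and k assume "0 < \<epsilon>" "k < newM m (lim0 P)"
  show "newP m (lim0 P) P \<epsilon> k k = 0" by (simp add: newP_def)
next
  fix \<epsilon> :: real and k assume e: "0 < \<epsilon>" and k: "k < newM m (lim0 P)"
  let ?n = "newM m (lim0 P)"
  have "(\<Sum>l<?n. newP m (lim0 P) P \<epsilon> k l) = (\<Sum>l\<in>{..<?n} - {k}. newP m (lim0 P) P \<epsilon> k l)"
    by (intro sum.mono_neutral_right) (auto simp: newP_def)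
  also have "\<dots> = (\<Sum>l\<in>{..<?n} - {k}. (\<Sum>i\<in>cell m P k. \<Sum>j\<in>cell m P l. lam m (lim0 P) i * P \<epsilon> i j) / den m P \<epsilon> k)"
    by (intro sum.cong) (auto simp: newP_eq)
  also have "\<dots> = (\<Sum>l\<in>{..<?n} - {k}. \<Sum>i\<in>cell m P k. \<Sum>j\<in>cell m P l. lam m (lim0 P) i * P \<epsilon> i j) / den m P \<epsilon> k"
    by (simp add: sum_divide_distrib)
  also have "(\<Sum>l\<in>{..<?n} - {k}. \<Sum>i\<in>cell m P k. \<Sum>j\<in>cell m P l. lam m (lim0 P) i * P \<epsilon> i j) =
      (\<Sum>i\<in>cell m P k. \<Sum>l\<in>{..<?n} - {k}. \<Sum>j\<in>cell m P l. lam m (lim0 P) i * P \<epsilon> i j)"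
    by (rule sum.swap)
  also have "\<dots> = den m P \<epsilon> k"
    unfolding den_def
  proof (rule sum.cong[OF refl])
    fix i
    have "{..<m} - cell m P k = {j. j < m \<and> newidx m (lim0 P) j \<in> {..<?n} - {k}}"
      using newidx_less by (auto simp: cell_def)
    then show "(\<Sum>l\<in>{..<?n} - {k}. \<Sum>j\<in>cell m P l. lam m (lim0 P) i * P \<epsilon> i j) =
        (\<Sum>j\<in>{..<m} - cell m P k. lam m (lim0 P) i * P \<epsilon> i j)"
      unfolding cell_def[of m P l for l] by (simp add: sum_fibres)
  qed
  finally show "(\<Sum>l<?n. newP m (lim0 P) P \<epsilon> k l) = 1"
    using G_pos[OF den_G[OF g nM k] e] by simp
next
  fix k l assume k: "k < newM m (lim0 P)" and l: "l < newM m (lim0 P)"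
  let ?n = "newM m (lim0 P)" and ?x = "newidx m (lim0 P)"
  let ?R = "{(a, b). a < ?n \<and> b < ?n \<and> (\<forall>\<epsilon>>0. newP m (lim0 P) P \<epsilon> a b > 0)}"
  obtain i j where ij: "i < m" "?x i = k" "j < m" "?x j = l" using newidx_surj[OF k] newidx_surj[OF l] by blast
  have lp: "0 < lam m (lim0 P) i" if "i < m" for i using lam_pos[OF good_stoch[OF g] that] .
  have edge: "(?x a, ?x b) \<in> ?R\<^sup>*" if ab: "a < m" "b < m" "\<forall>\<epsilon>>0. P \<epsilon> a b > 0" for a b
  proof (cases "?x a = ?x b")
    case False
    have "newP m (lim0 P) P \<epsilon> (?x a) (?x b) > 0" if e: "0 < \<epsilon>" for \<epsilon>
    proof -
      have nn: "0 \<le> lam m (lim0 P) i * P \<epsilon> i j" if "i < m" "j < m" for i j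
        using lp[OF that(1)] good_nonneg[OF g e that] by simp
      have "0 < lam m (lim0 P) a * P \<epsilon> a b" using ab lp e by simp
      also have "\<dots> \<le> (\<Sum>j\<in>cell m P (?x b). lam m (lim0 P) a * P \<epsilon> a j)"
        using ab nn by (intro member_le_sum) (auto simp: cell_def)
      also have "\<dots> \<le> (\<Sum>i\<in>cell m P (?x a). \<Sum>j\<in>cell m P (?x b). lam m (lim0 P) i * P \<epsilon> i j)"
        using ab nn by (intro member_le_sum[of a _ "\<lambda>i. \<Sum>j\<in>cell m P (?x b). lam m (lim0 P) i * P \<epsilon> i j"] sum_nonneg)
          (auto simp: cell_def)
      finally show ?thesis
        using G_pos[OF den_G[OF g nM newidx_less[OF ab(1)]] e] by (simp add: newP_eq[OF False])
    qed
    then show ?thesis using newidx_less ab by (intro r_into_rtrancl) auto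
  qed simp
  have "(?x i, ?x j) \<in> ?R\<^sup>*"
    using goodD(4)[OF g ij(1,3)]
  proof (induction rule: rtrancl_induct)
    case (step b c)
    then have "(?x b, ?x c) \<in> ?R\<^sup>*" using edge[of b c] by blast
    with step.IH show ?case by (rule rtrancl_trans)
  qed simp
  then show "(k, l) \<in> ?R\<^sup>*" using ij by simp
qed

text \<open>Since the probability of leaving an ergodic class tends to zero, the normalised occupation
  vector is nearly invariant under the limit matrix.\<close>
lemma flow_near_lam:
  assumes g: "good m P" and i0: "i0 < m" and \<delta>: "0 < \<delta>"
  shows "\<exists>\<eta>>0. \<forall>\<^sub>F \<epsilon> in at_right 0. \<forall>B V F. flow m (P \<epsilon>) \<eta> (block m (lim0 P) i0) B V F \<longrightarrow>
     (\<forall>j\<in>block m (lim0 P) i0. near \<delta> (V j) (lam m (lim0 P) j * sum V (block m (lim0 P) i0)))"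
proof (cases "ergodic m (lim0 P) i0")
  case False
  \<comment> \<open>A transient state is a block of its own with weight 1, and the claim holds
    without error.\<close>
  then have blk: "block m (lim0 P) i0 = {i0}" by (simp add: block_def)
  have l1: "lam m (lim0 P) i0 = 1" using False by (simp add: lam_def)
  have "near \<delta> (V i0) (V i0)" if "flow m (P \<epsilon>) 1 {i0} B V F" for \<epsilon> B V F
    using near_refl[of \<delta> "V i0"] \<delta> flowD(2)[OF that] by simp
  then show ?thesis unfolding blk by (intro exI[of _ 1]) (auto simp: l1)
next
  case True
  let ?A = "lim0 P" and ?E = "block m (lim0 P) i0"
  have st: "stoch m ?A" by (rule good_stoch[OF g])
  have sub: "?E \<subseteq> {..<m}" using block_less[OF i0] .
  have fin: "finite ?E" by (rule finite_block)
  have ne: "?E \<noteq> {}" using block_self[OF i0, of ?A] by blast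
  have nnA: "\<forall>i\<in>?E. \<forall>j\<in>?E. ?A i j \<ge> 0" using st sub unfolding stoch_def by blast
  have irr: "irred ?E ?A" using irred_comm_class[OF True] True by (simp add: block_def)
  note lam = lam_ergodic[OF st True]
  obtain C where C0: "C \<ge> 0" and C: "\<And>v w \<kappa> j. (\<forall>i\<in>?E. v i \<ge> 0) \<Longrightarrow> sum v ?E = 1 \<Longrightarrow> 0 \<le> \<kappa> \<Longrightarrow>
     (\<forall>j\<in>?E. \<bar>v j - (\<Sum>i\<in>?E. v i * ?A i j)\<bar> \<le> \<kappa>) \<Longrightarrow>
     (\<forall>i\<in>?E. w i \<ge> 0) \<Longrightarrow> sum w ?E = 1 \<Longrightarrow> (\<forall>j\<in>?E. w j = (\<Sum>i\<in>?E. w i * ?A i j)) \<Longrightarrow>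
     j \<in> ?E \<Longrightarrow> \<bar>v j - w j\<bar> \<le> C * \<kappa>"
    using stationary_stable[OF fin nnA irr ne] by blast
  define \<mu> where "\<mu> = Min (lam m ?A ` ?E)"
  have \<mu>: "\<mu> > 0" "\<And>j. j \<in> ?E \<Longrightarrow> \<mu> \<le> lam m ?A j"
    unfolding \<mu>_def using fin ne lam(2) by auto
  \<comment> \<open>The stability bound turns a defect \<open>\<kappa>\<close> into an absolute
    error of at most \<open>\<delta> * \<mu>\<close>; as \<open>\<mu>\<close> is the least weight in
    the class, this is a relative error \<open>\<delta>\<close>.\<close>
  define \<kappa> where "\<kappa> = \<delta> * \<mu> / (C + 1)"
  have \<kappa>: "\<kappa> > 0" "C * \<kappa> \<le> \<delta> * \<mu>"
    using \<delta> \<mu>(1) C0 by (auto simp: \<kappa>_def field_simps)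
  define \<Delta> where "\<Delta> \<epsilon> = (\<Sum>i<m. \<Sum>j<m. \<bar>P \<epsilon> i j - ?A i j\<bar>)" for \<epsilon>
  have "((\<lambda>\<epsilon>. \<Delta> \<epsilon>) \<longlongrightarrow> (\<Sum>i<m. \<Sum>j<m. \<bar>?A i j - ?A i j\<bar>)) (at_right 0)"
    unfolding \<Delta>_def using good_lim[OF g] by (intro tendsto_intros) auto
  then have "(\<Delta> \<longlongrightarrow> 0) (at_right 0)" by simp
  then have ev\<Delta>: "\<forall>\<^sub>F \<epsilon> in at_right 0. \<Delta> \<epsilon> < \<kappa> / 4" using \<kappa>(1) by (intro order_tendstoD(2)) auto
  have row\<Delta>: "(\<Sum>j\<in>J. \<bar>P \<epsilon> i j - ?A i j\<bar>) \<le> \<Delta> \<epsilon>" if "i < m" "J \<subseteq> {..<m}" for i J \<epsilon>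
  proof -
    have "(\<Sum>j\<in>J. \<bar>P \<epsilon> i j - ?A i j\<bar>) \<le> (\<Sum>j<m. \<bar>P \<epsilon> i j - ?A i j\<bar>)"
      using that by (intro sum_mono2) auto
    also have "\<dots> \<le> \<Delta> \<epsilon>" unfolding \<Delta>_def
      using that by (intro member_le_sum[of i _ "\<lambda>i. \<Sum>j<m. \<bar>P \<epsilon> i j - ?A i j\<bar>"] sum_nonneg) auto
    finally show ?thesis .
  qed
  \<comment> \<open>The defect of the normalised occupation will be at most
    \<open>\<eta> + 3 * \<Delta> \<epsilon>\<close>: one quarter of \<open>\<kappa>\<close> is
    granted to \<open>\<eta>\<close> and three quarters to the matrix error.\<close>
  define \<eta> where "\<eta> = min 1 (\<kappa> / 4)"
  have \<eta>: "0 < \<eta>" "\<eta> \<le> 1" "\<eta> \<le> \<kappa> / 4" using \<kappa> by (auto simp: \<eta>_def)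
  have "\<forall>\<^sub>F \<epsilon> in at_right 0. \<forall>B V F. flow m (P \<epsilon>) \<eta> ?E B V F \<longrightarrow>
     (\<forall>j\<in>?E. near \<delta> (V j) (lam m ?A j * sum V ?E))"
    using ev\<Delta> eventually_pos_at_right
  proof eventually_elim
    case (elim \<epsilon>)
    show ?case
    proof (intro allI impI ballI)
      fix B V F j assume fl: "flow m (P \<epsilon>) \<eta> ?E B V F" and j: "j \<in> ?E"
      define s where "s = sum V ?E"
      have V0: "0 \<le> V i" if "i \<in> ?E" for i using flowD(2)[OF fl that] .
      have s0: "0 \<le> s" unfolding s_def using V0 by (rule sum_nonneg)
      have P01: "0 \<le> P \<epsilon> i j" "P \<epsilon> i j \<le> 1" if "i \<in> ?E" "j < m" for i j
        using good_nonneg[OF g elim(2)] good_le_1[OF g elim(2)] that sub by auto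
      \<comment> \<open>The source equals the outflow, and the limit matrix has no entries leading
        out of the class; so the source is negligible against the total occupation.\<close>
      have out: "sum B ?E \<le> 2 * \<Delta> \<epsilon> * s"
      proof -
        have "sum B ?E = (\<Sum>i\<in>?E. \<Sum>j\<in>{..<m} - ?E. F i j)"
          using flow_conservation[OF fl sub] by simp
        also have "\<dots> \<le> (\<Sum>i\<in>?E. \<Sum>j\<in>{..<m} - ?E. 2 * V i * \<bar>P \<epsilon> i j - ?A i j\<bar>)"
        proof (intro sum_mono)
          fix i j assume ij: "i \<in> ?E" "j \<in> {..<m} - ?E"
          have "?A i j = 0" using ergodic_closed[OF st True ij(1)] ij(2) by simp
          have "F i j \<le> (1 + \<eta>) * (P \<epsilon> i j * V i)" using near_upper[OF flowD(4)[OF fl ij(1)]] ij by simp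
          also have "\<dots> \<le> 2 * (P \<epsilon> i j * V i)"
            using \<eta>(2) P01(1)[OF ij(1)] V0[OF ij(1)] ij by (intro mult_right_mono) auto
          finally show "F i j \<le> 2 * V i * \<bar>P \<epsilon> i j - ?A i j\<bar>"
            using \<open>?A i j = 0\<close> P01(1)[OF ij(1)] ij by (simp add: mult_ac)
        qed
        also have "\<dots> = (\<Sum>i\<in>?E. 2 * V i * (\<Sum>j\<in>{..<m} - ?E. \<bar>P \<epsilon> i j - ?A i j\<bar>))"
          by (simp add: sum_distrib_left)
        also have "\<dots> \<le> (\<Sum>i\<in>?E. 2 * V i * \<Delta> \<epsilon>)"
          using V0 sub by (intro sum_mono mult_left_mono row\<Delta>) auto
        also have "\<dots> = 2 * \<Delta> \<epsilon> * s" by (simp add: s_def sum_distrib_left mult_ac)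
        finally show ?thesis .
      qed
      have inv: "\<bar>V j - (\<Sum>i\<in>?E. V i * ?A i j)\<bar> \<le> \<kappa> * s" if j: "j \<in> ?E" for j
      proof -
        have jm: "j < m" using sub j by blast
        have "B j \<le> sum B ?E" using fin j flowD(1)[OF fl] by (intro member_le_sum) auto
        moreover have "0 \<le> B j" using flowD(1)[OF fl j] .
        moreover have "\<bar>\<Sum>i\<in>?E. F i j - V i * ?A i j\<bar> \<le> (\<eta> + \<Delta> \<epsilon>) * s"
        proof -
          have "\<bar>\<Sum>i\<in>?E. F i j - V i * ?A i j\<bar> \<le> (\<Sum>i\<in>?E. \<bar>F i j - V i * ?A i j\<bar>)" by (rule sum_abs)
          also have "\<dots> \<le> (\<Sum>i\<in>?E. (\<eta> + \<Delta> \<epsilon>) * V i)"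
          proof (rule sum_mono)
            fix i assume i: "i \<in> ?E"
            have "\<bar>F i j - P \<epsilon> i j * V i\<bar> \<le> \<eta> * (P \<epsilon> i j * V i)" using flowD(4)[OF fl i jm] by (simp add: near_def)
            also have "\<dots> \<le> \<eta> * (1 * V i)"
              using \<eta> P01[OF i jm] V0[OF i] by (intro mult_left_mono mult_right_mono) auto
            finally have 1: "\<bar>F i j - P \<epsilon> i j * V i\<bar> \<le> \<eta> * V i" by simp
            have "\<bar>P \<epsilon> i j * V i - V i * ?A i j\<bar> = \<bar>P \<epsilon> i j - ?A i j\<bar> * V i"
              using V0[OF i] abs_mult_pos[of "V i" "P \<epsilon> i j - ?A i j"] by (simp add: algebra_simps)
            also have "\<dots> \<le> \<Delta> \<epsilon> * V i"
              using row\<Delta>[of i "{j}" \<epsilon>] i sub jm V0[OF i] by (intro mult_right_mono) auto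
            finally show "\<bar>F i j - V i * ?A i j\<bar> \<le> (\<eta> + \<Delta> \<epsilon>) * V i" using 1 by (simp add: algebra_simps)
          qed
          finally show ?thesis by (simp add: s_def sum_distrib_left)
        qed
        moreover have "V j - (\<Sum>i\<in>?E. V i * ?A i j) = B j + (\<Sum>i\<in>?E. F i j - V i * ?A i j)"
          using flowD(6)[OF fl j] by (simp add: sum_subtractf)
        ultimately have "\<bar>V j - (\<Sum>i\<in>?E. V i * ?A i j)\<bar> \<le> 2 * \<Delta> \<epsilon> * s + (\<eta> + \<Delta> \<epsilon>) * s" using out by linarith
        also have "\<dots> = (\<eta> + 3 * \<Delta> \<epsilon>) * s" by (simp add: algebra_simps)
        also have "\<dots> \<le> \<kappa> * s" using elim(1) \<eta> s0 by (intro mult_right_mono) auto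
        finally show ?thesis .
      qed
      show "near \<delta> (V j) (lam m ?A j * sum V ?E)"
      \<comment> \<open>Zero total occupation cannot be normalised, but then every
        \<open>V j\<close> is 0.\<close>
      proof (cases "s = 0")
        case True
        then have "V j = 0" using V0 fin j unfolding s_def by (subst (asm) sum_nonneg_eq_0_iff) auto
        then show ?thesis using True by (simp add: near_def s_def)
      next
        case False
        with s0 have s: "0 < s" by simp
        have "\<bar>V j / s - lam m ?A j\<bar> \<le> C * \<kappa>"
        proof (rule C)
          show "\<forall>j\<in>?E. \<bar>V j / s - (\<Sum>i\<in>?E. V i / s * ?A i j)\<bar> \<le> \<kappa>"
          proof
            fix j assume j: "j \<in> ?E"
            have "V j / s - (\<Sum>i\<in>?E. V i / s * ?A i j) = (V j - (\<Sum>i\<in>?E. V i * ?A i j)) / s"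
              by (simp add: diff_divide_distrib sum_divide_distrib)
            then show "\<bar>V j / s - (\<Sum>i\<in>?E. V i / s * ?A i j)\<bar> \<le> \<kappa>"
              using inv[OF j] s by (simp add: field_simps)
          qed
          show "(\<Sum>i\<in>?E. V i / s) = 1" using s by (simp add: s_def flip: sum_divide_distrib)
          show "\<forall>i\<in>?E. 0 \<le> lam m ?A i" using lam(2) by (simp add: less_imp_le)
        qed (use V0 s \<kappa> lam j in \<open>(blast | simp)+\<close>)
        also have "\<dots> \<le> \<delta> * \<mu>" by (rule \<kappa>(2))
        also have "\<dots> \<le> \<delta> * lam m ?A j" using \<delta> \<mu>(2)[OF j] by simp
        finally have "\<bar>V j / s - lam m ?A j\<bar> * s \<le> \<delta> * lam m ?A j * s" using s by (intro mult_right_mono) auto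
        moreover have "\<bar>V j / s - lam m ?A j\<bar> * s = \<bar>V j - lam m ?A j * s\<bar>"
          using s by (simp add: field_simps flip: abs_mult_pos)
        ultimately show ?thesis by (simp add: near_def s_def mult_ac)
      qed
    qed
  qed
  then show ?thesis using \<eta>(1) by blast
qed

text \<open>By \<open>flow_near_lam\<close> the only unknown is the total occupation
  \<open>s\<close>. The mass leaving the cell is close to \<open>s * den m P \<epsilon> k\<close>,
  and conservation equates it with the source; this determines \<open>s\<close>, and with it the
  visits and the distribution of the exits.\<close>

lemma flow_exit_cell:
  assumes g: "good m P" and nM: "1 < newM m (lim0 P)" and k: "k < newM m (lim0 P)" and \<delta>: "0 < \<delta>"
  shows "\<exists>\<eta>>0. \<forall>\<^sub>F \<epsilon> in at_right 0. \<forall>B V F. flow m (P \<epsilon>) \<eta> (cell m P k) B V F \<longrightarrow>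
     (\<forall>j\<in>cell m P k. near \<delta> (V j) (lam m (lim0 P) j / den m P \<epsilon> k * sum B (cell m P k))) \<and>
     (\<forall>l. l \<noteq> k \<longrightarrow> near \<delta> (\<Sum>i\<in>cell m P k. \<Sum>j\<in>cell m P l. F i j)
        (newP m (lim0 P) P \<epsilon> k l * sum B (cell m P k)))"
proof -
  let ?A = "lim0 P" and ?E = "cell m P k"
  obtain i0 where i0: "i0 < m" "?E = block m ?A i0" using cell_block[OF k] by blast
  \<comment> \<open>Jumps carry the error \<open>3 * d\<close>, solving for \<open>s\<close> doubles
    it to \<open>6 * d\<close>, and one further \<open>near_trans\<close> triples this.\<close>
  define d where "d = min (\<delta> / 18) (1 / 18)"
  have d: "0 < d" "18 * d \<le> \<delta>" "18 * d \<le> 1" using \<delta> by (auto simp: d_def)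
  have sub: "?E \<subseteq> {..<m}" by (rule cell_subset)
  obtain \<eta>0 where \<eta>0: "\<eta>0 > 0" "\<forall>\<^sub>F \<epsilon> in at_right 0. \<forall>B V F. flow m (P \<epsilon>) \<eta>0 ?E B V F \<longrightarrow>
     (\<forall>j\<in>?E. near d (V j) (lam m ?A j * sum V ?E))"
    using flow_near_lam[OF g i0(1) d(1)] unfolding i0(2) by blast
  define \<eta> where "\<eta> = min \<eta>0 d"
  have "\<forall>\<^sub>F \<epsilon> in at_right 0. \<forall>B V F. flow m (P \<epsilon>) \<eta> ?E B V F \<longrightarrow>
     (\<forall>j\<in>?E. near \<delta> (V j) (lam m ?A j / den m P \<epsilon> k * sum B ?E)) \<and>
     (\<forall>l. l \<noteq> k \<longrightarrow> near \<delta> (\<Sum>i\<in>?E. \<Sum>j\<in>cell m P l. F i j) (newP m ?A P \<epsilon> k l * sum B ?E))"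
    using \<eta>0(2) eventually_pos_at_right
  proof eventually_elim
    case (elim \<epsilon>)
    show ?case
    proof (intro allI impI)
      fix B V F assume fl: "flow m (P \<epsilon>) \<eta> ?E B V F"
      have Pn: "\<forall>i\<in>?E. \<forall>j<m. 0 \<le> P \<epsilon> i j" using good_nonneg[OF g elim(2)] sub by auto
      have lp: "0 < lam m ?A i" if "i \<in> ?E" for i using lam_pos[OF good_stoch[OF g]] that sub by auto
      have V: "near d (V j) (lam m ?A j * sum V ?E)" if "j \<in> ?E" for j
      proof -
        have "flow m (P \<epsilon>) \<eta>0 ?E B V F" by (rule flow_mono[OF fl _ Pn]) (simp add: \<eta>_def)
        then show ?thesis using elim(1) that by blast
      qed
      define s where "s = sum V ?E"
      have s0: "0 \<le> s" unfolding s_def using flowD(2)[OF fl] by (rule sum_nonneg)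
      have F: "near (3 * d) (F i j) (s * (lam m ?A i * P \<epsilon> i j))" if ij: "i \<in> ?E" "j < m" for i j
      proof -
        have p: "0 \<le> P \<epsilon> i j" using Pn ij by blast
        have "near d (F i j) (P \<epsilon> i j * V i)"
          using flowD(4)[OF flow_mono[OF fl _ Pn, of d] ij] by (simp add: \<eta>_def)
        moreover have "near d (P \<epsilon> i j * V i) (P \<epsilon> i j * (lam m ?A i * s))"
          using near_cmult[OF V[OF ij(1)] p] by (simp add: s_def)
        ultimately have "near (3 * d) (F i j) (P \<epsilon> i j * (lam m ?A i * s))"
          using d p lp[OF ij(1)] s0 by (intro near_trans) auto
        then show ?thesis by (simp add: mult_ac)
      qed
      have Fs: "near (3 * d) (\<Sum>i\<in>?E. \<Sum>j\<in>J. F i j) (s * (\<Sum>i\<in>?E. \<Sum>j\<in>J. lam m ?A i * P \<epsilon> i j))"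
        if "J \<subseteq> {..<m}" for J
        unfolding sum_distrib_left using that F by (intro near_sum) auto
      define D where "D = den m P \<epsilon> k"
      have D: "0 < D" unfolding D_def using G_pos[OF den_G[OF g nM k] elim(2)] .
      have "near (3 * d) (sum B ?E) (s * D)"
        using Fs[of "{..<m} - ?E"] flow_conservation[OF fl sub] by (simp add: D_def den_def)
      from near_sym[OF this] have sD: "near (6 * d) (s * D) (sum B ?E)" using d s0 D by simp
      have B0: "0 \<le> sum B ?E" using flowD(1)[OF fl] by (rule sum_nonneg)
      have "near \<delta> (V j) (lam m ?A j / D * sum B ?E)" if j: "j \<in> ?E" for j
      proof -
        have c: "0 \<le> lam m ?A j / D" using lp[OF j] D by simp
        have "near (6 * d) (V j) (lam m ?A j * s)"
          using near_mono[OF V[OF j], of "6 * d"] d lp[OF j] s0 by (simp add: s_def)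
        moreover have "near (6 * d) (lam m ?A j * s) (lam m ?A j / D * sum B ?E)"
          using near_cmult[OF sD c] D by simp
        ultimately have "near (3 * (6 * d)) (V j) (lam m ?A j / D * sum B ?E)"
          using d mult_nonneg_nonneg[OF c B0] by (intro near_trans[of "6 * d" "V j" "lam m ?A j * s"]) auto
        then show ?thesis by (rule near_mono) (use d mult_nonneg_nonneg[OF c B0] in auto)
      qed
      moreover have "near \<delta> (\<Sum>i\<in>?E. \<Sum>j\<in>cell m P l. F i j) (newP m ?A P \<epsilon> k l * sum B ?E)" if l: "l \<noteq> k" for l
      proof -
        have c: "0 \<le> newP m ?A P \<epsilon> k l" using G0_nonneg[OF newP_G0[OF g nM k] elim(2)] .
        have e: "s * (\<Sum>i\<in>?E. \<Sum>j\<in>cell m P l. lam m ?A i * P \<epsilon> i j) = newP m ?A P \<epsilon> k l * (s * D)"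
          using newP_eq[of k l m P \<epsilon>] l D by (simp add: D_def field_simps)
        have 1: "near (3 * d) (\<Sum>i\<in>?E. \<Sum>j\<in>cell m P l. F i j) (newP m ?A P \<epsilon> k l * (s * D))"
          using Fs[OF cell_subset[of m P l]] unfolding e .
        have "near (6 * d) (\<Sum>i\<in>?E. \<Sum>j\<in>cell m P l. F i j) (newP m ?A P \<epsilon> k l * (s * D))"
          by (rule near_mono[OF 1]) (use d c s0 D in auto)
        moreover have "near (6 * d) (newP m ?A P \<epsilon> k l * (s * D)) (newP m ?A P \<epsilon> k l * sum B ?E)"
          by (rule near_cmult[OF sD c])
        ultimately have "near (3 * (6 * d)) (\<Sum>i\<in>?E. \<Sum>j\<in>cell m P l. F i j) (newP m ?A P \<epsilon> k l * sum B ?E)"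
          using d c B0 by (intro near_trans) auto
        then show ?thesis by (rule near_mono) (use d mult_nonneg_nonneg[OF c B0] in auto)
      qed
      ultimately show "(\<forall>j\<in>?E. near \<delta> (V j) (lam m ?A j / den m P \<epsilon> k * sum B ?E)) \<and>
         (\<forall>l. l \<noteq> k \<longrightarrow> near \<delta> (\<Sum>i\<in>?E. \<Sum>j\<in>cell m P l. F i j) (newP m ?A P \<epsilon> k l * sum B ?E))"
        unfolding D_def by blast
    qed
  qed
  then show ?thesis using \<eta>0(1) d(1) by (intro exI[of _ \<eta>]) (auto simp: \<eta>_def)
qed

section \<open>Induction on the rank\<close>

text \<open>\<open>\<nu> i\<close> is the number of visits to \<open>i\<close> per unit of mass
  started in its cluster. The source enters only through its total, which is the asymptotic
  independence of the starting point.\<close>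

definition rank_law :: "nat \<Rightarrow> (nat \<Rightarrow> nat \<Rightarrow> real) \<Rightarrow> nat \<Rightarrow> (nat \<Rightarrow> nat) \<Rightarrow>
    (nat \<Rightarrow> nat \<Rightarrow> real) \<Rightarrow> (nat \<Rightarrow> real) \<Rightarrow> real \<Rightarrow> real \<Rightarrow> bool" where
  "rank_law M Q m c P \<nu> \<delta> \<eta> \<longleftrightarrow> (\<forall>a<m. \<forall>b W F. flow M Q \<eta> {i. i < M \<and> c i = a} b W F \<longrightarrow>
     (\<forall>i\<in>{i. i < M \<and> c i = a}. near \<delta> (W i) (\<nu> i * sum b {i. i < M \<and> c i = a})) \<and>
     (\<forall>a'<m. a' \<noteq> a \<longrightarrow> near \<delta> (\<Sum>i\<in>{i. i < M \<and> c i = a}. \<Sum>j\<in>{i. i < M \<and> c i = a'}. F i j)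
        (P a a' * sum b {i. i < M \<and> c i = a})))"

definition rank_asymp :: "nat \<Rightarrow> (real \<Rightarrow> nat \<Rightarrow> nat \<Rightarrow> real) \<Rightarrow> nat \<Rightarrow> (nat \<Rightarrow> nat) \<Rightarrow>
    (real \<Rightarrow> nat \<Rightarrow> nat \<Rightarrow> real) \<Rightarrow> (real \<Rightarrow> nat \<Rightarrow> real) \<Rightarrow> bool" where
  "rank_asymp M Pm m c P \<nu> \<longleftrightarrow>
     (\<forall>\<delta>>0. \<exists>\<eta>>0. \<forall>\<^sub>F \<epsilon> in at_right 0. rank_law M (Pm \<epsilon>) m c (P \<epsilon>) (\<nu> \<epsilon>) \<delta> \<eta>)"

text \<open>A rank-0 cluster is left at once because \<open>Pm\<close> has zero diagonal, so visits
  coincide with the source.\<close>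

lemma rank_asymp_0:
  assumes g: "good M Pm"
  shows "rank_asymp M Pm M id Pm (\<lambda>_ _. 1)"
  unfolding rank_asymp_def
proof (intro allI impI)
  fix \<delta> :: real assume \<delta>: "0 < \<delta>"
  have "\<forall>\<^sub>F \<epsilon> in at_right 0. rank_law M (Pm \<epsilon>) M id (Pm \<epsilon>) (\<lambda>_. 1) \<delta> \<delta>"
    using eventually_pos_at_right
  proof eventually_elim
    case (elim \<epsilon>)
    have s: "{i. i < M \<and> id i = a} = {a}" if "a < M" for a using that by auto
    show ?case
      unfolding rank_law_def
    proof (intro allI impI)
      fix a b W F assume a: "a < M" and "flow M (Pm \<epsilon>) \<delta> {i. i < M \<and> id i = a} b W F"
      then have fl: "flow M (Pm \<epsilon>) \<delta> {a} b W F" by (simp only: s)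
      have "near \<delta> (F a a) 0" using flowD(4)[OF fl, of a a] a goodD(1)[OF g elim a] by simp
      then have "W a = b a" using flowD(6)[OF fl, of a] by (simp add: near_def)
      then show "(\<forall>i\<in>{i. i < M \<and> id i = a}. near \<delta> (W i) (1 * sum b {i. i < M \<and> id i = a})) \<and>
     (\<forall>a'<M. a' \<noteq> a \<longrightarrow> near \<delta> (\<Sum>i\<in>{i. i < M \<and> id i = a}. \<Sum>j\<in>{i. i < M \<and> id i = a'}. F i j)
        (Pm \<epsilon> a a' * sum b {i. i < M \<and> id i = a}))"
        using near_refl[of \<delta> "b a"] \<delta> flowD(1)[OF fl, of a] flowD(4)[OF fl, of a] a
        by (auto simp: s simp del: id_apply)
    qed
  qed
  then show "\<exists>\<eta>>0. \<forall>\<^sub>F \<epsilon> in at_right 0. rank_law M (Pm \<epsilon>) M id (Pm \<epsilon>) (\<lambda>_. 1) \<delta> \<eta>" using \<delta> by blast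
qed

text \<open>A visit at the coarser level is an entry into a piece \<open>Ka a\<close>, from the
  source or from another piece; conservation for the restricted flow matches entries with exits.
  Jumps inside a piece are invisible at this level, hence the zero diagonal of
  \<open>Fr\<close>.\<close>

lemma flow_cluster:
  fixes M m :: nat and c :: "nat \<Rightarrow> nat" and E :: "nat set" and b :: "nat \<Rightarrow> real"
    and F P :: "nat \<Rightarrow> nat \<Rightarrow> real"
  defines "Ka \<equiv> \<lambda>a. {i. i < M \<and> c i = a}"
  defines "K \<equiv> {i. i < M \<and> c i \<in> E}"
  defines "V \<equiv> \<lambda>a. \<Sum>j\<in>Ka a. b j + (\<Sum>i\<in>K - Ka a. F i j)"
  defines "Fr \<equiv> \<lambda>a a'. if a = a' then 0 else (\<Sum>i\<in>Ka a. \<Sum>j\<in>Ka a'. F i j)"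
  assumes fl: "flow M Q \<eta> K b W F" and E: "E \<subseteq> {..<m}" and c: "\<And>i. i < M \<Longrightarrow> c i < m"
    and diag: "\<And>a. a < m \<Longrightarrow> P a a = 0"
    and near: "\<And>a a'. a \<in> E \<Longrightarrow> a' < m \<Longrightarrow> a' \<noteq> a \<Longrightarrow> near \<eta>' (Fr a a') (P a a' * V a)"
  shows "flow m P \<eta>' E (\<lambda>a. sum b (Ka a)) V Fr"
  unfolding flow_def
proof (intro conjI ballI allI impI)
  have finE: "finite E" using E finite_subset by blast
  have KaK: "Ka a \<subseteq> K" if "a \<in> E" for a using that by (auto simp: Ka_def K_def)
  have KM: "K \<subseteq> {..<M}" by (auto simp: K_def)
  have KaM: "Ka a \<subseteq> {..<M}" for a by (auto simp: Ka_def)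
  have fla: "flow M Q \<eta> (Ka a) (\<lambda>j. b j + (\<Sum>i\<in>K - Ka a. F i j)) W F" if "a \<in> E" for a
    by (rule flow_restrict[OF fl KaK[OF that] KM])
  fix a assume a: "a \<in> E"
  show "0 \<le> sum b (Ka a)" using flowD(1)[OF fl] KaK[OF a] by (intro sum_nonneg) auto
  show "0 \<le> V a" unfolding V_def using flowD(1)[OF fla[OF a]] by (rule sum_nonneg)
  { fix a' assume "a' < m"
    show "0 \<le> Fr a a'" unfolding Fr_def using flowD(3)[OF fl] KaK[OF a] KaM[of a'] by (auto intro!: sum_nonneg)
    show "near \<eta>' (Fr a a') (P a a' * V a)"
    proof (cases "a' = a")
      case True
      then show ?thesis using diag[OF \<open>a' < m\<close>] by (simp add: Fr_def near_def)
    qed (use near a \<open>a' < m\<close> in blast) }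
  show "(\<Sum>a'<m. Fr a a') = V a"
  proof -
    have "(\<Sum>a'<m. Fr a a') = (\<Sum>a'\<in>{..<m} - {a}. Fr a a')"
      by (intro sum.mono_neutral_right) (auto simp: Fr_def)
    also have "\<dots> = (\<Sum>a'\<in>{..<m} - {a}. \<Sum>i\<in>Ka a. \<Sum>j\<in>Ka a'. F i j)"
      by (intro sum.cong) (auto simp: Fr_def)
    also have "\<dots> = (\<Sum>i\<in>Ka a. \<Sum>a'\<in>{..<m} - {a}. \<Sum>j\<in>Ka a'. F i j)" by (rule sum.swap)
    also have "\<dots> = (\<Sum>i\<in>Ka a. \<Sum>j\<in>{j. j < M \<and> c j \<in> {..<m} - {a}}. F i j)"
      unfolding Ka_def by (intro sum.cong refl sum_fibres) simp
    also have "{j. j < M \<and> c j \<in> {..<m} - {a}} = {..<M} - Ka a" using c by (auto simp: Ka_def)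
    also have "(\<Sum>i\<in>Ka a. \<Sum>j\<in>{..<M} - Ka a. F i j) = V a"
      unfolding V_def by (rule flow_conservation[OF fla[OF a] KaM])
    finally show ?thesis .
  qed
  show "V a = sum b (Ka a) + (\<Sum>a'\<in>E. Fr a' a)"
  proof -
    have "(\<Sum>a'\<in>E. Fr a' a) = (\<Sum>a'\<in>E - {a}. Fr a' a)"
      using finE by (intro sum.mono_neutral_right) (auto simp: Fr_def)
    also have "\<dots> = (\<Sum>a'\<in>E - {a}. \<Sum>i\<in>Ka a'. \<Sum>j\<in>Ka a. F i j)"
      by (intro sum.cong) (auto simp: Fr_def)
    also have "\<dots> = (\<Sum>i\<in>{i. i < M \<and> c i \<in> E - {a}}. \<Sum>j\<in>Ka a. F i j)"
      unfolding Ka_def using finE by (intro sum_fibres) simp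
    also have "{i. i < M \<and> c i \<in> E - {a}} = K - Ka a" by (auto simp: K_def Ka_def)
    also have "(\<Sum>i\<in>K - Ka a. \<Sum>j\<in>Ka a. F i j) = (\<Sum>j\<in>Ka a. \<Sum>i\<in>K - Ka a. F i j)" by (rule sum.swap)
    finally show ?thesis by (simp add: V_def sum.distrib)
  qed
qed

text \<open>The visits to \<open>i\<close> factor into the visits per entry into its current
  cluster, given by \<open>\<nu>\<close>, and the number of entries into that cluster per unit of
  source, which \<open>flow_exit_cell\<close> identifies as \<open>lam\<close> divided by
  \<open>den\<close>.\<close>

lemma rank_asymp_Suc:
  assumes ra: "rank_asymp M Pm m c P \<nu>" and g: "good m P" and nM: "1 < newM m (lim0 P)"
    and c: "\<And>i. i < M \<Longrightarrow> c i < m" and \<nu>: "\<And>\<epsilon> i. 0 < \<epsilon> \<Longrightarrow> i < M \<Longrightarrow> 0 < \<nu> \<epsilon> i"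
  shows "rank_asymp M Pm (newM m (lim0 P)) (newidx m (lim0 P) \<circ> c) (newP m (lim0 P) P)
     (\<lambda>\<epsilon> i. \<nu> \<epsilon> i * (lam m (lim0 P) (c i) / den m P \<epsilon> (newidx m (lim0 P) (c i))))"
  unfolding rank_asymp_def
proof (intro allI impI)
  fix \<delta> :: real assume \<delta>: "0 < \<delta>"
  let ?A = "lim0 P" and ?n = "newM m (lim0 P)" and ?x = "newidx m (lim0 P)"
  let ?K = "\<lambda>k. {i. i < M \<and> (?x \<circ> c) i = k}"
  define d where "d = min (\<delta> / 3) 1"
  have d: "0 < d" "3 * d \<le> \<delta>" "d \<le> 1" using \<delta> by (auto simp: d_def)
  define concl where "concl k \<epsilon> B V F \<longleftrightarrow>
     (\<forall>j\<in>cell m P k. near d (V j) (lam m ?A j / den m P \<epsilon> k * sum B (cell m P k))) \<and>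
     (\<forall>l. l \<noteq> k \<longrightarrow> near d (\<Sum>i\<in>cell m P k. \<Sum>j\<in>cell m P l. F i j) (newP m ?A P \<epsilon> k l * sum B (cell m P k)))"
    for k \<epsilon> and B V :: "nat \<Rightarrow> real" and F :: "nat \<Rightarrow> nat \<Rightarrow> real"
  have "\<exists>\<eta>>0. \<forall>\<^sub>F \<epsilon> in at_right 0. \<forall>k<?n. \<forall>B V F. flow m (P \<epsilon>) \<eta> (cell m P k) B V F \<longrightarrow> concl k \<epsilon> B V F"
  proof (rule uniform_eta)
    fix k assume "k < ?n"
    then show "\<exists>\<eta>>0. \<forall>\<^sub>F \<epsilon> in at_right 0. \<forall>B V F. flow m (P \<epsilon>) \<eta> (cell m P k) B V F \<longrightarrow> concl k \<epsilon> B V F"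
      unfolding concl_def by (rule flow_exit_cell[OF g nM _ d(1)])
  next
    fix k \<eta> \<eta>' and \<epsilon> :: real
    assume e: "\<eta> \<le> \<eta>'" "0 < \<epsilon>" "\<forall>B V F. flow m (P \<epsilon>) \<eta>' (cell m P k) B V F \<longrightarrow> concl k \<epsilon> B V F"
    have "\<forall>i\<in>cell m P k. \<forall>j<m. 0 \<le> P \<epsilon> i j" using good_nonneg[OF g e(2)] cell_subset by blast
    then show "\<forall>B V F. flow m (P \<epsilon>) \<eta> (cell m P k) B V F \<longrightarrow> concl k \<epsilon> B V F"
      using flow_mono[OF _ e(1)] e(3) by blast
  qed
  then obtain \<eta>1 where \<eta>1: "\<eta>1 > 0"
    "\<forall>\<^sub>F \<epsilon> in at_right 0. \<forall>k<?n. \<forall>B V F. flow m (P \<epsilon>) \<eta>1 (cell m P k) B V F \<longrightarrow> concl k \<epsilon> B V F" by blast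
  \<comment> \<open>The accuracy at the lower rank is both a part of the final error and the
    tolerance of the aggregated flow, hence the minimum with \<open>\<eta>1\<close>.\<close>
  define d2 where "d2 = min d \<eta>1"
  have d2: "0 < d2" "d2 \<le> d" "d2 \<le> \<eta>1" using d \<eta>1 by (auto simp: d2_def)
  let ?Ka = "\<lambda>a. {i. i < M \<and> c i = a}"
  obtain \<eta> where \<eta>: "\<eta> > 0" "\<forall>\<^sub>F \<epsilon> in at_right 0. rank_law M (Pm \<epsilon>) m c (P \<epsilon>) (\<nu> \<epsilon>) d2 \<eta>"
    using ra[unfolded rank_asymp_def, rule_format, OF d2(1)] by blast
  let ?\<nu> = "\<lambda>\<epsilon> i. \<nu> \<epsilon> i * (lam m ?A (c i) / den m P \<epsilon> (?x (c i)))"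
  have "\<forall>\<^sub>F \<epsilon> in at_right 0. rank_law M (Pm \<epsilon>) ?n (?x \<circ> c) (newP m ?A P \<epsilon>) (?\<nu> \<epsilon>) \<delta> \<eta>"
    using \<eta>(2) \<eta>1(2) eventually_pos_at_right
  proof eventually_elim
    case (elim \<epsilon>)
    note IH = elim(1)[unfolded rank_law_def, rule_format, THEN conjunct1, rule_format]
      elim(1)[unfolded rank_law_def, rule_format, THEN conjunct2, rule_format]
    show ?case
      unfolding rank_law_def
    proof (intro allI impI)
      fix k b W F assume k: "k < ?n" and fl0: "flow M (Pm \<epsilon>) \<eta> (?K k) b W F"
      let ?E = "cell m P k"
      have Keq: "?K k = {i. i < M \<and> c i \<in> cell m P k}" for k using c by (auto simp: cell_def)
      let ?KE = "{i. i < M \<and> c i \<in> ?E}"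
      have fl: "flow M (Pm \<epsilon>) \<eta> ?KE b W F" using fl0 unfolding Keq .
      have KaK: "?Ka a \<subseteq> ?KE" if "a \<in> ?E" for a using that by auto
      have fla: "flow M (Pm \<epsilon>) \<eta> (?Ka a) (\<lambda>j. b j + (\<Sum>i\<in>?KE - ?Ka a. F i j)) W F" if "a \<in> ?E" for a
        by (rule flow_restrict[OF fl KaK[OF that]]) auto
      define V where "V a = (\<Sum>j\<in>?Ka a. b j + (\<Sum>i\<in>?KE - ?Ka a. F i j))" for a
      define Fr where "Fr a a' = (if a = a' then 0 else (\<Sum>i\<in>?Ka a. \<Sum>j\<in>?Ka a'. F i j))" for a a'
      have am: "a < m" if "a \<in> ?E" for a using that by (simp add: cell_def)
      have W: "near d2 (W i) (\<nu> \<epsilon> i * V a)" if "a \<in> ?E" "i \<in> ?Ka a" for a i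
        unfolding V_def using IH(1)[OF am[OF that(1)] fla[OF that(1)] that(2)] .
      have Vn: "0 \<le> V a" if "a \<in> ?E" for a unfolding V_def using flowD(1)[OF fla[OF that]] by (rule sum_nonneg)
      \<comment> \<open>The induction hypothesis for each piece supplies the closeness of the
        aggregated jumps to the matrix of the lower rank.\<close>
      have "flow m (P \<epsilon>) \<eta>1 ?E (\<lambda>a. sum b (?Ka a)) V Fr"
        unfolding V_def[abs_def] Fr_def[abs_def]
      proof (rule flow_cluster[OF fl cell_subset c])
        show "P \<epsilon> a a = 0" if "a < m" for a using goodD(1)[OF g elim(3) that] .
        fix a a' assume a: "a \<in> ?E" "a' < m" "a' \<noteq> a"
        have "near d2 (\<Sum>i\<in>?Ka a. \<Sum>j\<in>?Ka a'. F i j) (P \<epsilon> a a' * V a)"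
          unfolding V_def using IH(2)[OF am[OF a(1)] fla[OF a(1)] a(2,3)] .
        then have "near \<eta>1 (\<Sum>i\<in>?Ka a. \<Sum>j\<in>?Ka a'. F i j) (P \<epsilon> a a' * V a)"
          using d2(3) by (rule near_mono) (use Vn[OF a(1)] good_nonneg[OF g elim(3) am[OF a(1)] a(2)] in simp)
        then show "near \<eta>1 (if a = a' then 0 else (\<Sum>i\<in>?Ka a. \<Sum>j\<in>?Ka a'. F i j))
            (P \<epsilon> a a' * (\<Sum>j\<in>?Ka a. b j + (\<Sum>i\<in>?KE - ?Ka a. F i j)))" using a(3) by (simp add: V_def)
      qed
      then have "concl k \<epsilon> (\<lambda>a. sum b (?Ka a)) V Fr" using elim(2) k by blast
      moreover have sb: "(\<Sum>a\<in>?E. sum b (?Ka a)) = sum b ?KE" by (rule sum_fibres[OF finite_cell])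
      ultimately have V: "\<And>a. a \<in> ?E \<Longrightarrow> near d (V a) (lam m ?A a / den m P \<epsilon> k * sum b ?KE)"
        and Fr: "\<And>l. l \<noteq> k \<Longrightarrow> near d (\<Sum>a\<in>?E. \<Sum>a'\<in>cell m P l. Fr a a') (newP m ?A P \<epsilon> k l * sum b ?KE)"
        unfolding concl_def sb by blast+
      have b0: "0 \<le> sum b ?KE" using flowD(1)[OF fl] by (rule sum_nonneg)
      have D: "0 < den m P \<epsilon> k" using G_pos[OF den_G[OF g nM k] elim(3)] .
      have "near \<delta> (W i) (\<nu> \<epsilon> i * (lam m ?A (c i) / den m P \<epsilon> (?x (c i))) * sum b ?KE)" if i: "i \<in> ?KE" for i
      proof -
        have ci: "c i \<in> ?E" and iM: "i < M" using i by auto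
        have xk: "?x (c i) = k" using ci by (simp add: cell_def)
        have n: "0 \<le> \<nu> \<epsilon> i" using \<nu>[OF elim(3) iM] by simp
        have l: "0 \<le> lam m ?A (c i) / den m P \<epsilon> k"
          using lam_pos[OF good_stoch[OF g] am[OF ci]] D by simp
        have "near d (W i) (\<nu> \<epsilon> i * V (c i))"
          by (rule near_mono[OF W[OF ci]]) (use d2 n Vn[OF ci] iM in auto)
        moreover have "near d (\<nu> \<epsilon> i * V (c i)) (\<nu> \<epsilon> i * (lam m ?A (c i) / den m P \<epsilon> k * sum b ?KE))"
          by (rule near_cmult[OF V[OF ci] n])
        ultimately have "near (3 * d) (W i) (\<nu> \<epsilon> i * (lam m ?A (c i) / den m P \<epsilon> k * sum b ?KE))"
          by (rule near_trans) (use d mult_nonneg_nonneg[OF n mult_nonneg_nonneg[OF l b0]] in auto)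
        then have "near \<delta> (W i) (\<nu> \<epsilon> i * (lam m ?A (c i) / den m P \<epsilon> k * sum b ?KE))"
          by (rule near_mono) (use d mult_nonneg_nonneg[OF n mult_nonneg_nonneg[OF l b0]] in auto)
        then show ?thesis by (simp only: xk mult.assoc)
      qed
      moreover have "near \<delta> (\<Sum>i\<in>?KE. \<Sum>j\<in>?K l. F i j) (newP m ?A P \<epsilon> k l * sum b ?KE)"
        if l: "l < ?n" "l \<noteq> k" for l
      proof -
        have "(\<Sum>a\<in>?E. \<Sum>a'\<in>cell m P l. Fr a a') = (\<Sum>a\<in>?E. \<Sum>a'\<in>cell m P l. \<Sum>i\<in>?Ka a. \<Sum>j\<in>?Ka a'. F i j)"
        proof (intro sum.cong refl)
          fix a a' assume "a \<in> ?E" "a' \<in> cell m P l"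
          then have "a \<noteq> a'" using l(2) by (auto simp: cell_def)
          then show "Fr a a' = (\<Sum>i\<in>?Ka a. \<Sum>j\<in>?Ka a'. F i j)" by (simp add: Fr_def)
        qed
        also have "\<dots> = (\<Sum>a\<in>?E. \<Sum>i\<in>?Ka a. \<Sum>a'\<in>cell m P l. \<Sum>j\<in>?Ka a'. F i j)"
          by (intro sum.cong refl sum.swap)
        also have "\<dots> = (\<Sum>a\<in>?E. \<Sum>i\<in>?Ka a. \<Sum>j\<in>{j. j < M \<and> c j \<in> cell m P l}. F i j)"
          by (intro sum.cong refl sum_fibres finite_cell)
        also have "\<dots> = (\<Sum>i\<in>?KE. \<Sum>j\<in>{j. j < M \<and> c j \<in> cell m P l}. F i j)"
          by (rule sum_fibres[OF finite_cell])
        finally have e: "(\<Sum>a\<in>?E. \<Sum>a'\<in>cell m P l. Fr a a') = (\<Sum>i\<in>?KE. \<Sum>j\<in>?K l. F i j)"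
          unfolding Keq .
        have "0 \<le> newP m ?A P \<epsilon> k l" using G0_nonneg[OF newP_G0[OF g nM k] elim(3)] .
        then show ?thesis using near_mono[OF Fr[OF l(2), unfolded e]] d b0 by simp
      qed
      ultimately show "(\<forall>i\<in>?K k. near \<delta> (W i) (\<nu> \<epsilon> i * (lam m ?A (c i) / den m P \<epsilon> (?x (c i))) * sum b (?K k))) \<and>
         (\<forall>l<?n. l \<noteq> k \<longrightarrow> near \<delta> (\<Sum>i\<in>?K k. \<Sum>j\<in>?K l. F i j) (newP m ?A P \<epsilon> k l * sum b (?K k)))"
        unfolding Keq[of k] by blast
    qed
  qed
  then show "\<exists>\<eta>>0. \<forall>\<^sub>F \<epsilon> in at_right 0. rank_law M (Pm \<epsilon>) ?n (?x \<circ> c) (newP m ?A P \<epsilon>) (?\<nu> \<epsilon>) \<delta> \<eta>"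
    using \<eta>(1) by blast
qed

lemma newM_pos: "0 < m \<Longrightarrow> 0 < newM m A"
  using newidx_less[of 0 m A] by simp

text \<open>As \<open>Mr\<close> differs from 1 at every rank up to \<open>r\<close>,
  \<open>hier\<close> aggregates at each earlier step instead of stopping, and each aggregation
  produces more than one cell, as \<open>den_G\<close> demands.\<close>

lemma hier_good:
  assumes g: "good M Pm" and M: "0 < M" and r: "\<And>s. s \<le> r \<Longrightarrow> Mr M Pm s \<noteq> 1"
  shows "1 < Mr M Pm r \<and> good (Mr M Pm r) (Pmat M Pm r) \<and> (\<forall>i<M. clus M Pm r i < Mr M Pm r) \<and>
    (\<forall>k<Mr M Pm r. \<exists>i<M. clus M Pm r i = k) \<and>
    (\<exists>\<nu>. (\<forall>\<epsilon>>0. \<forall>i<M. 0 < \<nu> \<epsilon> i) \<and> rank_asymp M Pm (Mr M Pm r) (clus M Pm r) (Pmat M Pm r) \<nu>)"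
  using r
proof (induction r)
  case 0
  then have "1 < M" using M 0[of 0] by (simp add: Mr_def)
  moreover have eqs: "Mr M Pm 0 = M" "clus M Pm 0 = id" "Pmat M Pm 0 = Pm"
    by (simp_all add: Mr_def clus_def Pmat_def)
  moreover have "\<exists>\<nu>. (\<forall>\<epsilon>>0. \<forall>i<M. 0 < \<nu> \<epsilon> i) \<and> rank_asymp M Pm M id Pm \<nu>"
    using rank_asymp_0[OF g] by (intro exI[of _ "\<lambda>_ _. 1"]) simp
  ultimately show ?case using g unfolding eqs by (intro conjI) (assumption | simp)+
next
  case (Suc r)
  let ?m = "Mr M Pm r" and ?c = "clus M Pm r" and ?P = "Pmat M Pm r"
  have IH: "1 < ?m" "good ?m ?P" "\<And>i. i < M \<Longrightarrow> ?c i < ?m" "\<And>k. k < ?m \<Longrightarrow> \<exists>i<M. ?c i = k"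
    and "\<exists>\<nu>. (\<forall>\<epsilon>>0. \<forall>i<M. 0 < \<nu> \<epsilon> i) \<and> rank_asymp M Pm ?m ?c ?P \<nu>"
    using Suc.IH Suc.prems by auto
  then obtain \<nu> where \<nu>: "\<And>\<epsilon> i. 0 < \<epsilon> \<Longrightarrow> i < M \<Longrightarrow> 0 < \<nu> \<epsilon> i" "rank_asymp M Pm ?m ?c ?P \<nu>" by blast
  have h: "hier M Pm r = (?m, ?c, ?P)" by (simp add: Mr_def clus_def Pmat_def)
  have hS: "hier M Pm (Suc r) = (newM ?m (lim0 ?P), newidx ?m (lim0 ?P) \<circ> ?c, newP ?m (lim0 ?P) ?P)"
    using IH(1) by (simp add: h)
  have eqs: "Mr M Pm (Suc r) = newM ?m (lim0 ?P)" "clus M Pm (Suc r) = newidx ?m (lim0 ?P) \<circ> ?c"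
    "Pmat M Pm (Suc r) = newP ?m (lim0 ?P) ?P"
    unfolding Mr_def[of M Pm "Suc r"] clus_def[of M Pm "Suc r"] Pmat_def[of M Pm "Suc r"] hS by simp_all
  have nM: "1 < newM ?m (lim0 ?P)"
    using Suc.prems[of "Suc r"] newM_pos[of ?m "lim0 ?P"] IH(1) eqs(1) by simp
  have pos: "0 < \<nu> \<epsilon> i * (lam ?m (lim0 ?P) (?c i) / den ?m ?P \<epsilon> (newidx ?m (lim0 ?P) (?c i)))"
    if "0 < \<epsilon>" "i < M" for \<epsilon> i
    using \<nu>(1)[OF that] lam_pos[OF good_stoch[OF IH(2)] IH(3)[OF that(2)]]
      G_pos[OF den_G[OF IH(2) nM newidx_less[OF IH(3)[OF that(2)]]] that(1)] by simp
  have surj: "\<exists>i<M. (newidx ?m (lim0 ?P) \<circ> ?c) i = k" if "k < newM ?m (lim0 ?P)" for k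
    using newidx_surj[OF that] IH(4) by force
  show ?case unfolding eqs
  proof (intro conjI exI)
    show "1 < newM ?m (lim0 ?P)" by (rule nM)
    show "good (newM ?m (lim0 ?P)) (newP ?m (lim0 ?P) ?P)" by (rule good_newP[OF IH(2) nM])
    show "\<forall>i<M. (newidx ?m (lim0 ?P) \<circ> ?c) i < newM ?m (lim0 ?P)" using newidx_less[OF IH(3)] by simp
    show "\<forall>k<newM ?m (lim0 ?P). \<exists>i<M. (newidx ?m (lim0 ?P) \<circ> ?c) i = k" using surj by blast
    show "rank_asymp M Pm (newM ?m (lim0 ?P)) (newidx ?m (lim0 ?P) \<circ> ?c) (newP ?m (lim0 ?P) ?P)
        (\<lambda>\<epsilon> i. \<nu> \<epsilon> i * (lam ?m (lim0 ?P) (?c i) / den ?m ?P \<epsilon> (newidx ?m (lim0 ?P) (?c i))))"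
      by (rule rank_asymp_Suc[OF \<nu>(2) IH(2) nM IH(3) \<nu>(1)])
  qed (use pos in blast)
qed

end

section \<open>The asymptotic scale generated by ratios of transition probabilities\<close>

definition mono_fn :: "(real \<Rightarrow> nat \<Rightarrow> nat \<Rightarrow> real) \<Rightarrow> (nat \<times> nat \<times> nat) list \<Rightarrow> real \<Rightarrow> real" where
  "mono_fn Pm xs \<epsilon> = (\<Prod>(a, b, d)\<leftarrow>xs. Pm \<epsilon> a b / Pm \<epsilon> a d)"

definition admissible :: "nat \<Rightarrow> (real \<Rightarrow> nat \<Rightarrow> nat \<Rightarrow> real) \<Rightarrow> (nat \<times> nat \<times> nat) list \<Rightarrow> bool" where
  "admissible M Pm xs \<longleftrightarrow> (\<forall>(a, b, d)\<in>set xs. a < M \<and> b < M \<and> d < M \<and>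
     (\<forall>\<epsilon>>0. Pm \<epsilon> a b > 0) \<and> (\<forall>\<epsilon>>0. Pm \<epsilon> a d > 0))"

text \<open>Both transitions of a ratio start at the same index, as in (f). Only the asymptotics up
  to a positive constant is prescribed: a sum of two monomials need not be a monomial, but it is
  asymptotic to a multiple of one.\<close>

definition ratio_scale :: "nat \<Rightarrow> (real \<Rightarrow> nat \<Rightarrow> nat \<Rightarrow> real) \<Rightarrow> (real \<Rightarrow> real) set" where
  "ratio_scale M Pm = {f. (\<forall>\<epsilon>>0. f \<epsilon> > 0) \<and> (\<exists>c>0. \<exists>xs. admissible M Pm xs \<and>
      ((\<lambda>\<epsilon>. f \<epsilon> / mono_fn Pm xs \<epsilon>) \<longlongrightarrow> c) (at_right 0))}"

lemma ratio_scaleI: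
  assumes "\<And>\<epsilon>. 0 < \<epsilon> \<Longrightarrow> 0 < f \<epsilon>" "0 < c" "admissible M Pm xs"
    "((\<lambda>\<epsilon>. f \<epsilon> / mono_fn Pm xs \<epsilon>) \<longlongrightarrow> c) (at_right 0)"
  shows "f \<in> ratio_scale M Pm"
  unfolding ratio_scale_def using assms by blast

lemma ratio_scaleE:
  assumes "f \<in> ratio_scale M Pm"
  obtains c xs where "0 < c" "admissible M Pm xs"
    "((\<lambda>\<epsilon>. f \<epsilon> / mono_fn Pm xs \<epsilon>) \<longlongrightarrow> c) (at_right 0)"
  using assms unfolding ratio_scale_def by blast

lemma mono_fn_append: "mono_fn Pm (xs @ ys) \<epsilon> = mono_fn Pm xs \<epsilon> * mono_fn Pm ys \<epsilon>"
  by (simp add: mono_fn_def)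

lemma mono_fn_pos: "admissible M Pm xs \<Longrightarrow> 0 < \<epsilon> \<Longrightarrow> 0 < mono_fn Pm xs \<epsilon>"
  by (induction xs) (auto simp: mono_fn_def admissible_def)

lemma mono_fn_swap: "mono_fn Pm (map (\<lambda>(a, b, d). (a, d, b)) xs) \<epsilon> = 1 / mono_fn Pm xs \<epsilon>"
  by (induction xs) (auto simp: mono_fn_def)

lemma admissible_swap: "admissible M Pm xs \<Longrightarrow> admissible M Pm (map (\<lambda>(a, b, d). (a, d, b)) xs)"
  by (auto simp: admissible_def)

lemma admissible_append: "admissible M Pm xs \<Longrightarrow> admissible M Pm ys \<Longrightarrow> admissible M Pm (xs @ ys)"
  by (auto simp: admissible_def)

text \<open>The quotient of two elements of the scale has a limit in \<open>[0, \<infinity>]\<close>, so one of them dominates; this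
  gives the closure under sums.\<close>
lemma asymp_class_ratio_scale:
  assumes lim: "\<And>xs. admissible M Pm xs \<Longrightarrow> \<exists>L::ereal. L \<ge> 0 \<and> ((\<lambda>\<epsilon>. ereal (mono_fn Pm xs \<epsilon>)) \<longlongrightarrow> L) (at_right 0)"
  shows "asymp_class (ratio_scale M Pm)"
proof -
  let ?G = "ratio_scale M Pm"
  have posD: "0 < f \<epsilon>" if "f \<in> ?G" "0 < \<epsilon>" for f \<epsilon> using that by (auto simp: ratio_scale_def)
  have limD: "(\<exists>l\<ge>0. (f \<longlongrightarrow> l) (at_right 0)) \<or> ((\<lambda>\<epsilon>. 1 / f \<epsilon>) \<longlongrightarrow> 0) (at_right 0)" if f: "f \<in> ?G" for f
  proof -
    obtain c xs where c: "c > 0" "admissible M Pm xs" "((\<lambda>\<epsilon>. f \<epsilon> / mono_fn Pm xs \<epsilon>) \<longlongrightarrow> c) (at_right 0)"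
      using f by (rule ratio_scaleE)
    have e: "\<forall>\<^sub>F \<epsilon> in at_right 0. f \<epsilon> / mono_fn Pm xs \<epsilon> * mono_fn Pm xs \<epsilon> = f \<epsilon>"
      using eventually_pos_at_right
    proof eventually_elim
      case (elim \<epsilon>)
      then show ?case using mono_fn_pos[OF c(2) elim] by simp
    qed
    obtain L where L: "L \<ge> 0" "((\<lambda>\<epsilon>. ereal (mono_fn Pm xs \<epsilon>)) \<longlongrightarrow> L) (at_right 0)" using lim[OF c(2)] by blast
    show ?thesis
    proof (cases L)
      case (real l)
      then have "((\<lambda>\<epsilon>. mono_fn Pm xs \<epsilon>) \<longlongrightarrow> l) (at_right 0)" using L(2) by simp
      from tendsto_mult[OF c(3) this] have "((\<lambda>\<epsilon>. f \<epsilon>) \<longlongrightarrow> c * l) (at_right 0)"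
        using e by (simp add: tendsto_cong)
      moreover have "0 \<le> c * l" using c(1) L(1) real by simp
      ultimately show ?thesis by blast
    next
      case PInf
      then have "filterlim (mono_fn Pm xs) at_top (at_right 0)" using L(2) by (simp add: tendsto_PInfty_eq_at_top)
      then have "LIM \<epsilon> at_right 0. f \<epsilon> / mono_fn Pm xs \<epsilon> * mono_fn Pm xs \<epsilon> :> at_top"
        by (rule filterlim_tendsto_pos_mult_at_top[OF c(3,1)])
      then have "filterlim f at_top (at_right 0)" using e by (simp add: filterlim_cong)
      then have "((\<lambda>\<epsilon>. inverse (f \<epsilon>)) \<longlongrightarrow> 0) (at_right 0)" by (rule tendsto_inverse_0_at_top)
      then show ?thesis by (simp add: inverse_eq_divide)
    next
      case MInf
      then show ?thesis using L(1) by simp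
    qed
  qed
  have divide: "(\<lambda>\<epsilon>. f \<epsilon> / g \<epsilon>) \<in> ?G" if f: "f \<in> ?G" and g: "g \<in> ?G" for f g
  proof -
    obtain c xs where c: "c > 0" "admissible M Pm xs" "((\<lambda>\<epsilon>. f \<epsilon> / mono_fn Pm xs \<epsilon>) \<longlongrightarrow> c) (at_right 0)"
      using f by (rule ratio_scaleE)
    obtain d ys where d: "d > 0" "admissible M Pm ys" "((\<lambda>\<epsilon>. g \<epsilon> / mono_fn Pm ys \<epsilon>) \<longlongrightarrow> d) (at_right 0)"
      using g by (rule ratio_scaleE)
    \<comment> \<open>Exchanging the two targets in each triple inverts a monomial.\<close>
    let ?zs = "xs @ map (\<lambda>(a, b, d). (a, d, b)) ys"
    have "((\<lambda>\<epsilon>. (f \<epsilon> / mono_fn Pm xs \<epsilon>) / (g \<epsilon> / mono_fn Pm ys \<epsilon>)) \<longlongrightarrow> c / d) (at_right 0)"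
      using c d by (intro tendsto_divide) auto
    then have "((\<lambda>\<epsilon>. f \<epsilon> / g \<epsilon> / mono_fn Pm ?zs \<epsilon>) \<longlongrightarrow> c / d) (at_right 0)"
      by (simp add: mono_fn_append mono_fn_swap mult_ac)
    moreover have "admissible M Pm ?zs" using c d by (intro admissible_append admissible_swap) auto
    moreover have "0 < c / d" using c d by simp
    ultimately show ?thesis using posD[OF f] posD[OF g] by (intro ratio_scaleI[of _ "c / d" M Pm ?zs]) auto
  qed
  have add_aux: "(\<lambda>\<epsilon>. f \<epsilon> + g \<epsilon>) \<in> ?G"
    if f: "f \<in> ?G" and g: "g \<in> ?G" and l: "l \<ge> 0" "((\<lambda>\<epsilon>. f \<epsilon> / g \<epsilon>) \<longlongrightarrow> l) (at_right 0)" for f g l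
  proof -
    obtain d ys where d: "d > 0" "admissible M Pm ys" "((\<lambda>\<epsilon>. g \<epsilon> / mono_fn Pm ys \<epsilon>) \<longlongrightarrow> d) (at_right 0)"
      using g by (rule ratio_scaleE)
    \<comment> \<open>If \<open>f / g\<close> converges, then \<open>g\<close> sets the order of the
      sum and the limit enters only the constant.\<close>
    have "((\<lambda>\<epsilon>. (f \<epsilon> / g \<epsilon> + 1) * (g \<epsilon> / mono_fn Pm ys \<epsilon>)) \<longlongrightarrow> (l + 1) * d) (at_right 0)"
      using d l by (intro tendsto_intros)
    moreover have "\<forall>\<^sub>F \<epsilon> in at_right 0. (f \<epsilon> / g \<epsilon> + 1) * (g \<epsilon> / mono_fn Pm ys \<epsilon>) = (f \<epsilon> + g \<epsilon>) / mono_fn Pm ys \<epsilon>"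
      using eventually_pos_at_right
    proof eventually_elim
      case (elim \<epsilon>)
      then show ?case using posD[OF g elim] mono_fn_pos[OF d(2) elim] by (simp add: field_simps)
    qed
    ultimately have "((\<lambda>\<epsilon>. (f \<epsilon> + g \<epsilon>) / mono_fn Pm ys \<epsilon>) \<longlongrightarrow> (l + 1) * d) (at_right 0)"
      by (rule Lim_transform_eventually)
    moreover have "0 < (l + 1) * d" using d l by simp
    ultimately show ?thesis using posD[OF f] posD[OF g] d(2)
      by (intro ratio_scaleI[of _ "(l + 1) * d" M Pm ys]) (auto intro: add_pos_pos)
  qed
  show ?thesis
  proof
    fix f g assume f: "f \<in> ?G" and g: "g \<in> ?G"
    show "(\<lambda>\<epsilon>. f \<epsilon> / g \<epsilon>) \<in> ?G" by (rule divide[OF f g])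
    show "(\<lambda>\<epsilon>. f \<epsilon> + g \<epsilon>) \<in> ?G"
      using limD[OF divide[OF f g]]
    proof
      assume "\<exists>l\<ge>0. ((\<lambda>\<epsilon>. f \<epsilon> / g \<epsilon>) \<longlongrightarrow> l) (at_right 0)"
      then show ?thesis using add_aux[OF f g] by blast
    next
      assume "((\<lambda>\<epsilon>. 1 / (f \<epsilon> / g \<epsilon>)) \<longlongrightarrow> 0) (at_right 0)"
      then have "((\<lambda>\<epsilon>. g \<epsilon> / f \<epsilon>) \<longlongrightarrow> 0) (at_right 0)" by simp
      from add_aux[OF g f _ this] show ?thesis by (simp add: add.commute)
    qed
  next
    fix f and c :: real assume f: "f \<in> ?G" and c: "0 < c"
    obtain d ys where d: "d > 0" "admissible M Pm ys" "((\<lambda>\<epsilon>. f \<epsilon> / mono_fn Pm ys \<epsilon>) \<longlongrightarrow> d) (at_right 0)"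
      using f by (rule ratio_scaleE)
    from tendsto_mult[OF tendsto_const[of c] d(3)]
    have "((\<lambda>\<epsilon>. c * f \<epsilon> / mono_fn Pm ys \<epsilon>) \<longlongrightarrow> c * d) (at_right 0)" by simp
    moreover have "0 < c * d" using c d by simp
    ultimately show "(\<lambda>\<epsilon>. c * f \<epsilon>) \<in> ?G"
      using posD[OF f] c d(2) by (intro ratio_scaleI[of _ "c * d" M Pm ys]) auto
  next
    fix f g assume f: "f \<in> ?G" and e: "\<And>\<epsilon>::real. 0 < \<epsilon> \<Longrightarrow> g \<epsilon> = f \<epsilon>"
    obtain d ys where d: "d > 0" "admissible M Pm ys" "((\<lambda>\<epsilon>. f \<epsilon> / mono_fn Pm ys \<epsilon>) \<longlongrightarrow> d) (at_right 0)"
      using f by (rule ratio_scaleE)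
    have "\<forall>\<^sub>F \<epsilon> in at_right 0. f \<epsilon> / mono_fn Pm ys \<epsilon> = g \<epsilon> / mono_fn Pm ys \<epsilon>"
      using eventually_pos_at_right by eventually_elim (simp add: e)
    from Lim_transform_eventually[OF d(3) this] show "g \<in> ?G"
      using posD[OF f] e d(1,2) by (intro ratio_scaleI[of _ d M Pm ys]) auto
  next
    fix f and \<epsilon> :: real assume "f \<in> ?G" "0 < \<epsilon>" then show "0 < f \<epsilon>" by (rule posD)
  next
    fix f assume "f \<in> ?G"
    then show "(\<exists>l. (f \<longlongrightarrow> l) (at_right 0)) \<or> ((\<lambda>\<epsilon>. 1 / f \<epsilon>) \<longlongrightarrow> 0) (at_right 0)" using limD by blast
  qed
qed

section \<open>Flows from occupation sequences\<close>

text \<open>With \<open>n\<close> the graph distance of \<open>i\<close> to the complement of \<open>K\<close>, take \<open>\<phi> i = C * (1 - \<beta> ^ n)\<close>: a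
  step towards the complement has probability at least \<open>2 * \<beta>\<close> and outweighs all other steps.\<close>
lemma lyapunov:
  fixes P :: "nat \<Rightarrow> nat \<Rightarrow> real"
  assumes K: "K \<subseteq> {..<M}" and \<eta>: "\<eta> \<le> 1/2"
    and exit: "\<And>i. i \<in> K \<Longrightarrow> \<exists>l. l \<notin> K \<and> (i, l) \<in> {(a, b). a < M \<and> b < M \<and> P a b > 0}\<^sup>*"
  shows "\<exists>\<phi> :: nat \<Rightarrow> real. (\<forall>i. 0 \<le> \<phi> i) \<and> (\<forall>i\<in>K. \<forall>w f. 0 \<le> w \<longrightarrow> (\<forall>j<M. 0 \<le> f j) \<longrightarrow> (\<Sum>j<M. f j) = w \<longrightarrow>
       (\<forall>j<M. near \<eta> (f j) (P i j * w)) \<longrightarrow> (\<Sum>j\<in>K. f j * \<phi> j) + w \<le> w * \<phi> i)"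
proof -
  define R where "R = {(a, b). a < M \<and> b < M \<and> P a b > 0}"
  define dist where "dist i = (LEAST n. \<exists>l. l \<notin> K \<and> (i, l) \<in> R ^^ n)" for i
  have finR: "finite R" unfolding R_def by (rule finite_subset[of _ "{..<M} \<times> {..<M}"]) auto
  \<comment> \<open>Half of the least positive entry, because the tolerance
    \<open>\<eta> \<le> 1/2\<close> may halve the mass of a step; the inserted 1 keeps
    \<open>p\<close> at most 1/2.\<close>
  define p where "p = Min (insert 1 ((\<lambda>(a, b). P a b) ` R)) / 2"
  have "Min (insert 1 ((\<lambda>(a, b). P a b) ` R)) \<in> insert 1 ((\<lambda>(a, b). P a b) ` R)"
    using finR by (intro Min_in) auto
  then have p0: "0 < p" unfolding p_def by (auto simp: R_def)
  have ple: "2 * p \<le> P a b" if "(a, b) \<in> R" for a b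
    unfolding p_def using finR that by (auto intro!: Min_le)
  have p1: "p \<le> 1/2" unfolding p_def using finR by auto
  \<comment> \<open>With this ratio the gain \<open>p * \<beta> ^ d\<close> from a step to distance
    \<open>d\<close> is twice the deficit \<open>\<beta> ^ Suc d\<close> of a state at distance
    \<open>Suc d\<close>, both up to the factor \<open>C\<close>.\<close>
  define \<beta> where "\<beta> = p / 2"
  have \<beta>: "0 < \<beta>" "\<beta> < 1" using p0 p1 by (auto simp: \<beta>_def)
  define n0 where "n0 = Max (insert 0 (dist ` K))"
  have finK: "finite K" using K finite_subset by blast
  have n0: "dist i \<le> n0" if "i \<in> K" for i unfolding n0_def using finK that by auto
  \<comment> \<open>Chosen so that the surplus \<open>C * \<beta> ^ Suc d\<close> is at least 1 at
    all distances occurring in \<open>K\<close>, which pays for the term \<open>w\<close>.\<close>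
  define C where "C = 2 / (p * \<beta> ^ n0)"
  have C: "0 < C" using p0 \<beta> by (simp add: C_def)
  define \<phi> where "\<phi> i = C * (1 - \<beta> ^ dist i)" for i
  have \<phi>0: "0 \<le> \<phi> i" for i using C \<beta> by (simp add: \<phi>_def power_le_one)
  have \<phi>C: "\<phi> i \<le> C" for i using C \<beta> by (simp add: \<phi>_def)
  have "(\<Sum>j\<in>K. f j * \<phi> j) + w \<le> w * \<phi> i"
    if i: "i \<in> K" and w: "0 \<le> w" and f0: "\<And>j. j < M \<Longrightarrow> 0 \<le> f j" and fs: "(\<Sum>j<M. f j) = w"
      and nr: "\<And>j. j < M \<Longrightarrow> near \<eta> (f j) (P i j * w)" for i w f
  proof -
    obtain l where l: "l \<notin> K" "(i, l) \<in> R\<^sup>*" using exit[OF i] unfolding R_def by blast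
    then obtain n where "(i, l) \<in> R ^^ n" using rtrancl_imp_relpow[OF l(2)] by blast
    with l(1) have "\<exists>n l. l \<notin> K \<and> (i, l) \<in> R ^^ n" by blast
    from LeastI_ex[OF this] have "\<exists>l. l \<notin> K \<and> (i, l) \<in> R ^^ dist i" unfolding dist_def .
    then obtain l' where l': "l' \<notin> K" "(i, l') \<in> R ^^ dist i" by blast
    have "dist i \<noteq> 0" using l' i by (cases "dist i") auto
    then obtain d where d: "dist i = Suc d" by (cases "dist i") auto
    from l'(2) obtain s where s: "(i, s) \<in> R" "(s, l') \<in> R ^^ d" unfolding d using relpow_Suc_D2 by metis
    have sd: "dist s \<le> d" unfolding dist_def using l'(1) s(2) by (intro Least_le) blast
    have sM: "s < M" using s(1) by (simp add: R_def)
    have "(1 - \<eta>) * (P i s * w) \<le> f s" using near_lower[OF nr[OF sM]] .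
    moreover have "p * w \<le> (1 - \<eta>) * (P i s * w)"
    proof -
      have "1/2 * (2 * p * w) \<le> (1 - \<eta>) * (P i s * w)"
        using \<eta> ple[OF s(1)] p0 w by (intro mult_mono mult_right_mono) auto
      then show ?thesis by simp
    qed
    ultimately have fs1: "p * w \<le> f s" by simp
    have "(\<Sum>j\<in>K. f j * \<phi> j) \<le> (\<Sum>j<M. f j * \<phi> j)"
      using K f0 \<phi>0 by (intro sum_mono2) auto
    also have "\<dots> = f s * \<phi> s + (\<Sum>j\<in>{..<M} - {s}. f j * \<phi> j)"
      using sM by (intro sum.remove) auto
    also have "(\<Sum>j\<in>{..<M} - {s}. f j * \<phi> j) \<le> (\<Sum>j\<in>{..<M} - {s}. f j * C)"
      using f0 \<phi>C by (intro sum_mono mult_left_mono) auto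
    also have "\<dots> = C * (w - f s)"
      using fs sum.remove[of "{..<M}" s f] sM by (simp flip: sum_distrib_right)
    finally have 1: "(\<Sum>j\<in>K. f j * \<phi> j) \<le> w * C - f s * C * \<beta> ^ dist s"
      by (simp add: \<phi>_def algebra_simps)
    have "p * w * C * \<beta> ^ d \<le> f s * C * \<beta> ^ dist s"
      using fs1 C \<beta> sd p0 w f0[OF sM] by (intro mult_mono power_decreasing) auto
    moreover have "w \<le> w * (C * \<beta> ^ d * (p / 2))"
    proof -
      have "\<beta> ^ n0 \<le> \<beta> ^ d" using \<beta> n0[OF i] d by (intro power_decreasing) auto
      then have "C * \<beta> ^ n0 * (p / 2) \<le> C * \<beta> ^ d * (p / 2)"
        using C p0 by (intro mult_right_mono mult_left_mono) auto
      moreover have "C * \<beta> ^ n0 * (p / 2) = 1" using p0 \<beta> by (simp add: C_def)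
      ultimately show ?thesis using w mult_left_mono[of 1 "C * \<beta> ^ d * (p / 2)" w] by simp
    qed
    moreover have "w * \<phi> i = w * C - w * (C * \<beta> ^ d * (p / 2))"
      by (simp add: \<phi>_def d \<beta>_def algebra_simps)
    moreover have "p * w * C * \<beta> ^ d = 2 * (w * (C * \<beta> ^ d * (p / 2)))" by (simp add: algebra_simps)
    ultimately show ?thesis using 1 by linarith
  qed
  with \<phi>0 show ?thesis by (intro exI[of _ \<phi>]) blast
qed

lemma near_suminf:
  assumes "summable f" "summable g" "\<And>n. near d (f n) (g n)"
  shows "near d (suminf f) (suminf g)"
proof -
  have "suminf f \<le> (\<Sum>n. (1 + d) * g n)"
    using assms near_upper by (intro suminf_le summable_mult) blast+
  moreover have "(\<Sum>n. (1 - d) * g n) \<le> suminf f"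
    using assms near_lower by (intro suminf_le summable_mult) blast+
  ultimately have "suminf f \<le> (1 + d) * suminf g" "(1 - d) * suminf g \<le> suminf f"
    using suminf_mult[OF assms(2), of "1 + d"] suminf_mult[OF assms(2), of "1 - d"] by linarith+
  then show ?thesis by (simp add: near_def algebra_simps abs_le_iff)
qed

text \<open>\<open>a n i\<close> is the mass at \<open>i\<close> at time \<open>n\<close>,
  \<open>f n\<close> the jumps at that time and \<open>g\<close> an external inflow. Up to this
  inflow, the Lyapunov function of \<open>lyapunov\<close> decreases by at least the present mass at
  each step, so the total over time is finite; summing the step equation then gives the balance
  equation.\<close>

lemma occupation_flow:
  fixes a g :: "nat \<Rightarrow> nat \<Rightarrow> real" and f :: "nat \<Rightarrow> nat \<Rightarrow> nat \<Rightarrow> real"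
  assumes K: "K \<subseteq> {..<M}" and \<eta>: "\<eta> \<le> 1/2" and P0: "\<And>i j. i \<in> K \<Longrightarrow> j < M \<Longrightarrow> 0 \<le> P i j"
    and exit: "\<And>i. i \<in> K \<Longrightarrow> \<exists>l. l \<notin> K \<and> (i, l) \<in> {(a, b). a < M \<and> b < M \<and> P a b > 0}\<^sup>*"
    and a0: "\<And>n i. i \<in> K \<Longrightarrow> 0 \<le> a n i"
    and f0: "\<And>n i j. i \<in> K \<Longrightarrow> j < M \<Longrightarrow> 0 \<le> f n i j"
    and g0: "\<And>n i. i \<in> K \<Longrightarrow> 0 \<le> g n i" and gs: "\<And>i. i \<in> K \<Longrightarrow> summable (\<lambda>n. g n i)"
    and nr: "\<And>n i j. i \<in> K \<Longrightarrow> j < M \<Longrightarrow> near \<eta> (f n i j) (P i j * a n i)"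
    and row: "\<And>n i. i \<in> K \<Longrightarrow> (\<Sum>j<M. f n i j) = a n i"
    and step: "\<And>n j. j \<in> K \<Longrightarrow> a (Suc n) j = g n j + (\<Sum>i\<in>K. f n i j)"
  shows "i \<in> K \<Longrightarrow> summable (\<lambda>n. a n i)"
    and "i \<in> K \<Longrightarrow> j < M \<Longrightarrow> summable (\<lambda>n. f n i j)"
    and "flow M P \<eta> K (\<lambda>j. a 0 j + (\<Sum>n. g n j)) (\<lambda>i. \<Sum>n. a n i) (\<lambda>i j. \<Sum>n. f n i j)"
proof -
  have finK: "finite K" using K finite_subset by blast
  obtain \<phi> :: "nat \<Rightarrow> real" where \<phi>0: "\<And>i. 0 \<le> \<phi> i" and
    \<phi>: "\<forall>i\<in>K. \<forall>w f. 0 \<le> w \<longrightarrow> (\<forall>j<M. 0 \<le> f j) \<longrightarrow> (\<Sum>j<M. f j) = w \<longrightarrow>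
       (\<forall>j<M. near \<eta> (f j) (P i j * w)) \<longrightarrow> (\<Sum>j\<in>K. f j * \<phi> j) + w \<le> w * \<phi> i"
    using lyapunov[OF K \<eta> exit] by blast
  define \<Phi> where "\<Phi> n = (\<Sum>j\<in>K. a n j * \<phi> j)" for n
  define \<Gamma> where "\<Gamma> n = (\<Sum>j\<in>K. g n j * \<phi> j)" for n
  have \<Gamma>s: "summable \<Gamma>" unfolding \<Gamma>_def using gs by (intro summable_sum summable_mult2)
  have \<Gamma>0: "0 \<le> \<Gamma> n" for n unfolding \<Gamma>_def using g0 \<phi>0 by (intro sum_nonneg) auto
  have \<Phi>0: "0 \<le> \<Phi> n" for n unfolding \<Phi>_def using a0 \<phi>0 by (intro sum_nonneg) auto
  have dec: "\<Phi> (Suc n) + (\<Sum>i\<in>K. a n i) \<le> \<Phi> n + \<Gamma> n" for n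
  proof -
    have "\<Phi> (Suc n) = \<Gamma> n + (\<Sum>j\<in>K. (\<Sum>i\<in>K. f n i j) * \<phi> j)"
      by (simp add: \<Phi>_def \<Gamma>_def step distrib_right sum.distrib)
    also have "(\<Sum>j\<in>K. (\<Sum>i\<in>K. f n i j) * \<phi> j) = (\<Sum>i\<in>K. \<Sum>j\<in>K. f n i j * \<phi> j)"
      by (simp add: sum_distrib_right) (rule sum.swap)
    finally have "\<Phi> (Suc n) + (\<Sum>i\<in>K. a n i) = \<Gamma> n + (\<Sum>i\<in>K. (\<Sum>j\<in>K. f n i j * \<phi> j) + a n i)"
      by (simp add: sum.distrib)
    also have "\<dots> \<le> \<Gamma> n + \<Phi> n"
      unfolding \<Phi>_def by (intro add_left_mono sum_mono \<phi>[rule_format] a0 f0 row nr)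
    finally show ?thesis by simp
  qed
  have part: "(\<Sum>n<N. \<Sum>i\<in>K. a n i) + \<Phi> N \<le> \<Phi> 0 + (\<Sum>n<N. \<Gamma> n)" for N
  proof (induction N)
    case (Suc N)
    then show ?case using dec[of N] by simp
  qed simp
  have bound: "(\<Sum>n<N. \<Sum>i\<in>K. a n i) \<le> \<Phi> 0 + suminf \<Gamma>" for N
    using part[of N] \<Phi>0[of N] sum_le_suminf[OF \<Gamma>s, of "{..<N}"] \<Gamma>0 by force
  have sa: "summable (\<lambda>n. a n i)" if i: "i \<in> K" for i
  proof (rule summableI_nonneg_bounded)
    fix N
    have "(\<Sum>n<N. a n i) \<le> (\<Sum>n<N. \<Sum>i\<in>K. a n i)"
      using finK i a0 by (intro sum_mono member_le_sum) auto
    then show "(\<Sum>n<N. a n i) \<le> \<Phi> 0 + suminf \<Gamma>" using bound[of N] by linarith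
  qed (use a0 i in auto)
  then show "i \<in> K \<Longrightarrow> summable (\<lambda>n. a n i)" .
  have sf: "summable (\<lambda>n. f n i j)" if ij: "i \<in> K" "j < M" for i j
  proof (rule summable_comparison_test'[OF sa[OF ij(1)], of 0])
    fix n
    have "f n i j \<le> (\<Sum>j<M. f n i j)" using ij f0 by (intro member_le_sum) auto
    then show "norm (f n i j) \<le> a n i" using row[OF ij(1)] f0[OF ij] by simp
  qed
  then show "i \<in> K \<Longrightarrow> j < M \<Longrightarrow> summable (\<lambda>n. f n i j)" .
  show "flow M P \<eta> K (\<lambda>j. a 0 j + (\<Sum>n. g n j)) (\<lambda>i. \<Sum>n. a n i) (\<lambda>i j. \<Sum>n. f n i j)"
    unfolding flow_def
  proof (intro conjI ballI allI impI)
    fix i assume i: "i \<in> K"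
    show "0 \<le> a 0 i + (\<Sum>n. g n i)" using a0[OF i] g0[OF i] gs[OF i] by (intro add_nonneg_nonneg suminf_nonneg) auto
    show "0 \<le> (\<Sum>n. a n i)" using a0[OF i] sa[OF i] by (intro suminf_nonneg) auto
    have "(\<Sum>j<M. \<Sum>n. f n i j) = (\<Sum>n. \<Sum>j<M. f n i j)" using sf[OF i] by (intro suminf_sum[symmetric]) auto
    then show "(\<Sum>j<M. \<Sum>n. f n i j) = (\<Sum>n. a n i)" using row[OF i] by simp
    fix j assume j: "j < M"
    show "0 \<le> (\<Sum>n. f n i j)" using f0[OF i j] sf[OF i j] by (intro suminf_nonneg) auto
    have "near \<eta> (\<Sum>n. f n i j) (\<Sum>n. P i j * a n i)"
      using sf[OF i j] sa[OF i] nr[OF i j] by (intro near_suminf summable_mult) auto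
    then show "near \<eta> (\<Sum>n. f n i j) (P i j * (\<Sum>n. a n i))" using suminf_mult[OF sa[OF i]] by simp
  next
    fix j assume j: "j \<in> K"
    then have jM: "j < M" using K by blast
    have "(\<Sum>n. a n j) = a 0 j + (\<Sum>n. a (Suc n) j)" using suminf_split_head[OF sa[OF j]] by simp
    also have "(\<Sum>n. a (Suc n) j) = (\<Sum>n. g n j + (\<Sum>i\<in>K. f n i j))" using step[OF j] by simp
    also have "\<dots> = (\<Sum>n. g n j) + (\<Sum>n. \<Sum>i\<in>K. f n i j)"
      using gs[OF j] sf[OF _ jM] by (intro suminf_add[symmetric] summable_sum) auto
    also have "(\<Sum>n. \<Sum>i\<in>K. f n i j) = (\<Sum>i\<in>K. \<Sum>n. f n i j)" using sf[OF _ jM] by (intro suminf_sum) auto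
    finally show "(\<Sum>n. a n j) = a 0 j + (\<Sum>n. g n j) + (\<Sum>i\<in>K. \<Sum>n. f n i j)" by simp
  qed
qed

section \<open>One step of the chain\<close>

lemma measurable_history:
  assumes "\<And>n. X n \<in> Pr \<rightarrow>\<^sub>M borel" "\<And>n. T n \<in> Pr \<rightarrow>\<^sub>M borel"
  shows "history X T n \<in> Pr \<rightarrow>\<^sub>M PiM {..n} (\<lambda>_. borel \<Otimes>\<^sub>M borel)"
  unfolding history_def[abs_def] using assms by (intro measurable_restrict measurable_Pair) auto

text \<open>The chain property is given only for product events of history and next step. Two
  monotone-class inductions extend it to nonnegative functions, first in \<open>g\<close> with an
  indicator of the history, then in \<open>f\<close>.\<close>

lemma chain_one_step:
  fixes Q :: "'a::metric_space \<Rightarrow> ('a \<times> real) measure"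
  assumes ch: "MRP_chain Q x Pr X T" and Q: "Q \<in> borel \<rightarrow>\<^sub>M prob_algebra (borel \<Otimes>\<^sub>M borel)"
    and f: "f \<in> borel_measurable (PiM {..n} (\<lambda>_. borel \<Otimes>\<^sub>M borel))"
    and g: "g \<in> borel_measurable (borel \<Otimes>\<^sub>M borel)"
  shows "(\<integral>\<^sup>+\<omega>. f (history X T n \<omega>) * g (X (Suc n) \<omega>, T (Suc n) \<omega>) \<partial>Pr) =
    (\<integral>\<^sup>+\<omega>. f (history X T n \<omega>) * (\<integral>\<^sup>+p. g p \<partial>Q (X n \<omega>)) \<partial>Pr)"
proof -
  let ?h = "history X T n" and ?Y = "\<lambda>\<omega>. (X (Suc n) \<omega>, T (Suc n) \<omega>)" and ?H = "PiM {..n} (\<lambda>_. borel \<Otimes>\<^sub>M borel)"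
  have X[measurable]: "\<And>n. X n \<in> Pr \<rightarrow>\<^sub>M borel" and T[measurable]: "\<And>n. T n \<in> Pr \<rightarrow>\<^sub>M borel"
    and pr: "prob_space Pr" using ch unfolding MRP_chain_def by blast+
  interpret prob_space Pr by (rule pr)
  have Qs[measurable]: "Q \<in> borel \<rightarrow>\<^sub>M subprob_algebra (borel \<Otimes>\<^sub>M borel)" using Q by (rule measurable_prob_algebraD)
  have h[measurable]: "history X T n \<in> Pr \<rightarrow>\<^sub>M ?H"
    by (rule measurable_history) measurable
  have setsQ[measurable_cong]: "sets (Q y) = sets (borel \<Otimes>\<^sub>M borel)" for y
    using subprob_measurableD(2)[OF Qs, of y] by simp
  have psQ: "prob_space (Q y)" for y
    using measurable_space[OF Q, of y] by (simp add: space_prob_algebra)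
  have nnQ[measurable]: "(\<lambda>y. \<integral>\<^sup>+p. u p \<partial>Q y) \<in> borel_measurable borel"
    if "u \<in> borel_measurable (borel \<Otimes>\<^sub>M borel)" for u
    using measurable_compose[OF Qs nn_integral_measurable_subprob_algebra[OF that]] .
  have sets_case: "(\<integral>\<^sup>+\<omega>. indicator H (?h \<omega>) * indicator B (?Y \<omega>) \<partial>Pr) =
      (\<integral>\<^sup>+\<omega>. indicator H (?h \<omega>) * (\<integral>\<^sup>+p. indicator B p \<partial>Q (X n \<omega>)) \<partial>Pr)"
    if H[measurable]: "H \<in> sets (?H)"
      and B[measurable]: "B \<in> sets (borel \<Otimes>\<^sub>M (borel :: real measure))" for H B
  proof -
    let ?E = "{\<omega>\<in>space Pr. ?h \<omega> \<in> H \<and> ?Y \<omega> \<in> B}"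
    have Em: "?E \<in> sets Pr" by measurable
    have "(\<integral>\<^sup>+\<omega>. indicator H (?h \<omega>) * indicator B (?Y \<omega>) \<partial>Pr) =
        (\<integral>\<^sup>+\<omega>. indicator ?E \<omega> \<partial>Pr)"
      by (intro nn_integral_cong) (auto simp: indicator_def)
    also have "\<dots> = ennreal (measure Pr ?E)" using Em by (simp add: emeasure_eq_measure)
    also have "measure Pr ?E = (\<integral>\<omega>. indicator {\<omega>\<in>space Pr. ?h \<omega> \<in> H} \<omega> * measure (Q (X n \<omega>)) B \<partial>Pr)"
      using ch H B unfolding MRP_chain_def by blast
    also have "ennreal \<dots> = (\<integral>\<^sup>+\<omega>. ennreal (indicator {\<omega>\<in>space Pr. ?h \<omega> \<in> H} \<omega> * measure (Q (X n \<omega>)) B) \<partial>Pr)"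
    proof (rule nn_integral_eq_integral[symmetric])
      have le: "indicator A \<omega> * measure (Q (X n \<omega>)) B \<le> 1" for A \<omega>
        using prob_space.prob_le_1[OF psQ, of "X n \<omega>" B] by (simp add: indicator_def)
      show "integrable Pr (\<lambda>\<omega>. indicator {\<omega>\<in>space Pr. ?h \<omega> \<in> H} \<omega> * measure (Q (X n \<omega>)) B)"
      proof (rule integrable_const_bound[of _ 1])
        have [measurable]: "(\<lambda>y. measure (Q y) B) \<in> borel_measurable borel"
          using measurable_compose[OF Qs measurable_measure_subprob_algebra[OF B]] .
        show "(\<lambda>\<omega>. indicator {\<omega>\<in>space Pr. ?h \<omega> \<in> H} \<omega> * measure (Q (X n \<omega>)) B) \<in> borel_measurable Pr"
          by measurable
      qed (use le in \<open>auto simp: abs_mult\<close>)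
    qed simp
    also have "\<dots> = (\<integral>\<^sup>+\<omega>. indicator H (?h \<omega>) * (\<integral>\<^sup>+p. indicator B p \<partial>Q (X n \<omega>)) \<partial>Pr)"
    proof (rule nn_integral_cong)
      fix \<omega> assume "\<omega> \<in> space Pr"
      moreover have "(\<integral>\<^sup>+p. indicator B p \<partial>Q (X n \<omega>)) = ennreal (measure (Q (X n \<omega>)) B)"
        using B by (simp add: setsQ finite_measure.emeasure_eq_measure[OF prob_space.finite_measure[OF psQ]])
      ultimately show "ennreal (indicator {\<omega>\<in>space Pr. ?h \<omega> \<in> H} \<omega> * measure (Q (X n \<omega>)) B) =
          indicator H (?h \<omega>) * (\<integral>\<^sup>+p. indicator B p \<partial>Q (X n \<omega>))"
        by (simp add: indicator_def)
    qed
    finally show ?thesis .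
  qed
  have ind_case: "(\<integral>\<^sup>+\<omega>. indicator H (?h \<omega>) * g (?Y \<omega>) \<partial>Pr) =
      (\<integral>\<^sup>+\<omega>. indicator H (?h \<omega>) * (\<integral>\<^sup>+p. g p \<partial>Q (X n \<omega>)) \<partial>Pr)"
    if H[measurable]: "H \<in> sets (?H)" for H
    using g
  proof (induction rule: borel_measurable_induct)
    case (cong u v)
    have "(\<integral>\<^sup>+p. u p \<partial>Q (X n \<omega>)) = (\<integral>\<^sup>+p. v p \<partial>Q (X n \<omega>))" for \<omega>
      using cong(3) by (intro nn_integral_cong) (simp add: space_pair_measure)
    moreover have "u = v" using cong(3) by (auto simp: space_pair_measure fun_eq_iff)
    ultimately show ?case using cong(4) by simp
  next
    case (set B)
    then show ?case by (rule sets_case[OF H])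
  next
    case (mult u c)
    note [measurable] = mult.hyps(2)
    have "(\<integral>\<^sup>+\<omega>. indicator H (?h \<omega>) * (c * u (?Y \<omega>)) \<partial>Pr) =
       (\<integral>\<^sup>+\<omega>. c * (indicator H (?h \<omega>) * u (?Y \<omega>)) \<partial>Pr)" by (simp add: mult_ac)
    also have "\<dots> = c * (\<integral>\<^sup>+\<omega>. indicator H (?h \<omega>) * u (?Y \<omega>) \<partial>Pr)"
      by (rule nn_integral_cmult) measurable
    also have "\<dots> = c * (\<integral>\<^sup>+\<omega>. indicator H (?h \<omega>) * (\<integral>\<^sup>+p. u p \<partial>Q (X n \<omega>)) \<partial>Pr)" using mult.IH by simp
    also have "\<dots> = (\<integral>\<^sup>+\<omega>. c * (indicator H (?h \<omega>) * (\<integral>\<^sup>+p. u p \<partial>Q (X n \<omega>))) \<partial>Pr)"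
      by (rule nn_integral_cmult[symmetric]) measurable
    also have "\<dots> = (\<integral>\<^sup>+\<omega>. indicator H (?h \<omega>) * (\<integral>\<^sup>+p. c * u p \<partial>Q (X n \<omega>)) \<partial>Pr)"
      by (simp add: nn_integral_cmult mult_ac)
    finally show ?case .
  next
    case (add u v)
    note [measurable] = add.hyps(1,3)
    show ?case using add.IH
      by (simp add: nn_integral_add distrib_left)
  next
    case (seq U)
    note [measurable] = seq.hyps(1)
    have inc: "incseq (\<lambda>i. U i p)" for p using seq.hyps(3) unfolding incseq_def le_fun_def by blast
    have "(\<integral>\<^sup>+\<omega>. indicator H (?h \<omega>) * (SUP i. U i (?Y \<omega>)) \<partial>Pr) =
       (\<integral>\<^sup>+\<omega>. (SUP i. indicator H (?h \<omega>) * U i (?Y \<omega>)) \<partial>Pr)"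
      by (simp add: SUP_mult_left_ennreal)
    also have "\<dots> = (SUP i. \<integral>\<^sup>+\<omega>. indicator H (?h \<omega>) * U i (?Y \<omega>) \<partial>Pr)"
      using inc by (intro nn_integral_monotone_convergence_SUP) (auto simp: incseq_def le_fun_def intro!: mult_left_mono)
    also have "\<dots> = (SUP i. \<integral>\<^sup>+\<omega>. indicator H (?h \<omega>) * (\<integral>\<^sup>+p. U i p \<partial>Q (X n \<omega>)) \<partial>Pr)"
      using seq.IH by simp
    also have "\<dots> = (\<integral>\<^sup>+\<omega>. (SUP i. indicator H (?h \<omega>) * (\<integral>\<^sup>+p. U i p \<partial>Q (X n \<omega>))) \<partial>Pr)"
      using inc by (intro nn_integral_monotone_convergence_SUP[symmetric])
        (auto simp: incseq_def le_fun_def intro!: mult_left_mono nn_integral_mono)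
    also have "\<dots> = (\<integral>\<^sup>+\<omega>. indicator H (?h \<omega>) * (SUP i. \<integral>\<^sup>+p. U i p \<partial>Q (X n \<omega>)) \<partial>Pr)"
      by (simp add: SUP_mult_left_ennreal)
    also have "\<dots> = (\<integral>\<^sup>+\<omega>. indicator H (?h \<omega>) * (\<integral>\<^sup>+p. (SUP i. U i p) \<partial>Q (X n \<omega>)) \<partial>Pr)"
      using seq.hyps(3) by (subst nn_integral_monotone_convergence_SUP) (auto simp: image_image)
    finally show ?case by (simp add: image_image)
  qed
  note [measurable] = g
  show ?thesis using f
  proof (induction rule: borel_measurable_induct)
    case (cong u v)
    have "u (?h \<omega>) = v (?h \<omega>)" if "\<omega> \<in> space Pr" for \<omega>
      using cong(3) measurable_space[OF h that] by blast
    then have "(\<integral>\<^sup>+\<omega>. u (?h \<omega>) * G \<omega> \<partial>Pr) = (\<integral>\<^sup>+\<omega>. v (?h \<omega>) * G \<omega> \<partial>Pr)" for G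
      by (intro nn_integral_cong) simp
    then show ?case using cong(4) by simp
  next
    case (set H)
    then show ?case by (rule ind_case)
  next
    case (mult u c)
    note [measurable] = mult.hyps(2)
    show ?case using mult.IH by (simp add: mult.assoc nn_integral_cmult)
  next
    case (add u v)
    note [measurable] = add.hyps(1,3)
    show ?case using add.IH by (simp add: nn_integral_add distrib_right)
  next
    case (seq U)
    note [measurable] = seq.hyps(1)
    have inc: "incseq (\<lambda>i. U i p)" for p using seq.hyps(3) unfolding incseq_def le_fun_def by blast
    have sup: "(\<integral>\<^sup>+\<omega>. (SUP i. U i (?h \<omega>)) * G \<omega> \<partial>Pr) = (SUP i. \<integral>\<^sup>+\<omega>. U i (?h \<omega>) * G \<omega> \<partial>Pr)"
      if [measurable]: "G \<in> borel_measurable Pr" for G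
    proof -
      have "(\<integral>\<^sup>+\<omega>. (SUP i. U i (?h \<omega>)) * G \<omega> \<partial>Pr) = (\<integral>\<^sup>+\<omega>. (SUP i. U i (?h \<omega>) * G \<omega>) \<partial>Pr)"
        by (simp add: SUP_mult_right_ennreal)
      also have "\<dots> = (SUP i. \<integral>\<^sup>+\<omega>. U i (?h \<omega>) * G \<omega> \<partial>Pr)"
        using inc by (intro nn_integral_monotone_convergence_SUP) (auto simp: incseq_def le_fun_def intro!: mult_right_mono)
      finally show ?thesis .
    qed
    show ?case using seq.IH by (simp add: image_image sup)
  qed
qed

section \<open>Exit from a cluster at a fixed parameter\<close>

lemma enn2real_sum_cong: "(\<And>i. i \<in> I \<Longrightarrow> f i < \<top>) \<Longrightarrow> enn2real (\<Sum>i\<in>I. f i) = (\<Sum>i\<in>I. enn2real (f i))"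
  by (simp add: enn2real_sum)

text \<open>The mean of the holding time multiplied by the transition probability, so that it makes
  sense when that probability is 0; the equation with \<open>ennreal c\<close> includes finiteness
  of the integral.\<close>

definition time_near :: "real \<Rightarrow> ('a \<times> real) measure \<Rightarrow> 'a set \<Rightarrow> real \<Rightarrow> bool" where
  "time_near d N B t \<longleftrightarrow>
     (\<exists>c. (\<integral>\<^sup>+q. ennreal (snd q) * indicator B (fst q) \<partial>N) = ennreal c \<and> near d c (t * kerP N B))"

text \<open>One \<epsilon> is fixed, and the uniform limits in (a) and (b) enter as a single
  tolerance \<open>\<eta>\<close>. Closeness is required only on \<open>K\<close>, where the chain
  lives before the exit, and the cluster map \<open>p\<close> enters only through its fibre over
  \<open>p x\<close>.\<close>

locale cluster_exit =
  fixes Q :: "'a::metric_space \<Rightarrow> ('a \<times> real) measure" and x :: 'a and Pr :: "'w measure"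
    and X :: "nat \<Rightarrow> 'w \<Rightarrow> 'a" and T :: "nat \<Rightarrow> 'w \<Rightarrow> real" and M :: nat and S :: "nat \<Rightarrow> 'a set"
    and K :: "nat set" and i0 :: nat and P :: "nat \<Rightarrow> nat \<Rightarrow> real" and \<tau> :: "nat \<Rightarrow> real"
    and \<eta> :: real and p :: "'a \<Rightarrow> nat"
  assumes chain: "MRP_chain Q x Pr X T"
    and kernel: "Q \<in> borel \<rightarrow>\<^sub>M prob_algebra (borel \<Otimes>\<^sub>M borel)"
    and nonneg_time: "measure (Q y) (UNIV \<times> {..<0}) = 0"
    and S_borel: "i < M \<Longrightarrow> S i \<in> sets borel"
    and S_disj: "i < M \<Longrightarrow> j < M \<Longrightarrow> i \<noteq> j \<Longrightarrow> S i \<inter> S j = {}"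
    and S_cover: "(\<Union>i<M. S i) = UNIV"
    and K: "K \<subseteq> {..<M}" and i0: "i0 \<in> K" and x: "x \<in> S i0"
    and \<eta>: "0 \<le> \<eta>" "\<eta> \<le> 1/2"
    and P_nonneg: "i \<in> K \<Longrightarrow> j < M \<Longrightarrow> 0 \<le> P i j"
    and \<tau>_pos: "i \<in> K \<Longrightarrow> 0 < \<tau> i"
    and exit: "i \<in> K \<Longrightarrow> \<exists>l. l \<notin> K \<and> (i, l) \<in> {(a, b). a < M \<and> b < M \<and> P a b > 0}\<^sup>*"
    and near_P: "i \<in> K \<Longrightarrow> j < M \<Longrightarrow> y \<in> S i \<Longrightarrow> near \<eta> (kerP (Q y) (S j)) (P i j)"
    and near_T: "i \<in> K \<Longrightarrow> j < M \<Longrightarrow> y \<in> S i \<Longrightarrow> time_near \<eta> (Q y) (S j) (\<tau> i)"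
    and p_iff: "p y = p x \<longleftrightarrow> y \<in> (\<Union>i\<in>K. S i)"
begin

lemma prob_Pr: "prob_space Pr"
  using chain unfolding MRP_chain_def by blast

sublocale prob_space Pr by (rule prob_Pr)

lemma X_meas[measurable]: "X n \<in> Pr \<rightarrow>\<^sub>M borel"
  using chain unfolding MRP_chain_def by blast

lemma T_meas[measurable]: "T n \<in> Pr \<rightarrow>\<^sub>M borel"
  using chain unfolding MRP_chain_def by blast

lemma X_0: "\<omega> \<in> space Pr \<Longrightarrow> X 0 \<omega> = x" and T_0: "\<omega> \<in> space Pr \<Longrightarrow> T 0 \<omega> = 0"
  using chain unfolding MRP_chain_def by blast+

lemma sets_Q: "sets (Q y) = sets (borel \<Otimes>\<^sub>M borel)"
  using subprob_measurableD(2)[OF measurable_prob_algebraD[OF kernel], of y] by simp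

lemma prob_Q: "prob_space (Q y)"
  using measurable_space[OF kernel, of y] by (simp add: space_prob_algebra)

lemma finite_K: "finite K"
  using K finite_subset by blast

lemma K_less: "i \<in> K \<Longrightarrow> i < M"
  using K by blast

lemma sum_indicator_S:
  assumes "J \<subseteq> {..<M}"
  shows "(\<Sum>j\<in>J. indicator (S j) y) = (indicator (\<Union>j\<in>J. S j) y :: 'b::semiring_1)"
proof -
  have "disjoint_family_on S J"
    unfolding disjoint_family_on_def using assms S_disj by (meson lessThan_iff subsetD)
  moreover have "finite J" using assms finite_subset by blast
  ultimately show ?thesis by (simp add: indicator_UN_disjoint)
qed

text \<open>\<open>kerP\<close> counts only nonnegative times; the remaining part is null by
  \<open>nonneg_time\<close>.\<close>

lemma kerP_nn:
  assumes "j < M"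
  shows "(\<integral>\<^sup>+q. indicator (S j) (fst q) \<partial>Q y) = ennreal (kerP (Q y) (S j))"
proof -
  interpret Q: prob_space "Q y" by (rule prob_Q)
  note [measurable] = S_borel[OF assms]
  have m: "A \<times> B \<in> sets (Q y)" if "A \<in> sets borel" "B \<in> sets borel" for A B
    using that by (simp add: sets_Q)
  have "measure (Q y) (S j \<times> UNIV) = measure (Q y) (S j \<times> {0..} \<union> S j \<times> {..<0})"
    by (rule arg_cong[of _ _ "measure (Q y)"]) auto
  also have "\<dots> = measure (Q y) (S j \<times> {0..}) + measure (Q y) (S j \<times> {..<0})"
    by (intro Q.finite_measure_Union m) auto
  also have "measure (Q y) (S j \<times> {..<0}) = 0"
  proof -
    have "measure (Q y) (S j \<times> {..<0}) \<le> measure (Q y) (UNIV \<times> {..<0})"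
      by (intro Q.finite_measure_mono m) auto
    then show ?thesis using nonneg_time[of y] measure_nonneg[of "Q y" "S j \<times> {..<0}"] by linarith
  qed
  finally have "measure (Q y) (S j \<times> UNIV) = kerP (Q y) (S j)" by (simp add: kerP_def)
  moreover have "(\<integral>\<^sup>+q. indicator (S j) (fst q) \<partial>Q y) = (\<integral>\<^sup>+q. indicator (S j \<times> UNIV) q \<partial>Q y)"
    by (intro nn_integral_cong) (auto simp: indicator_def)
  ultimately show ?thesis using m[of "S j" UNIV] by (simp add: Q.emeasure_eq_measure)
qed

lemma kerP_nonneg: "0 \<le> kerP (Q y) B"
  by (simp add: kerP_def)

section \<open>Weighted occupations and jumps before the exit\<close>

definition alive :: "nat \<Rightarrow> 'w \<Rightarrow> bool" where
  "alive n \<omega> \<longleftrightarrow> (\<forall>m\<le>n. X m \<omega> \<in> (\<Union>i\<in>K. S i))"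

definition wt :: "nat \<Rightarrow> nat \<Rightarrow> 'w \<Rightarrow> ennreal" where
  "wt n i \<omega> = (if alive n \<omega> \<and> X n \<omega> \<in> S i then 1 else 0)"

text \<open>Stated literally through \<open>history\<close>, to match the events in
  \<open>MRP_chain\<close>. The weights of interest are the constant 1 and the elapsed time
  \<open>Zt\<close>.\<close>

definition adapted :: "(nat \<Rightarrow> 'w \<Rightarrow> ennreal) \<Rightarrow> bool" where
  "adapted Z \<longleftrightarrow> (\<forall>n. \<exists>f\<in>borel_measurable (PiM {..n} (\<lambda>_. borel \<Otimes>\<^sub>M borel)). \<forall>\<omega>. Z n \<omega> = f (history X T n \<omega>))"

lemma D_borel[measurable]: "(\<Union>i\<in>K. S i) \<in> sets borel"
  using S_borel K_less finite_K by (intro sets.finite_UN) auto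

lemma adapted_mult: "adapted Y \<Longrightarrow> adapted Z \<Longrightarrow> adapted (\<lambda>n \<omega>. Y n \<omega> * Z n \<omega>)"
  unfolding adapted_def
proof
  fix n
  assume "\<forall>n. \<exists>f\<in>borel_measurable (PiM {..n} (\<lambda>_. borel \<Otimes>\<^sub>M borel)). \<forall>\<omega>. Y n \<omega> = f (history X T n \<omega>)"
    "\<forall>n. \<exists>f\<in>borel_measurable (PiM {..n} (\<lambda>_. borel \<Otimes>\<^sub>M borel)). \<forall>\<omega>. Z n \<omega> = f (history X T n \<omega>)"
  then obtain f g where [measurable]: "f \<in> borel_measurable (PiM {..n} (\<lambda>_. borel \<Otimes>\<^sub>M borel))"
      "g \<in> borel_measurable (PiM {..n} (\<lambda>_. borel \<Otimes>\<^sub>M borel))"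
    and "\<forall>\<omega>. Y n \<omega> = f (history X T n \<omega>)" "\<forall>\<omega>. Z n \<omega> = g (history X T n \<omega>)" by metis
  then show "\<exists>f\<in>borel_measurable (PiM {..n} (\<lambda>_. borel \<Otimes>\<^sub>M borel)). \<forall>\<omega>. Y n \<omega> * Z n \<omega> = f (history X T n \<omega>)"
    by (intro bexI[of _ "\<lambda>h. f h * g h"]) auto
qed

lemma adapted_const: "adapted (\<lambda>_ _. c)"
  unfolding adapted_def by (intro allI bexI[of _ "\<lambda>_. c"]) auto

lemma adapted_wt:
  assumes "i < M"
  shows "adapted (\<lambda>n. wt n i)"
  unfolding adapted_def
proof
  fix n
  let ?f = "\<lambda>h :: nat \<Rightarrow> 'a \<times> real.
    (if (\<forall>m\<in>{..n}. fst (h m) \<in> (\<Union>i\<in>K. S i)) \<and> fst (h n) \<in> S i then 1 else 0) :: ennreal"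
  note [measurable] = S_borel[OF assms]
  have "?f \<in> borel_measurable (PiM {..n} (\<lambda>_. borel \<Otimes>\<^sub>M borel))" by measurable
  moreover have "wt n i \<omega> = ?f (history X T n \<omega>)" for \<omega>
    by (auto simp: wt_def alive_def history_def)
  ultimately show "\<exists>f\<in>borel_measurable (PiM {..n} (\<lambda>_. borel \<Otimes>\<^sub>M borel)). \<forall>\<omega>. wt n i \<omega> = f (history X T n \<omega>)"
    by (intro bexI[of _ ?f] allI)
qed

text \<open>\<open>ennreal\<close> cuts negative times off at 0; almost surely there are
  none.\<close>

definition Zt :: "nat \<Rightarrow> 'w \<Rightarrow> ennreal" where
  "Zt n \<omega> = (\<Sum>m\<in>{1..n}. ennreal (T m \<omega>))"

lemma adapted_Zt: "adapted Zt"
  unfolding adapted_def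
proof
  fix n
  let ?f = "\<lambda>h :: nat \<Rightarrow> 'a \<times> real. \<Sum>m\<in>{1..n}. ennreal (snd (h m))"
  have "?f \<in> borel_measurable (PiM {..n} (\<lambda>_. borel \<Otimes>\<^sub>M borel))"
  proof (rule borel_measurable_sum)
    fix m assume "m \<in> {1..n}"
    then have "m \<in> {..n}" by simp
    then show "(\<lambda>h. ennreal (snd (h m))) \<in> borel_measurable (PiM {..n} (\<lambda>_. borel \<Otimes>\<^sub>M borel))" by measurable
  qed
  moreover have "Zt n \<omega> = ?f (history X T n \<omega>)" for \<omega>
    unfolding Zt_def history_def by (intro sum.cong) auto
  ultimately show "\<exists>f\<in>borel_measurable (PiM {..n} (\<lambda>_. borel \<Otimes>\<^sub>M borel)). \<forall>\<omega>. Zt n \<omega> = f (history X T n \<omega>)"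
    by (intro bexI[of _ ?f] allI)
qed

lemma adapted_measurable: "adapted Z \<Longrightarrow> Z n \<in> borel_measurable Pr"
proof -
  assume "adapted Z"
  then obtain f where f: "f \<in> borel_measurable (PiM {..n} (\<lambda>_. borel \<Otimes>\<^sub>M borel))" "\<forall>\<omega>. Z n \<omega> = f (history X T n \<omega>)"
    unfolding adapted_def by blast
  have "history X T n \<in> Pr \<rightarrow>\<^sub>M PiM {..n} (\<lambda>_. borel \<Otimes>\<^sub>M borel)" by (rule measurable_history) measurable
  from measurable_compose[OF this f(1)] show ?thesis using f(2) by (simp cong: measurable_cong)
qed

lemma adapted_step:
  assumes "adapted Z" "g \<in> borel_measurable (borel \<Otimes>\<^sub>M borel)"
  shows "(\<integral>\<^sup>+\<omega>. Z n \<omega> * g (X (Suc n) \<omega>, T (Suc n) \<omega>) \<partial>Pr) = (\<integral>\<^sup>+\<omega>. Z n \<omega> * (\<integral>\<^sup>+q. g q \<partial>Q (X n \<omega>)) \<partial>Pr)"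
proof -
  obtain f where f: "f \<in> borel_measurable (PiM {..n} (\<lambda>_. borel \<Otimes>\<^sub>M borel))" "\<forall>\<omega>. Z n \<omega> = f (history X T n \<omega>)"
    using assms(1) unfolding adapted_def by blast
  show ?thesis using chain_one_step[OF chain kernel f(1) assms(2)] f(2) by simp
qed

definition occ :: "(nat \<Rightarrow> 'w \<Rightarrow> ennreal) \<Rightarrow> nat \<Rightarrow> nat \<Rightarrow> ennreal" where
  "occ Z n i = (\<integral>\<^sup>+\<omega>. Z n \<omega> * wt n i \<omega> \<partial>Pr)"

definition jmp :: "(nat \<Rightarrow> 'w \<Rightarrow> ennreal) \<Rightarrow> nat \<Rightarrow> nat \<Rightarrow> nat \<Rightarrow> ennreal" where
  "jmp Z n i j = (\<integral>\<^sup>+\<omega>. Z n \<omega> * wt n i \<omega> * indicator (S j) (X (Suc n) \<omega>) \<partial>Pr)"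

text \<open>The holding time of the jump itself: it is the increment of \<open>Zt\<close>, and so
  becomes the source of the time-weighted flow.\<close>

definition tim :: "nat \<Rightarrow> nat \<Rightarrow> nat \<Rightarrow> ennreal" where
  "tim n i j = (\<integral>\<^sup>+\<omega>. wt n i \<omega> * (ennreal (T (Suc n) \<omega>) * indicator (S j) (X (Suc n) \<omega>)) \<partial>Pr)"

lemma jmp_kernel:
  assumes Z: "adapted Z" and i: "i < M" and j: "j < M"
  shows "jmp Z n i j = (\<integral>\<^sup>+\<omega>. Z n \<omega> * wt n i \<omega> * ennreal (kerP (Q (X n \<omega>)) (S j)) \<partial>Pr)"
proof -
  note [measurable] = S_borel[OF j]
  have "jmp Z n i j = (\<integral>\<^sup>+\<omega>. Z n \<omega> * wt n i \<omega> * (\<lambda>q. indicator (S j) (fst q)) (X (Suc n) \<omega>, T (Suc n) \<omega>) \<partial>Pr)"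
    by (simp add: jmp_def)
  also have "\<dots> = (\<integral>\<^sup>+\<omega>. Z n \<omega> * wt n i \<omega> * (\<integral>\<^sup>+q. indicator (S j) (fst q) \<partial>Q (X n \<omega>)) \<partial>Pr)"
    by (rule adapted_step[OF adapted_mult[OF Z adapted_wt[OF i]]]) measurable
  finally show ?thesis by (simp add: kerP_nn[OF j])
qed

lemma tim_kernel:
  assumes i: "i < M" and j: "j < M"
  shows "tim n i j = (\<integral>\<^sup>+\<omega>. wt n i \<omega> * (\<integral>\<^sup>+q. ennreal (snd q) * indicator (S j) (fst q) \<partial>Q (X n \<omega>)) \<partial>Pr)"
proof -
  note [measurable] = S_borel[OF j]
  have "tim n i j = (\<integral>\<^sup>+\<omega>. wt n i \<omega> * (\<lambda>q. ennreal (snd q) * indicator (S j) (fst q)) (X (Suc n) \<omega>, T (Suc n) \<omega>) \<partial>Pr)"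
    by (simp add: tim_def)
  also have "\<dots> = (\<integral>\<^sup>+\<omega>. wt n i \<omega> * (\<integral>\<^sup>+q. ennreal (snd q) * indicator (S j) (fst q) \<partial>Q (X n \<omega>)) \<partial>Pr)"
    by (rule adapted_step[OF adapted_wt[OF i]]) measurable
  finally show ?thesis .
qed

text \<open>A relative error survives integration against a nonnegative weight. The pointwise
  estimate is asked for only where the weight is nonzero, since it is available only while the chain
  sits in the right \<open>S i\<close>.\<close>

lemma nn_near:
  fixes u :: "'w \<Rightarrow> ennreal" and r r' :: "'w \<Rightarrow> real" and c :: real
  assumes c: "0 \<le> c"
    and v: "\<And>\<omega>. \<omega> \<in> space Pr \<Longrightarrow> u \<omega> \<noteq> 0 \<Longrightarrow> 0 \<le> r \<omega> \<and> 0 \<le> r' \<omega> \<and> near \<eta> (r' \<omega>) (c * r \<omega>)"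
    and m: "(\<lambda>\<omega>. u \<omega> * ennreal (r \<omega>)) \<in> borel_measurable Pr"
    and fin: "(\<integral>\<^sup>+\<omega>. u \<omega> * ennreal (r \<omega>) \<partial>Pr) < \<top>"
  shows "(\<integral>\<^sup>+\<omega>. u \<omega> * ennreal (r' \<omega>) \<partial>Pr) < \<top>"
    and "near \<eta> (enn2real (\<integral>\<^sup>+\<omega>. u \<omega> * ennreal (r' \<omega>) \<partial>Pr)) (c * enn2real (\<integral>\<^sup>+\<omega>. u \<omega> * ennreal (r \<omega>) \<partial>Pr))"
proof -
  let ?I = "\<integral>\<^sup>+\<omega>. u \<omega> * ennreal (r \<omega>) \<partial>Pr" and ?J = "\<integral>\<^sup>+\<omega>. u \<omega> * ennreal (r' \<omega>) \<partial>Pr"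
  have "?J \<le> (\<integral>\<^sup>+\<omega>. ennreal ((1 + \<eta>) * c) * (u \<omega> * ennreal (r \<omega>)) \<partial>Pr)"
  proof (rule nn_integral_mono)
    fix \<omega> assume w: "\<omega> \<in> space Pr"
    show "u \<omega> * ennreal (r' \<omega>) \<le> ennreal ((1 + \<eta>) * c) * (u \<omega> * ennreal (r \<omega>))"
    proof (cases "u \<omega> = 0")
      case False
      have "ennreal (r' \<omega>) \<le> ennreal ((1 + \<eta>) * c) * ennreal (r \<omega>)"
        using v[OF w False] near_upper[of \<eta> "r' \<omega>" "c * r \<omega>"] \<eta> c
        by (subst ennreal_mult[symmetric]) (auto intro!: ennreal_leI simp: mult.assoc)
      then have "u \<omega> * ennreal (r' \<omega>) \<le> u \<omega> * (ennreal ((1 + \<eta>) * c) * ennreal (r \<omega>))" by (rule mult_left_mono) simp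
      then show ?thesis by (simp only: mult.left_commute)
    qed simp
  qed
  also have "\<dots> = ennreal ((1 + \<eta>) * c) * ?I" by (rule nn_integral_cmult[OF m])
  finally have up: "?J \<le> ennreal ((1 + \<eta>) * c) * ?I" .
  then show J: "?J < \<top>" using fin by (intro le_less_trans[OF up]) (simp add: ennreal_mult_less_top)
  have "ennreal ((1 - \<eta>) * c) * ?I = (\<integral>\<^sup>+\<omega>. ennreal ((1 - \<eta>) * c) * (u \<omega> * ennreal (r \<omega>)) \<partial>Pr)"
    by (rule nn_integral_cmult[OF m, symmetric])
  also have "\<dots> \<le> ?J"
  proof (rule nn_integral_mono)
    fix \<omega> assume w: "\<omega> \<in> space Pr"
    show "ennreal ((1 - \<eta>) * c) * (u \<omega> * ennreal (r \<omega>)) \<le> u \<omega> * ennreal (r' \<omega>)"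
    proof (cases "u \<omega> = 0")
      case False
      have "ennreal ((1 - \<eta>) * c) * ennreal (r \<omega>) \<le> ennreal (r' \<omega>)"
        using v[OF w False] near_lower[of \<eta> "r' \<omega>" "c * r \<omega>"] \<eta> c
        by (subst ennreal_mult[symmetric]) (auto intro!: ennreal_leI simp: mult.assoc)
      then have "u \<omega> * (ennreal ((1 - \<eta>) * c) * ennreal (r \<omega>)) \<le> u \<omega> * ennreal (r' \<omega>)" by (rule mult_left_mono) simp
      then show ?thesis by (simp only: mult.left_commute)
    qed simp
  qed
  finally have lo: "ennreal ((1 - \<eta>) * c) * ?I \<le> ?J" .
  obtain a where a: "?I = ennreal a" "0 \<le> a" using fin by (cases ?I) auto
  obtain b where b: "?J = ennreal b" "0 \<le> b" using J by (cases ?J) auto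
  have "b \<le> (1 + \<eta>) * c * a" "(1 - \<eta>) * c * a \<le> b"
    using up lo a b \<eta> c by (simp_all add: ennreal_mult[symmetric])
  then show "near \<eta> (enn2real ?J) (c * enn2real ?I)"
    using a b by (simp add: near_def algebra_simps abs_le_iff)
qed

abbreviation one :: "nat \<Rightarrow> 'w \<Rightarrow> ennreal" where
  "one \<equiv> \<lambda>_ _. 1"

lemma wt_meas: "i < M \<Longrightarrow> wt n i \<in> borel_measurable Pr"
  using adapted_measurable[OF adapted_wt] .

lemma wt_nonzero: "wt n i \<omega> \<noteq> 0 \<Longrightarrow> X n \<omega> \<in> S i"
  by (auto simp: wt_def split: if_splits)

lemma jmp_near:
  assumes Z: "adapted Z" and i: "i \<in> K" and j: "j < M" and fin: "occ Z n i < \<top>"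
  shows "jmp Z n i j < \<top>" "near \<eta> (enn2real (jmp Z n i j)) (P i j * enn2real (occ Z n i))"
proof -
  have v: "0 \<le> (1::real) \<and> 0 \<le> kerP (Q (X n \<omega>)) (S j) \<and> near \<eta> (kerP (Q (X n \<omega>)) (S j)) (P i j * 1)"
    if "Z n \<omega> * wt n i \<omega> \<noteq> 0" for \<omega>
  proof -
    have "X n \<omega> \<in> S i" using that wt_nonzero[of n i \<omega>] by auto
    then show ?thesis using near_P[OF i j] by (simp add: kerP_nonneg)
  qed
  have m: "(\<lambda>\<omega>. Z n \<omega> * wt n i \<omega> * ennreal 1) \<in> borel_measurable Pr"
    using adapted_measurable[OF adapted_mult[OF Z adapted_wt[OF K_less[OF i]]]] by simp
  have f: "(\<integral>\<^sup>+\<omega>. Z n \<omega> * wt n i \<omega> * ennreal 1 \<partial>Pr) < \<top>" using fin by (simp add: occ_def)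
  note nn = nn_near[OF P_nonneg[OF i j] v m f]
  show "jmp Z n i j < \<top>" using nn(1) unfolding jmp_kernel[OF Z K_less[OF i] j] by simp
  show "near \<eta> (enn2real (jmp Z n i j)) (P i j * enn2real (occ Z n i))"
    using nn(2) unfolding jmp_kernel[OF Z K_less[OF i] j] occ_def by simp
qed

lemma kerP_meas: "j < M \<Longrightarrow> (\<lambda>\<omega>. ennreal (kerP (Q (X n \<omega>)) (S j))) \<in> borel_measurable Pr"
proof -
  assume j: "j < M"
  note [measurable] = S_borel[OF j]
  have "(\<lambda>q. indicator (S j) (fst q) :: ennreal) \<in> borel_measurable (borel \<Otimes>\<^sub>M (borel :: real measure))" by measurable
  from measurable_compose[OF X_meas measurable_compose[OF measurable_prob_algebraD[OF kernel]
      nn_integral_measurable_subprob_algebra[OF this]]]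
  show ?thesis by (simp add: kerP_nn[OF j])
qed

text \<open>Given the present point, the holding time and the jump are integrals against the same
  kernel, in the ratio \<open>\<tau> i\<close> up to \<open>\<eta>\<close>; both are then averaged
  with the weight \<open>wt\<close>.\<close>

lemma tim_near:
  assumes i: "i \<in> K" and j: "j < M" and fin: "jmp one n i j < \<top>"
  shows "tim n i j < \<top>" "near \<eta> (enn2real (tim n i j)) (\<tau> i * enn2real (jmp one n i j))"
proof -
  define r where "r \<omega> = enn2real (\<integral>\<^sup>+q. ennreal (snd q) * indicator (S j) (fst q) \<partial>Q (X n \<omega>))" for \<omega>
  have kin: "0 \<le> r \<omega> \<and> (\<integral>\<^sup>+q. ennreal (snd q) * indicator (S j) (fst q) \<partial>Q (X n \<omega>)) = ennreal (r \<omega>) \<and>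
      near \<eta> (r \<omega>) (\<tau> i * kerP (Q (X n \<omega>)) (S j))"
    if wn: "wt n i \<omega> \<noteq> 0" for \<omega>
  proof -
    obtain c where c: "(\<integral>\<^sup>+q. ennreal (snd q) * indicator (S j) (fst q) \<partial>Q (X n \<omega>)) = ennreal c"
      "near \<eta> c (\<tau> i * kerP (Q (X n \<omega>)) (S j))"
      using near_T[OF i j wt_nonzero[OF wn]] unfolding time_near_def by blast
    have "0 \<le> \<tau> i * kerP (Q (X n \<omega>)) (S j)" using \<tau>_pos[OF i] by (simp add: kerP_nonneg)
    then have "0 \<le> c" using near_nonneg[OF c(2)] \<eta> by simp
    then show ?thesis using c by (simp add: r_def)
  qed
  have v: "0 \<le> kerP (Q (X n \<omega>)) (S j) \<and> 0 \<le> r \<omega> \<and> near \<eta> (r \<omega>) (\<tau> i * kerP (Q (X n \<omega>)) (S j))"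
    if "wt n i \<omega> \<noteq> 0" for \<omega> using kin[OF that] by (simp add: kerP_nonneg)
  have jk: "jmp one n i j = (\<integral>\<^sup>+\<omega>. wt n i \<omega> * ennreal (kerP (Q (X n \<omega>)) (S j)) \<partial>Pr)"
    using jmp_kernel[OF adapted_const K_less[OF i] j, of 1 n] by simp
  have tk: "tim n i j = (\<integral>\<^sup>+\<omega>. wt n i \<omega> * ennreal (r \<omega>) \<partial>Pr)"
    unfolding tim_kernel[OF K_less[OF i] j]
  proof (rule nn_integral_cong)
    fix \<omega>
    show "wt n i \<omega> * (\<integral>\<^sup>+q. ennreal (snd q) * indicator (S j) (fst q) \<partial>Q (X n \<omega>)) = wt n i \<omega> * ennreal (r \<omega>)"
      using kin[of \<omega>] by (cases "wt n i \<omega> = 0") auto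
  qed
  have m: "(\<lambda>\<omega>. wt n i \<omega> * ennreal (kerP (Q (X n \<omega>)) (S j))) \<in> borel_measurable Pr"
    using wt_meas[OF K_less[OF i]] kerP_meas[OF j] by (rule borel_measurable_times_ennreal)
  note nn = nn_near[OF less_imp_le[OF \<tau>_pos[OF i]] v m fin[unfolded jk]]
  show "tim n i j < \<top>" using nn(1) unfolding tk by simp
  show "near \<eta> (enn2real (tim n i j)) (\<tau> i * enn2real (jmp one n i j))" using nn(2) unfolding tk jk by simp
qed

lemma Z_wt_meas: "adapted Z \<Longrightarrow> i < M \<Longrightarrow> (\<lambda>\<omega>. Z n \<omega> * wt n i \<omega>) \<in> borel_measurable Pr"
  using adapted_measurable[OF adapted_mult[OF _ adapted_wt]] by blast

lemma ind_meas: "j < M \<Longrightarrow> (\<lambda>\<omega>. indicator (S j) (X n \<omega>) :: ennreal) \<in> borel_measurable Pr"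
  using S_borel[of j] by measurable

lemma jmp_row:
  assumes Z: "adapted Z" and i: "i < M"
  shows "(\<Sum>j<M. jmp Z n i j) = occ Z n i"
proof -
  have "(\<Sum>j<M. jmp Z n i j) = (\<integral>\<^sup>+\<omega>. (\<Sum>j<M. Z n \<omega> * wt n i \<omega> * indicator (S j) (X (Suc n) \<omega>)) \<partial>Pr)"
    unfolding jmp_def
    by (rule nn_integral_sum[symmetric]) (intro borel_measurable_times_ennreal Z_wt_meas Z i ind_meas, simp)
  also have "\<dots> = (\<integral>\<^sup>+\<omega>. Z n \<omega> * wt n i \<omega> \<partial>Pr)"
    using sum_indicator_S[of "{..<M}", where ?'b = ennreal] S_cover by (simp flip: sum_distrib_left)
  finally show ?thesis by (simp add: occ_def)
qed

lemma sum_wt: "(\<Sum>i\<in>K. wt n i \<omega>) = (if alive n \<omega> then 1 else 0)"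
proof -
  have "(\<Sum>i\<in>K. wt n i \<omega>) = (if alive n \<omega> then 1 else 0) * (\<Sum>i\<in>K. indicator (S i) (X n \<omega>))"
    unfolding sum_distrib_left by (intro sum.cong) (auto simp: wt_def indicator_def)
  also have "\<dots> = (if alive n \<omega> then 1 else 0)"
    unfolding sum_indicator_S[OF K] by (auto simp: alive_def)
  finally show ?thesis .
qed

text \<open>For \<open>j\<close> in \<open>K\<close>, a path that is in \<open>S j\<close> at the
  next time is alive then exactly if it is alive now; the alive paths are split by their present
  index.\<close>

lemma wt_Suc:
  assumes "j \<in> K"
  shows "wt (Suc n) j \<omega> = (\<Sum>i\<in>K. wt n i \<omega> * indicator (S j) (X (Suc n) \<omega>))"
proof -
  have "(\<Sum>i\<in>K. wt n i \<omega> * indicator (S j) (X (Suc n) \<omega>)) = (if alive n \<omega> then 1 else 0) * indicator (S j) (X (Suc n) \<omega>)"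
    by (simp add: sum_wt flip: sum_distrib_right)
  moreover have "alive (Suc n) \<omega> \<longleftrightarrow> alive n \<omega>" if "X (Suc n) \<omega> \<in> S j"
    using that assms by (auto simp: alive_def le_Suc_eq)
  ultimately show ?thesis by (auto simp: wt_def indicator_def)
qed

lemma occ_one_Suc:
  assumes j: "j \<in> K"
  shows "occ one (Suc n) j = (\<Sum>i\<in>K. jmp one n i j)"
proof -
  have "occ one (Suc n) j = (\<integral>\<^sup>+\<omega>. (\<Sum>i\<in>K. 1 * wt n i \<omega> * indicator (S j) (X (Suc n) \<omega>)) \<partial>Pr)"
    by (simp add: occ_def wt_Suc[OF j])
  also have "\<dots> = (\<Sum>i\<in>K. jmp one n i j)"
    unfolding jmp_def
    by (rule nn_integral_sum) (intro borel_measurable_times_ennreal Z_wt_meas[of one] adapted_const K_less ind_meas j)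
  finally show ?thesis .
qed

lemma tim_meas: "i < M \<Longrightarrow> j < M \<Longrightarrow>
   (\<lambda>\<omega>. wt n i \<omega> * (ennreal (T (Suc n) \<omega>) * indicator (S j) (X (Suc n) \<omega>))) \<in> borel_measurable Pr"
  by (intro borel_measurable_times_ennreal wt_meas ind_meas) measurable

lemma Zt_Suc: "Zt (Suc n) \<omega> = Zt n \<omega> + ennreal (T (Suc n) \<omega>)"
  by (simp add: Zt_def)

lemma jmp_meas: "adapted Z \<Longrightarrow> i < M \<Longrightarrow> j < M \<Longrightarrow>
   (\<lambda>\<omega>. Z n \<omega> * wt n i \<omega> * indicator (S j) (X (Suc n) \<omega>)) \<in> borel_measurable Pr"
  by (intro borel_measurable_times_ennreal Z_wt_meas ind_meas)

lemma jmp_Zt_Suc: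
  assumes i: "i < M" and j: "j < M"
  shows "(\<integral>\<^sup>+\<omega>. Zt (Suc n) \<omega> * wt n i \<omega> * indicator (S j) (X (Suc n) \<omega>) \<partial>Pr) = jmp Zt n i j + tim n i j"
  unfolding jmp_def tim_def
  by (subst nn_integral_add[symmetric, OF jmp_meas[OF adapted_Zt i j] tim_meas[OF i j]])
    (simp add: Zt_Suc distrib_right distrib_left mult_ac)

lemma occ_Zt_Suc:
  assumes j: "j \<in> K"
  shows "occ Zt (Suc n) j = (\<Sum>i\<in>K. jmp Zt n i j + tim n i j)"
proof -
  have "occ Zt (Suc n) j = (\<integral>\<^sup>+\<omega>. (\<Sum>i\<in>K. Zt (Suc n) \<omega> * wt n i \<omega> * indicator (S j) (X (Suc n) \<omega>)) \<partial>Pr)"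
    by (simp add: occ_def wt_Suc[OF j] sum_distrib_left mult.assoc)
  also have "\<dots> = (\<Sum>i\<in>K. \<integral>\<^sup>+\<omega>. Zt (Suc n) \<omega> * wt n i \<omega> * indicator (S j) (X (Suc n) \<omega>) \<partial>Pr)"
    by (rule nn_integral_sum) (intro borel_measurable_times_ennreal wt_meas K_less ind_meas j adapted_measurable adapted_Zt)
  finally show ?thesis using jmp_Zt_Suc K_less j by simp
qed

lemma occ_one_finite: "occ one n i < \<top>"
proof -
  have "occ one n i \<le> (\<integral>\<^sup>+\<omega>. 1 \<partial>Pr)" unfolding occ_def by (intro nn_integral_mono) (simp add: wt_def)
  also have "\<dots> = 1" by (simp add: emeasure_space_1)
  finally show ?thesis by (simp add: order.strict_trans1)
qed

lemma jmp_one_finite: "i \<in> K \<Longrightarrow> j < M \<Longrightarrow> jmp one n i j < \<top>"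
  using jmp_near(1)[OF adapted_const _ _ occ_one_finite] .

lemma tim_finite: "i \<in> K \<Longrightarrow> j < M \<Longrightarrow> tim n i j < \<top>"
  using tim_near(1) jmp_one_finite by blast

text \<open>Finiteness propagates in time: each step adds a finite expected holding time to a finite
  moment.\<close>

lemma occ_Zt_finite: "i \<in> K \<Longrightarrow> occ Zt n i < \<top>"
proof (induction n arbitrary: i)
  case 0
  then show ?case by (simp add: occ_def Zt_def)
next
  case (Suc n)
  have "jmp Zt n j i + tim n j i < \<top>" if "j \<in> K" for j
    using jmp_near(1)[OF adapted_Zt that K_less[OF Suc.prems] Suc.IH[OF that]] tim_finite[OF that K_less[OF Suc.prems]] by simp
  then show ?case unfolding occ_Zt_Suc[OF Suc.prems] using finite_K by (simp add: less_top)
qed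

lemma jmp_Zt_finite: "i \<in> K \<Longrightarrow> j < M \<Longrightarrow> jmp Zt n i j < \<top>"
  using jmp_near(1)[OF adapted_Zt _ _ occ_Zt_finite] .

lemma wt_0: "i \<in> K \<Longrightarrow> \<omega> \<in> space Pr \<Longrightarrow> wt 0 i \<omega> = (if i = i0 then 1 else 0)"
  using S_disj[of i i0] K_less[OF i0] K_less[of i] x i0 by (auto simp: wt_def alive_def X_0)

lemma occ_one_0: "i \<in> K \<Longrightarrow> occ one 0 i = (if i = i0 then 1 else 0)"
proof -
  assume i: "i \<in> K"
  have "occ one 0 i = (\<integral>\<^sup>+\<omega>. (if i = i0 then 1 else 0) \<partial>Pr)"
    unfolding occ_def by (intro nn_integral_cong) (simp add: wt_0[OF i])
  then show ?thesis by (simp add: emeasure_space_1)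
qed

lemma jmp_one_0:
  assumes i: "i \<in> K" and j: "j < M"
  shows "jmp one 0 i j = ennreal (if i = i0 then kerP (Q x) (S j) else 0)"
proof -
  have "jmp one 0 i j = (\<integral>\<^sup>+\<omega>. ennreal (if i = i0 then kerP (Q x) (S j) else 0) \<partial>Pr)"
    unfolding jmp_kernel[OF adapted_const K_less[OF i] j]
    by (intro nn_integral_cong) (simp add: wt_0[OF i] X_0)
  then show ?thesis by (simp add: emeasure_space_1)
qed

section \<open>Real occupation sequences and the flows obtained by summation over time\<close>

definition ro :: "(nat \<Rightarrow> 'w \<Rightarrow> ennreal) \<Rightarrow> nat \<Rightarrow> nat \<Rightarrow> real" where
  "ro Z n i = enn2real (occ Z n i)"

definition rj :: "(nat \<Rightarrow> 'w \<Rightarrow> ennreal) \<Rightarrow> nat \<Rightarrow> nat \<Rightarrow> nat \<Rightarrow> real" where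
  "rj Z n i j = enn2real (jmp Z n i j)"

definition rt :: "nat \<Rightarrow> nat \<Rightarrow> nat \<Rightarrow> real" where
  "rt n i j = enn2real (tim n i j)"

lemma rj_row:
  assumes Z: "adapted Z" and i: "i \<in> K" and fin: "\<And>j. j < M \<Longrightarrow> jmp Z n i j < \<top>"
  shows "(\<Sum>j<M. rj Z n i j) = ro Z n i"
proof -
  have "ro Z n i = enn2real (\<Sum>j<M. jmp Z n i j)" by (simp add: ro_def jmp_row[OF Z K_less[OF i]])
  also have "\<dots> = (\<Sum>j<M. rj Z n i j)" unfolding rj_def using fin by (intro enn2real_sum_cong) auto
  finally show ?thesis by simp
qed

lemma ro_one_Suc: "j \<in> K \<Longrightarrow> ro one (Suc n) j = (\<Sum>i\<in>K. rj one n i j)"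
  unfolding ro_def rj_def occ_one_Suc using jmp_one_finite K_less by (intro enn2real_sum_cong) auto

lemma ro_Zt_Suc: "j \<in> K \<Longrightarrow> ro Zt (Suc n) j = (\<Sum>i\<in>K. rt n i j) + (\<Sum>i\<in>K. rj Zt n i j)"
proof -
  assume j: "j \<in> K"
  have "ro Zt (Suc n) j = (\<Sum>i\<in>K. enn2real (jmp Zt n i j + tim n i j))"
    unfolding ro_def occ_Zt_Suc[OF j] using jmp_Zt_finite tim_finite K_less[OF j] by (intro enn2real_sum_cong) simp
  also have "\<dots> = (\<Sum>i\<in>K. rj Zt n i j + rt n i j)"
    unfolding rj_def rt_def using jmp_Zt_finite tim_finite K_less[OF j] by (intro sum.cong enn2real_plus) auto
  finally show ?thesis by (simp add: sum.distrib)
qed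

lemma r_nonneg: "0 \<le> ro Z n i" "0 \<le> rj Z n i j" "0 \<le> rt n i j"
  by (simp_all add: ro_def rj_def rt_def)

lemma rj_near: "i \<in> K \<Longrightarrow> j < M \<Longrightarrow> near \<eta> (rj one n i j) (P i j * ro one n i)"
  "i \<in> K \<Longrightarrow> j < M \<Longrightarrow> near \<eta> (rj Zt n i j) (P i j * ro Zt n i)"
  unfolding rj_def ro_def
  using jmp_near(2)[OF adapted_const _ _ occ_one_finite] jmp_near(2)[OF adapted_Zt _ _ occ_Zt_finite] by blast+

lemma rt_near: "i \<in> K \<Longrightarrow> j < M \<Longrightarrow> near \<eta> (rt n i j) (\<tau> i * rj one n i j)"
  unfolding rj_def rt_def using tim_near(2) jmp_one_finite by blast

text \<open>The shift restarts the count at time \<open>k\<close>: \<open>k = 0\<close> gives the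
  flow from the start, \<open>k = 1\<close> the flow that remains after the first jump.\<close>

lemma one_flow:
  shows "i \<in> K \<Longrightarrow> summable (\<lambda>n. ro one (n + k) i)"
    and "i \<in> K \<Longrightarrow> j < M \<Longrightarrow> summable (\<lambda>n. rj one (n + k) i j)"
    and "flow M P \<eta> K (ro one k) (\<lambda>i. \<Sum>n. ro one (n + k) i) (\<lambda>i j. \<Sum>n. rj one (n + k) i j)"
proof -
  have row: "(\<Sum>j<M. rj one (n + k) i j) = ro one (n + k) i" if "i \<in> K" for n i
    by (rule rj_row[OF adapted_const that jmp_one_finite[OF that]])
  have step: "ro one (Suc n + k) j = 0 + (\<Sum>i\<in>K. rj one (n + k) i j)" if "j \<in> K" for n j
    using ro_one_Suc[OF that] by simp
  note F = occupation_flow[OF K \<eta>(2) P_nonneg exit, where g = "\<lambda>_ _. 0"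
      and a = "\<lambda>n. ro one (n + k)" and f = "\<lambda>n. rj one (n + k)",
      OF _ _ _ r_nonneg(1) r_nonneg(2) order_refl summable_zero rj_near(1) row step]
  show "i \<in> K \<Longrightarrow> summable (\<lambda>n. ro one (n + k) i)" by (rule F(1); assumption)
  show "i \<in> K \<Longrightarrow> j < M \<Longrightarrow> summable (\<lambda>n. rj one (n + k) i j)" by (rule F(2); assumption)
  show "flow M P \<eta> K (ro one k) (\<lambda>i. \<Sum>n. ro one (n + k) i) (\<lambda>i j. \<Sum>n. rj one (n + k) i j)"
    using F(3)[simplified] by simp
qed

lemma rt_summable: "i \<in> K \<Longrightarrow> j < M \<Longrightarrow> summable (\<lambda>n. rt n i j)"
proof -
  assume ij: "i \<in> K" "j < M"
  show ?thesis
  proof (rule summable_comparison_test'[of "\<lambda>n. (1 + \<eta>) * (\<tau> i * rj one n i j)" 0])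
    show "summable (\<lambda>n. (1 + \<eta>) * (\<tau> i * rj one n i j))" using one_flow(2)[OF ij, of 0] by (intro summable_mult) simp
    show "norm (rt n i j) \<le> (1 + \<eta>) * (\<tau> i * rj one n i j)" for n
      using near_upper[OF rt_near[OF ij]] r_nonneg(3) by simp
  qed
qed

text \<open>No time has elapsed at step 0, so the source consists of holding times alone, credited
  to the index at which the jump arrives.\<close>

lemma Zt_flow:
  shows "i \<in> K \<Longrightarrow> j < M \<Longrightarrow> summable (\<lambda>n. rj Zt n i j)"
    and "flow M P \<eta> K (\<lambda>j. \<Sum>i\<in>K. \<Sum>n. rt n i j) (\<lambda>i. \<Sum>n. ro Zt n i) (\<lambda>i j. \<Sum>n. rj Zt n i j)"
proof -
  have row: "(\<Sum>j<M. rj Zt n i j) = ro Zt n i" if "i \<in> K" for n i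
    by (rule rj_row[OF adapted_Zt that jmp_Zt_finite[OF that]])
  have gs: "summable (\<lambda>n. \<Sum>i\<in>K. rt n i j)" if "j \<in> K" for j
    using rt_summable K_less[OF that] by (intro summable_sum) auto
  have g0: "0 \<le> (\<Sum>i\<in>K. rt n i j)" for n j using r_nonneg(3) by (intro sum_nonneg)
  note F = occupation_flow[OF K \<eta>(2) P_nonneg exit, where g = "\<lambda>n j. \<Sum>i\<in>K. rt n i j"
      and a = "ro Zt" and f = "rj Zt",
      OF _ _ _ r_nonneg(1) r_nonneg(2) g0 gs rj_near(2) row ro_Zt_Suc]
  show "i \<in> K \<Longrightarrow> j < M \<Longrightarrow> summable (\<lambda>n. rj Zt n i j)" by (rule F(2); assumption)
  have "ro Zt 0 j + (\<Sum>n. \<Sum>i\<in>K. rt n i j) = (\<Sum>i\<in>K. \<Sum>n. rt n i j)" if "j \<in> K" for j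
    using rt_summable K_less[OF that] by (subst suminf_sum) (auto simp: ro_def occ_def Zt_def)
  then show "flow M P \<eta> K (\<lambda>j. \<Sum>i\<in>K. \<Sum>n. rt n i j) (\<lambda>i. \<Sum>n. ro Zt n i) (\<lambda>i j. \<Sum>n. rj Zt n i j)"
    using F(3)[simplified] by (rule flow_source_cong)
qed

section \<open>The exit time along a path\<close>

definition \<theta> :: "'w \<Rightarrow> nat" where
  "\<theta> \<omega> = theta1 p X \<omega>"

text \<open>The paths on which \<open>LEAST\<close> in \<open>theta1\<close> selects a genuine exit
  and on which the elapsed time agrees with its \<open>ennreal\<close> version.\<close>

definition exits :: "'w \<Rightarrow> bool" where
  "exits \<omega> \<longleftrightarrow> \<omega> \<in> space Pr \<and> (\<exists>n. \<not> alive n \<omega>) \<and> (\<forall>n. 0 \<le> T n \<omega>)"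

lemma \<theta>_props:
  assumes "exits \<omega>"
  shows "0 < \<theta> \<omega>" "X (\<theta> \<omega>) \<omega> \<notin> (\<Union>i\<in>K. S i)" "alive n \<omega> \<longleftrightarrow> n < \<theta> \<omega>"
proof -
  let ?D = "\<Union>i\<in>K. S i" and ?B = "\<lambda>m. m > 0 \<and> p (X m \<omega>) \<noteq> p (X 0 \<omega>)"
  have sp: "\<omega> \<in> space Pr" using assms by (simp add: exits_def)
  have xD: "x \<in> ?D" using x i0 by blast
  have B: "?B m \<longleftrightarrow> X m \<omega> \<notin> ?D" for m
  proof (cases "m = 0")
    case True
    then show ?thesis using X_0[OF sp] xD by simp
  next
    case False
    then show ?thesis using p_iff[of "X m \<omega>"] X_0[OF sp] by simp
  qed
  obtain n' where "\<not> alive n' \<omega>" using assms by (auto simp: exits_def)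
  then obtain m where "X m \<omega> \<notin> ?D" by (auto simp: alive_def)
  then have "?B m" using B by blast
  then have L: "?B (\<theta> \<omega>)" unfolding \<theta>_def theta1_def by (rule LeastI)
  then show "0 < \<theta> \<omega>" "X (\<theta> \<omega>) \<omega> \<notin> ?D" using B by blast+
  have lt: "X m \<omega> \<in> ?D" if "m < \<theta> \<omega>" for m
  proof -
    have "\<not> ?B m" using not_less_Least[of m ?B] that unfolding \<theta>_def theta1_def by blast
    then show ?thesis using B[of m] by blast
  qed
  have nD: "X (\<theta> \<omega>) \<omega> \<notin> ?D" using L B by blast
  show "alive n \<omega> \<longleftrightarrow> n < \<theta> \<omega>"
  proof
    assume "alive n \<omega>"
    then have "\<not> \<theta> \<omega> \<le> n" using nD unfolding alive_def by blast
    then show "n < \<theta> \<omega>" by simp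
  next
    assume "n < \<theta> \<omega>"
    then show "alive n \<omega>" unfolding alive_def using lt by (simp add: le_less_trans)
  qed
qed

lemma \<theta>_meas[measurable]: "\<theta> \<in> Pr \<rightarrow>\<^sub>M count_space UNIV"
proof -
  define D where "D = (\<Union>i\<in>K. S i)"
  have [measurable]: "D \<in> sets borel" unfolding D_def by (rule D_borel)
  have "\<theta> \<omega> = (LEAST m. m > 0 \<and> X m \<omega> \<notin> D)" if "\<omega> \<in> space Pr" for \<omega>
    unfolding \<theta>_def theta1_def X_0[OF that] p_iff D_def ..
  moreover have "(\<lambda>\<omega>. LEAST m. m > 0 \<and> X m \<omega> \<notin> D) \<in> Pr \<rightarrow>\<^sub>M count_space UNIV" by measurable
  ultimately show ?thesis by (subst measurable_cong)
qed

lemma alive_meas[measurable]: "Measurable.pred Pr (alive n)"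
proof -
  define D where "D = (\<Union>i\<in>K. S i)"
  have [measurable]: "D \<in> sets borel" unfolding D_def by (rule D_borel)
  have "Measurable.pred Pr (\<lambda>\<omega>. \<forall>m. m \<le> n \<longrightarrow> X m \<omega> \<in> D)" by measurable
  then show ?thesis unfolding alive_def[abs_def] D_def .
qed

text \<open>The probability of being alive at time \<open>n\<close> is the total occupation at that
  time. Occupations are summable over time, so it tends to 0.\<close>

lemma AE_exits: "AE \<omega> in Pr. exits \<omega>"
proof -
  have "AE \<omega> in Pr. 0 \<le> T n \<omega>" for n
  proof (cases n)
    case 0
    then show ?thesis using T_0 by (auto intro!: AE_I2)
  next
    case (Suc m)
    have ind[measurable]: "(\<lambda>q. indicator (UNIV \<times> {..<0}) q :: ennreal) \<in> borel_measurable (borel \<Otimes>\<^sub>M (borel :: real measure))"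
      by measurable
    have z: "(\<integral>\<^sup>+q. indicator (UNIV \<times> {..<0}) q \<partial>Q y) = 0" for y
    proof -
      have "UNIV \<times> {..<0} \<in> sets (Q y)" by (simp add: sets_Q)
      then show ?thesis using nonneg_time[of y]
        by (simp add: finite_measure.emeasure_eq_measure[OF prob_space.finite_measure[OF prob_Q]])
    qed
    have "(\<integral>\<^sup>+\<omega>. 1 * indicator (UNIV \<times> {..<0}) (X (Suc m) \<omega>, T (Suc m) \<omega>) \<partial>Pr) = 0"
      by (subst adapted_step[OF adapted_const ind]) (simp add: z)
    then have "(\<integral>\<^sup>+\<omega>. indicator (UNIV \<times> {..<0}) (X (Suc m) \<omega>, T (Suc m) \<omega>) \<partial>Pr) = 0" by simp
    then have "AE \<omega> in Pr. indicator (UNIV \<times> {..<0}) (X (Suc m) \<omega>, T (Suc m) \<omega>) = (0::ennreal)"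
      by (subst (asm) nn_integral_0_iff_AE) measurable
    then show ?thesis unfolding Suc by (rule AE_mp) (auto intro!: AE_I2 simp: indicator_def split: if_splits)
  qed
  then have T: "AE \<omega> in Pr. \<forall>n. 0 \<le> T n \<omega>" by (simp add: AE_all_countable)
  have le: "measure Pr {\<omega>\<in>space Pr. \<forall>n. alive n \<omega>} \<le> (\<Sum>i\<in>K. ro one n i)" for n
  proof -
    have "emeasure Pr {\<omega>\<in>space Pr. \<forall>n. alive n \<omega>} \<le> emeasure Pr {\<omega>\<in>space Pr. alive n \<omega>}"
      by (intro emeasure_mono) auto
    also have "\<dots> = (\<integral>\<^sup>+\<omega>. indicator {\<omega>\<in>space Pr. alive n \<omega>} \<omega> \<partial>Pr)" by simp
    also have "\<dots> = (\<integral>\<^sup>+\<omega>. (\<Sum>i\<in>K. 1 * wt n i \<omega>) \<partial>Pr)"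
      by (intro nn_integral_cong) (simp add: sum_wt indicator_def)
    also have "\<dots> = (\<Sum>i\<in>K. occ one n i)"
      unfolding occ_def by (rule nn_integral_sum) (simp add: wt_meas K_less)
    also have "\<dots> = (\<Sum>i\<in>K. ennreal (ro one n i))"
      using occ_one_finite by (intro sum.cong) (auto simp: ro_def)
    also have "\<dots> = ennreal (\<Sum>i\<in>K. ro one n i)" using r_nonneg(1) by simp
    finally show ?thesis
      using r_nonneg(1) by (simp add: emeasure_eq_measure sum_nonneg)
  qed
  have "(\<lambda>n. \<Sum>i\<in>K. ro one n i) \<longlonglongrightarrow> (\<Sum>i\<in>K. 0)"
    using one_flow(1)[of _ 0] by (intro tendsto_sum summable_LIMSEQ_zero) simp
  then have "measure Pr {\<omega>\<in>space Pr. \<forall>n. alive n \<omega>} \<le> 0"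
    using le by (intro LIMSEQ_le_const) auto
  then have "measure Pr {\<omega>\<in>space Pr. \<forall>n. alive n \<omega>} = 0" using measure_nonneg antisym by blast
  then have "AE \<omega> in Pr. \<not> (\<forall>n. alive n \<omega>)"
    by (intro AE_I[of _ _ "{\<omega>\<in>space Pr. \<forall>n. alive n \<omega>}"]) (auto simp: emeasure_eq_measure)
  with T show ?thesis by (rule AE_mp[OF AE_conjI]) (auto intro!: AE_I2 simp: exits_def)
qed

lemma path_visits:
  assumes "exits \<omega>" and i: "i \<in> K"
  shows "ennreal (\<Sum>n\<in>{0..\<theta> \<omega>}. indicator (S i) (X n \<omega>)) = (\<Sum>n. wt n i \<omega>)"
proof -
  note th = \<theta>_props[OF assms(1)]
  have "(\<Sum>n. wt n i \<omega>) = (\<Sum>n<\<theta> \<omega>. wt n i \<omega>)"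
    by (rule suminf_finite) (auto simp: wt_def th(3))
  also have "\<dots> = (\<Sum>n<\<theta> \<omega>. ennreal (indicator (S i) (X n \<omega>)))"
    by (intro sum.cong) (auto simp: wt_def th(3) indicator_def)
  also have "\<dots> = ennreal (\<Sum>n<\<theta> \<omega>. indicator (S i) (X n \<omega>))" by simp
  \<comment> \<open>The extra index \<open>\<theta> \<omega>\<close> in the definition of N
    contributes 0, as the chain is then outside the cluster.\<close>
  also have "(\<Sum>n<\<theta> \<omega>. indicator (S i) (X n \<omega>)) = (\<Sum>n\<in>{0..\<theta> \<omega>}. indicator (S i) (X n \<omega>) :: real)"
    using th(2) i by (intro sum.mono_neutral_left) (auto simp: indicator_def le_less)
  finally show ?thesis by simp
qed

text \<open>Only the term with \<open>Suc n = \<theta> \<omega>\<close> survives: earlier the next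
  point still lies in the cluster, later the path is no longer alive. The weight is therefore taken
  at the time of arrival, \<open>Suc n\<close>.\<close>

lemma path_exit:
  assumes "exits \<omega>" and L: "L \<subseteq> {..<M}" "L \<inter> K = {}"
  shows "(\<Sum>n. \<Sum>i\<in>K. \<Sum>j\<in>L. Z (Suc n) \<omega> * wt n i \<omega> * indicator (S j) (X (Suc n) \<omega>)) =
    (Z (\<theta> \<omega>) \<omega> * indicator (\<Union>j\<in>L. S j) (X (\<theta> \<omega>) \<omega>) :: ennreal)"
proof -
  note th = \<theta>_props[OF assms(1)]
  let ?U = "\<Union>j\<in>L. S j"
  have disj: "y \<notin> ?U" if yD: "y \<in> (\<Union>i\<in>K. S i)" for y
  proof
    assume "y \<in> ?U"
    then obtain j where j: "j \<in> L" "y \<in> S j" by blast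
    obtain i where i: "i \<in> K" "y \<in> S i" using yD by blast
    have "i \<noteq> j" using i j L(2) by blast
    then show False using S_disj[of i j] K_less[OF i(1)] L(1) i j by blast
  qed
  have t: "(\<Sum>i\<in>K. \<Sum>j\<in>L. Z (Suc n) \<omega> * wt n i \<omega> * indicator (S j) (X (Suc n) \<omega>)) =
      Z (Suc n) \<omega> * (if alive n \<omega> then 1 else 0) * indicator ?U (X (Suc n) \<omega>)" for n
  proof -
    have "(\<Sum>i\<in>K. \<Sum>j\<in>L. Z (Suc n) \<omega> * wt n i \<omega> * indicator (S j) (X (Suc n) \<omega>)) =
      Z (Suc n) \<omega> * (\<Sum>i\<in>K. wt n i \<omega>) * (\<Sum>j\<in>L. indicator (S j) (X (Suc n) \<omega>))"
      by (simp add: sum_distrib_left sum_distrib_right) (rule sum.swap)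
    then show ?thesis unfolding sum_wt sum_indicator_S[OF L(1)] .
  qed
  obtain n0 where n0: "\<theta> \<omega> = Suc n0" using th(1) by (cases "\<theta> \<omega>") auto
  have "(\<Sum>n. Z (Suc n) \<omega> * (if alive n \<omega> then 1 else 0) * indicator ?U (X (Suc n) \<omega>)) =
      (\<Sum>n\<in>{n0}. Z (Suc n) \<omega> * (if alive n \<omega> then 1 else 0) * indicator ?U (X (Suc n) \<omega>))"
  proof (rule suminf_finite)
    fix n assume "n \<notin> {n0}"
    then consider "n < n0" | "n0 < n" by fastforce
    then show "Z (Suc n) \<omega> * (if alive n \<omega> then 1 else 0) * indicator ?U (X (Suc n) \<omega>) = 0"
    proof cases
      case 1
      then have "alive (Suc n) \<omega>" using th(3) n0 by simp
      then have "X (Suc n) \<omega> \<notin> ?U" using disj unfolding alive_def by blast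
      then show ?thesis by simp
    qed (use th(3) n0 in simp)
  qed simp
  also have "\<dots> = Z (\<theta> \<omega>) \<omega> * indicator ?U (X (\<theta> \<omega>) \<omega>)"
    using th(3)[of n0] unfolding n0 by (subst sum.insert) auto
  finally show ?thesis unfolding t .
qed

lemma ENr_eq:
  assumes i: "i \<in> K"
  shows "ENr Pr p X (S i) = (\<Sum>n. ro one n i)"
proof -
  note [measurable] = S_borel[OF K_less[OF i]]
  have m: "(\<lambda>\<omega>. (\<Sum>n\<in>{0..\<theta> \<omega>}. indicator (S i) (X n \<omega>)) :: real) \<in> borel_measurable Pr"
    by (rule measurable_compose_countable[where f = "\<lambda>k \<omega>. \<Sum>n\<in>{0..k}. indicator (S i) (X n \<omega>)"]) measurable
  have "ENr Pr p X (S i) = (\<integral>\<omega>. (\<Sum>n\<in>{0..\<theta> \<omega>}. indicator (S i) (X n \<omega>)) \<partial>Pr)" by (simp add: ENr_def \<theta>_def)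
  also have "\<dots> = enn2real (\<integral>\<^sup>+\<omega>. ennreal (\<Sum>n\<in>{0..\<theta> \<omega>}. indicator (S i) (X n \<omega>)) \<partial>Pr)"
    by (rule integral_eq_nn_integral[OF m]) (simp add: sum_nonneg)
  also have "(\<integral>\<^sup>+\<omega>. ennreal (\<Sum>n\<in>{0..\<theta> \<omega>}. indicator (S i) (X n \<omega>)) \<partial>Pr) = (\<integral>\<^sup>+\<omega>. (\<Sum>n. 1 * wt n i \<omega>) \<partial>Pr)"
    using AE_exits by (intro nn_integral_cong_AE) (auto simp: path_visits[OF _ i])
  also have "\<dots> = (\<Sum>n. occ one n i)"
    unfolding occ_def by (rule nn_integral_suminf) (simp add: wt_meas[OF K_less[OF i]])
  also have "\<dots> = (\<Sum>n. ennreal (ro one n i))" using occ_one_finite by (simp add: ro_def)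
  also have "\<dots> = ennreal (\<Sum>n. ro one n i)" using r_nonneg(1) one_flow(1)[OF i, of 0] by (intro suminf_ennreal2) auto
  finally show ?thesis using r_nonneg(1) one_flow(1)[OF i, of 0] by (simp add: suminf_nonneg)
qed

text \<open>Common to the exit probability, with \<open>Z\<close> constantly 1, and the exit time,
  with \<open>Z = Zt\<close>.\<close>

lemma nn_exit:
  assumes L: "L \<subseteq> {..<M}" "L \<inter> K = {}"
    and Z: "\<And>n. Z n \<in> borel_measurable Pr"
    and f: "\<And>n i j. i \<in> K \<Longrightarrow> j \<in> L \<Longrightarrow>
      (\<integral>\<^sup>+\<omega>. Z (Suc n) \<omega> * wt n i \<omega> * indicator (S j) (X (Suc n) \<omega>) \<partial>Pr) = ennreal (f n i j)"
    and f0: "\<And>n i j. 0 \<le> f n i j" and fs: "\<And>i j. i \<in> K \<Longrightarrow> j \<in> L \<Longrightarrow> summable (\<lambda>n. f n i j)"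
  shows "(\<integral>\<^sup>+\<omega>. Z (\<theta> \<omega>) \<omega> * indicator (\<Union>j\<in>L. S j) (X (\<theta> \<omega>) \<omega>) \<partial>Pr) = ennreal (\<Sum>i\<in>K. \<Sum>j\<in>L. \<Sum>n. f n i j)"
proof -
  have LM: "j < M" if "j \<in> L" for j using that L by blast
  have m: "(\<lambda>\<omega>. Z (Suc n) \<omega> * wt n i \<omega> * indicator (S j) (X (Suc n) \<omega>)) \<in> borel_measurable Pr"
    if "i \<in> K" "j \<in> L" for n i j
    using Z wt_meas[OF K_less[OF that(1)]] ind_meas[OF LM[OF that(2)]] by (intro borel_measurable_times_ennreal)
  have "(\<integral>\<^sup>+\<omega>. Z (\<theta> \<omega>) \<omega> * indicator (\<Union>j\<in>L. S j) (X (\<theta> \<omega>) \<omega>) \<partial>Pr) =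
      (\<integral>\<^sup>+\<omega>. (\<Sum>n. \<Sum>i\<in>K. \<Sum>j\<in>L. Z (Suc n) \<omega> * wt n i \<omega> * indicator (S j) (X (Suc n) \<omega>)) \<partial>Pr)"
    using AE_exits by (intro nn_integral_cong_AE) (auto simp: path_exit[OF _ L])
  also have "\<dots> = (\<Sum>n. \<integral>\<^sup>+\<omega>. (\<Sum>i\<in>K. \<Sum>j\<in>L. Z (Suc n) \<omega> * wt n i \<omega> * indicator (S j) (X (Suc n) \<omega>)) \<partial>Pr)"
    using m by (intro nn_integral_suminf borel_measurable_sum)
  also have "\<dots> = (\<Sum>n. ennreal (\<Sum>i\<in>K. \<Sum>j\<in>L. f n i j))"
  proof (intro arg_cong[of _ _ suminf] ext)
    fix n
    have "(\<integral>\<^sup>+\<omega>. (\<Sum>i\<in>K. \<Sum>j\<in>L. Z (Suc n) \<omega> * wt n i \<omega> * indicator (S j) (X (Suc n) \<omega>)) \<partial>Pr) =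
       (\<Sum>i\<in>K. \<integral>\<^sup>+\<omega>. (\<Sum>j\<in>L. Z (Suc n) \<omega> * wt n i \<omega> * indicator (S j) (X (Suc n) \<omega>)) \<partial>Pr)"
      using m by (intro nn_integral_sum borel_measurable_sum)
    also have "\<dots> = (\<Sum>i\<in>K. \<Sum>j\<in>L. ennreal (f n i j))"
      using m f by (intro sum.cong refl) (subst nn_integral_sum, auto)
    also have "\<dots> = ennreal (\<Sum>i\<in>K. \<Sum>j\<in>L. f n i j)" using f0 by (simp add: sum_nonneg)
    finally show "(\<integral>\<^sup>+\<omega>. (\<Sum>i\<in>K. \<Sum>j\<in>L. Z (Suc n) \<omega> * wt n i \<omega> * indicator (S j) (X (Suc n) \<omega>)) \<partial>Pr) =
       ennreal (\<Sum>i\<in>K. \<Sum>j\<in>L. f n i j)" .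
  qed
  also have "\<dots> = ennreal (\<Sum>n. \<Sum>i\<in>K. \<Sum>j\<in>L. f n i j)"
    using f0 fs by (intro suminf_ennreal2 sum_nonneg summable_sum) auto
  also have "(\<Sum>n. \<Sum>i\<in>K. \<Sum>j\<in>L. f n i j) = (\<Sum>i\<in>K. \<Sum>n. \<Sum>j\<in>L. f n i j)"
    using fs by (intro suminf_sum summable_sum)
  also have "\<dots> = (\<Sum>i\<in>K. \<Sum>j\<in>L. \<Sum>n. f n i j)" using fs by (intro sum.cong refl suminf_sum)
  finally show ?thesis .
qed

lemma UL_borel: "L \<subseteq> {..<M} \<Longrightarrow> (\<Union>j\<in>L. S j) \<in> sets borel"
  using S_borel finite_subset[of L "{..<M}"] by (intro sets.finite_UN) auto

lemma exit_prob:
  assumes L: "L \<subseteq> {..<M}" "L \<inter> K = {}"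
  shows "measure Pr {\<omega>\<in>space Pr. Xr1 p X \<omega> \<in> (\<Union>j\<in>L. S j)} = (\<Sum>i\<in>K. \<Sum>j\<in>L. \<Sum>n. rj one n i j)"
proof -
  note [measurable] = UL_borel[OF L(1)]
  have [measurable]: "(\<lambda>\<omega>. X (\<theta> \<omega>) \<omega>) \<in> Pr \<rightarrow>\<^sub>M borel"
    by (rule measurable_compose_countable[where f = X]) measurable
  have LM: "j < M" if "j \<in> L" for j using that L by blast
  let ?A = "{\<omega>\<in>space Pr. Xr1 p X \<omega> \<in> (\<Union>j\<in>L. S j)}"
  have A: "?A = {\<omega>\<in>space Pr. X (\<theta> \<omega>) \<omega> \<in> (\<Union>j\<in>L. S j)}" by (simp add: Xr1_def \<theta>_def)
  have Am: "?A \<in> sets Pr" unfolding A by measurable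
  have "ennreal (measure Pr ?A) = (\<integral>\<^sup>+\<omega>. indicator ?A \<omega> \<partial>Pr)" using Am by (simp add: emeasure_eq_measure)
  also have "\<dots> = (\<integral>\<^sup>+\<omega>. one (\<theta> \<omega>) \<omega> * indicator (\<Union>j\<in>L. S j) (X (\<theta> \<omega>) \<omega>) \<partial>Pr)"
    unfolding A by (intro nn_integral_cong) (simp add: indicator_def)
  also have "\<dots> = ennreal (\<Sum>i\<in>K. \<Sum>j\<in>L. \<Sum>n. rj one n i j)"
  proof (rule nn_exit[OF L])
    show "(\<integral>\<^sup>+\<omega>. 1 * wt n i \<omega> * indicator (S j) (X (Suc n) \<omega>) \<partial>Pr) = ennreal (rj one n i j)"
      if "i \<in> K" "j \<in> L" for n i j
      using jmp_one_finite[OF that(1) LM[OF that(2)], of n] unfolding rj_def jmp_def by simp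
    show "summable (\<lambda>n. rj one n i j)" if "i \<in> K" "j \<in> L" for i j
      using one_flow(2)[OF that(1) LM[OF that(2)], of 0] by simp
  qed (auto simp: r_nonneg)
  finally show ?thesis
    using one_flow(2)[of _ _ 0] LM by (subst (asm) ennreal_inj) (auto intro!: sum_nonneg suminf_nonneg simp: r_nonneg)
qed

lemma exit_time:
  assumes L: "L \<subseteq> {..<M}" "L \<inter> K = {}"
  shows "(\<integral>\<omega>. Tr1 p X T \<omega> * indicator (\<Union>j\<in>L. S j) (Xr1 p X \<omega>) \<partial>Pr) =
    (\<Sum>i\<in>K. \<Sum>j\<in>L. (\<Sum>n. rt n i j) + (\<Sum>n. rj Zt n i j))"
proof -
  define U where "U = (\<Union>j\<in>L. S j)"
  have [measurable]: "U \<in> sets borel" unfolding U_def by (rule UL_borel[OF L(1)])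
  have [measurable]: "(\<lambda>\<omega>. X (\<theta> \<omega>) \<omega>) \<in> Pr \<rightarrow>\<^sub>M borel"
    by (rule measurable_compose_countable[where f = X]) measurable
  have [measurable]: "(\<lambda>\<omega>. \<Sum>m\<in>{1..\<theta> \<omega>}. T m \<omega>) \<in> borel_measurable Pr"
    by (rule measurable_compose_countable[where f = "\<lambda>k \<omega>. \<Sum>m\<in>{1..k}. T m \<omega>"]) measurable
  have LM: "j < M" if "j \<in> L" for j using that L by blast
  have "(\<integral>\<omega>. Tr1 p X T \<omega> * indicator U (Xr1 p X \<omega>) \<partial>Pr) =
      (\<integral>\<omega>. (\<Sum>m\<in>{1..\<theta> \<omega>}. T m \<omega>) * indicator U (X (\<theta> \<omega>) \<omega>) \<partial>Pr)"
    by (simp add: Tr1_def Xr1_def \<theta>_def)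
  also have "\<dots> = enn2real (\<integral>\<^sup>+\<omega>. ennreal ((\<Sum>m\<in>{1..\<theta> \<omega>}. T m \<omega>) * indicator U (X (\<theta> \<omega>) \<omega>)) \<partial>Pr)"
  proof (rule integral_eq_nn_integral)
    show "AE \<omega> in Pr. 0 \<le> (\<Sum>m\<in>{1..\<theta> \<omega>}. T m \<omega>) * indicator U (X (\<theta> \<omega>) \<omega>)"
      using AE_exits by (rule AE_mp) (auto intro!: AE_I2 mult_nonneg_nonneg sum_nonneg simp: exits_def)
  qed measurable
  also have "(\<integral>\<^sup>+\<omega>. ennreal ((\<Sum>m\<in>{1..\<theta> \<omega>}. T m \<omega>) * indicator U (X (\<theta> \<omega>) \<omega>)) \<partial>Pr) =
      (\<integral>\<^sup>+\<omega>. Zt (\<theta> \<omega>) \<omega> * indicator U (X (\<theta> \<omega>) \<omega>) \<partial>Pr)"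
  proof (rule nn_integral_cong_AE, rule AE_mp[OF AE_exits], rule AE_I2, rule impI)
    fix \<omega> assume "exits \<omega>"
    then have "0 \<le> T m \<omega>" for m by (simp add: exits_def)
    then show "ennreal ((\<Sum>m\<in>{1..\<theta> \<omega>}. T m \<omega>) * indicator U (X (\<theta> \<omega>) \<omega>)) =
        Zt (\<theta> \<omega>) \<omega> * indicator U (X (\<theta> \<omega>) \<omega>)"
      by (simp add: Zt_def indicator_def)
  qed
  \<comment> \<open>At the exit the elapsed time splits into the time before the last jump and the
    holding time of that jump.\<close>
  also have "\<dots> = ennreal (\<Sum>i\<in>K. \<Sum>j\<in>L. \<Sum>n. rt n i j + rj Zt n i j)"
    unfolding U_def
  proof (rule nn_exit[OF L])
    show "(\<integral>\<^sup>+\<omega>. Zt (Suc n) \<omega> * wt n i \<omega> * indicator (S j) (X (Suc n) \<omega>) \<partial>Pr) = ennreal (rt n i j + rj Zt n i j)"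
      if "i \<in> K" "j \<in> L" for n i j
      unfolding jmp_Zt_Suc[OF K_less[OF that(1)] LM[OF that(2)]]
      using jmp_Zt_finite[OF that(1) LM[OF that(2)], of n] tim_finite[OF that(1) LM[OF that(2)], of n]
      by (simp add: rt_def rj_def ennreal_plus add.commute)
    show "summable (\<lambda>n. rt n i j + rj Zt n i j)" if "i \<in> K" "j \<in> L" for i j
      using Zt_flow(1)[OF that(1) LM[OF that(2)]] rt_summable[OF that(1) LM[OF that(2)]] by (rule summable_add[rotated])
    show "Zt n \<in> borel_measurable Pr" for n by (rule adapted_measurable[OF adapted_Zt])
  qed (auto simp: r_nonneg)
  also have "(\<Sum>i\<in>K. \<Sum>j\<in>L. \<Sum>n. rt n i j + rj Zt n i j) = (\<Sum>i\<in>K. \<Sum>j\<in>L. (\<Sum>n. rt n i j) + (\<Sum>n. rj Zt n i j))"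
    using Zt_flow(1) rt_summable LM by (intro sum.cong refl suminf_add[symmetric]) auto
  finally have e: "(\<integral>\<omega>. Tr1 p X T \<omega> * indicator U (Xr1 p X \<omega>) \<partial>Pr) =
      enn2real (ennreal (\<Sum>i\<in>K. \<Sum>j\<in>L. (\<Sum>n. rt n i j) + (\<Sum>n. rj Zt n i j)))" .
  have nn: "0 \<le> (\<Sum>i\<in>K. \<Sum>j\<in>L. (\<Sum>n. rt n i j) + (\<Sum>n. rj Zt n i j))"
    using Zt_flow(1) rt_summable LM r_nonneg by (intro sum_nonneg add_nonneg_nonneg suminf_nonneg) auto
  show ?thesis unfolding e[unfolded U_def] by (rule enn2real_ennreal[OF nn])
qed

lemma start_flow:
  "flow M P \<eta> K (\<lambda>j. if j = i0 then 1 else 0) (\<lambda>i. \<Sum>n. ro one n i) (\<lambda>i j. \<Sum>n. rj one n i j)"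
  by (rule flow_source_cong[OF _ one_flow(3)[of 0, simplified]]) (simp add: ro_def occ_one_0)

text \<open>Both flows belong to the same starting point, and their jump counts differ exactly by
  the first jump. Evaluating the exits of both by a law that sees only the source mass gives the
  harmonic equation at the point \<open>x\<close>.\<close>

lemma first_step_flows:
  "\<exists>N F N2 F2. flow M P \<eta> K (\<lambda>j. if j = i0 then 1 else 0) N F \<and>
     flow M P \<eta> K (\<lambda>j. kerP (Q x) (S j)) N2 F2 \<and>
     (\<forall>i\<in>K. \<forall>j<M. F i j = (if i = i0 then kerP (Q x) (S j) else 0) + F2 i j)"
proof (rule exI[of _ "\<lambda>i. \<Sum>n. ro one n i"], rule exI[of _ "\<lambda>i j. \<Sum>n. rj one n i j"],
    rule exI[of _ "\<lambda>i. \<Sum>n. ro one (n + 1) i"], rule exI[of _ "\<lambda>i j. \<Sum>n. rj one (n + 1) i j"], intro conjI)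
  let ?F = "\<lambda>i j. \<Sum>n. rj one n i j"
  have rj0: "rj one 0 i j = (if i = i0 then kerP (Q x) (S j) else 0)" if "i \<in> K" "j < M" for i j
    by (simp add: rj_def jmp_one_0[OF that] kerP_nonneg)
  show "flow M P \<eta> K (\<lambda>j. if j = i0 then 1 else 0) (\<lambda>i. \<Sum>n. ro one n i) ?F" by (rule start_flow)
  show "flow M P \<eta> K (\<lambda>j. kerP (Q x) (S j)) (\<lambda>i. \<Sum>n. ro one (n + 1) i) (\<lambda>i j. \<Sum>n. rj one (n + 1) i j)"
  proof (rule flow_source_cong[OF _ one_flow(3)])
    fix j assume j: "j \<in> K"
    have "ro one 1 j = (\<Sum>i\<in>K. rj one 0 i j)" using ro_one_Suc[OF j, of 0] by simp
    also have "\<dots> = (\<Sum>i\<in>K. if i = i0 then kerP (Q x) (S j) else 0)"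
      using rj0 K_less[OF j] by (intro sum.cong) auto
    also have "\<dots> = kerP (Q x) (S j)" using i0 finite_K by simp
    finally show "ro one 1 j = kerP (Q x) (S j)" .
  qed
  show "\<forall>i\<in>K. \<forall>j<M. ?F i j = (if i = i0 then kerP (Q x) (S j) else 0) + (\<Sum>n. rj one (n + 1) i j)"
  proof (intro ballI allI impI)
    fix i j assume ij: "i \<in> K" "j < M"
    have "summable (\<lambda>n. rj one n i j)" using one_flow(2)[OF ij, of 0] by simp
    from suminf_split_head[OF this] show "?F i j = (if i = i0 then kerP (Q x) (S j) else 0) + (\<Sum>n. rj one (n + 1) i j)"
      using rj0[OF ij] by simp
  qed
qed

text \<open>The interface to the asymptotic part: \<open>N\<close> and \<open>F\<close> count visits
  and jumps, \<open>FT i j\<close> accumulates the holding times of the jumps from \<open>i\<close>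
  to \<open>j\<close>, and \<open>F' i j\<close> the time elapsed before those jumps.\<close>

lemma exit_flows:
  "\<exists>N F W' F' FT. flow M P \<eta> K (\<lambda>j. if j = i0 then 1 else 0) N F \<and>
     flow M P \<eta> K (\<lambda>j. \<Sum>i\<in>K. FT i j) W' F' \<and>
     (\<forall>i\<in>K. \<forall>j<M. near \<eta> (FT i j) (\<tau> i * F i j)) \<and>
     (\<forall>i\<in>K. ENr Pr p X (S i) = N i) \<and>
     (\<forall>L. L \<subseteq> {..<M} \<longrightarrow> L \<inter> K = {} \<longrightarrow>
        measure Pr {\<omega>\<in>space Pr. Xr1 p X \<omega> \<in> (\<Union>j\<in>L. S j)} = (\<Sum>i\<in>K. \<Sum>j\<in>L. F i j) \<and>
        (\<integral>\<omega>. Tr1 p X T \<omega> * indicator (\<Union>j\<in>L. S j) (Xr1 p X \<omega>) \<partial>Pr) = (\<Sum>i\<in>K. \<Sum>j\<in>L. FT i j + F' i j))"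
proof (rule exI[of _ "\<lambda>i. \<Sum>n. ro one n i"], rule exI[of _ "\<lambda>i j. \<Sum>n. rj one n i j"],
    rule exI[of _ "\<lambda>i. \<Sum>n. ro Zt n i"], rule exI[of _ "\<lambda>i j. \<Sum>n. rj Zt n i j"],
    rule exI[of _ "\<lambda>i j. \<Sum>n. rt n i j"], intro conjI)
  let ?F = "\<lambda>i j. \<Sum>n. rj one n i j"
  show "flow M P \<eta> K (\<lambda>j. if j = i0 then 1 else 0) (\<lambda>i. \<Sum>n. ro one n i) ?F" by (rule start_flow)
  show "flow M P \<eta> K (\<lambda>j. \<Sum>i\<in>K. \<Sum>n. rt n i j) (\<lambda>i. \<Sum>n. ro Zt n i) (\<lambda>i j. \<Sum>n. rj Zt n i j)"
    by (rule Zt_flow(2))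
  show "\<forall>i\<in>K. \<forall>j<M. near \<eta> (\<Sum>n. rt n i j) (\<tau> i * ?F i j)"
  proof (intro ballI allI impI)
    fix i j assume ij: "i \<in> K" "j < M"
    have s: "summable (\<lambda>n. rj one n i j)" using one_flow(2)[OF ij, of 0] by simp
    have "near \<eta> (\<Sum>n. rt n i j) (\<Sum>n. \<tau> i * rj one n i j)"
      using rt_summable[OF ij] s rt_near[OF ij] by (intro near_suminf summable_mult)
    then show "near \<eta> (\<Sum>n. rt n i j) (\<tau> i * ?F i j)" using suminf_mult[OF s] by simp
  qed
  show "\<forall>i\<in>K. ENr Pr p X (S i) = (\<Sum>n. ro one n i)" using ENr_eq by blast
  show "\<forall>L. L \<subseteq> {..<M} \<longrightarrow> L \<inter> K = {} \<longrightarrow>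
        measure Pr {\<omega>\<in>space Pr. Xr1 p X \<omega> \<in> (\<Union>j\<in>L. S j)} = (\<Sum>i\<in>K. \<Sum>j\<in>L. ?F i j) \<and>
        (\<integral>\<omega>. Tr1 p X T \<omega> * indicator (\<Union>j\<in>L. S j) (Xr1 p X \<omega>) \<partial>Pr) =
          (\<Sum>i\<in>K. \<Sum>j\<in>L. (\<Sum>n. rt n i j) + (\<Sum>n. rj Zt n i j))"
    using exit_prob exit_time by blast
qed

end

section \<open>Relative error estimates for the exit time\<close>

lemma near_add: "near d a b \<Longrightarrow> near d a' b' \<Longrightarrow> near d (a + a') (b + b')"
  unfolding near_def by (simp add: algebra_simps)

text \<open>\<open>kL\<close> is the probability that the first jump reaches the target,
  \<open>kK\<close> that it stays in the cluster, and \<open>e2\<close> the mass reaching the target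
  later.\<close>

lemma harmonic_estimate:
  assumes e: "near d (kL + e2) p" and e2: "near d e2 (p * kK)"
    and d: "0 \<le> d" "d \<le> 1/6" and nn: "0 \<le> kL" "0 \<le> kK" "0 \<le> p"
  shows "near (6 * d) (kL + p * kK) p"
proof -
  have pk: "0 \<le> p * kK" using nn by simp
  have "near d (kL + e2) (kL + p * kK)" using near_add[OF near_refl[OF d(1) nn(1)] e2] .
  from near_sym[OF this] have "near (2 * d) (kL + p * kK) (kL + e2)" using d nn pk by simp
  moreover have "near (2 * d) (kL + e2) p" by (rule near_mono[OF e]) (use d nn in auto)
  ultimately have "near (3 * (2 * d)) (kL + p * kK) p" by (rule near_trans) (use d nn in auto)
  then show ?thesis by simp
qed

text \<open>Holding time earned on a jump counts fully if the jump ends in \<open>L\<close>, and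
  with weight \<open>p\<close>, the probability of a later exit to \<open>L\<close>, if it ends in
  \<open>K\<close>. So the total is close to the sum of \<open>\<tau> i * g i\<close>. Harmonicity
  \<open>h\<close> makes \<open>g i\<close> close to \<open>p * N i\<close>; then \<open>p\<close>
  factors out and cancels against the exit probability.\<close>

lemma exit_time_estimate:
  fixes \<nu> N \<tau> :: "nat \<Rightarrow> real" and F F' FT P :: "nat \<Rightarrow> nat \<Rightarrow> real"
  assumes d: "0 < d" "d \<le> 1/10000" and p: "0 < p" and K: "K \<subseteq> {..<M}" and L: "L \<subseteq> {..<M}"
    and N: "\<And>i. i \<in> K \<Longrightarrow> near d (N i) (\<nu> i)" and \<nu>: "\<And>i. i \<in> K \<Longrightarrow> 0 < \<nu> i" and \<tau>: "\<And>i. i \<in> K \<Longrightarrow> 0 < \<tau> i"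
    and EL: "near d (\<Sum>i\<in>K. \<Sum>j\<in>L. F i j) p"
    and P0: "\<And>i j. i \<in> K \<Longrightarrow> j < M \<Longrightarrow> 0 \<le> P i j"
    and F: "\<And>i j. i \<in> K \<Longrightarrow> j < M \<Longrightarrow> near d (F i j) (P i j * N i)"
    and h: "\<And>i. i \<in> K \<Longrightarrow> near (18 * d) ((\<Sum>j\<in>L. P i j) + p * (\<Sum>j\<in>K. P i j)) p"
    and FT: "\<And>i j. i \<in> K \<Longrightarrow> j < M \<Longrightarrow> near d (FT i j) (\<tau> i * F i j)"
    and F': "near d (\<Sum>i\<in>K. \<Sum>j\<in>L. F' i j) (p * (\<Sum>j\<in>K. \<Sum>i\<in>K. FT i j))"
  shows "near (4374 * d) (\<Sum>i\<in>K. \<Sum>j\<in>L. FT i j + F' i j) ((\<Sum>i\<in>K. \<Sum>j\<in>L. F i j) * (\<Sum>i\<in>K. \<tau> i * \<nu> i))"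
proof -
  have N0: "0 \<le> N i" if "i \<in> K" for i by (rule near_nonneg[OF N[OF that]]) (use d \<nu>[OF that] in auto)
  have F0: "0 \<le> F i j" if "i \<in> K" "j < M" for i j
    by (rule near_nonneg[OF F[OF that]]) (use d P0[OF that] N0[OF that(1)] in auto)
  have FT0: "0 \<le> FT i j" if "i \<in> K" "j < M" for i j
    by (rule near_nonneg[OF FT[OF that]]) (use d \<tau>[OF that(1)] F0[OF that] in auto)
  define t where "t = (\<Sum>i\<in>K. \<tau> i * \<nu> i)"
  have t0: "0 \<le> t" unfolding t_def using \<tau> \<nu> by (intro sum_nonneg) (simp add: less_imp_le)
  define A where "A = (\<Sum>i\<in>K. \<Sum>j\<in>L. FT i j) + p * (\<Sum>j\<in>K. \<Sum>i\<in>K. FT i j)"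
  define g where "g i = (\<Sum>j\<in>L. F i j) + p * (\<Sum>j\<in>K. F i j)" for i
  have LM: "j < M" if "j \<in> L" for j using L that by blast
  have KM: "j < M" if "j \<in> K" for j using K that by blast
  have g0: "0 \<le> g i" if "i \<in> K" for i
    unfolding g_def using F0[OF that] LM KM p by (intro add_nonneg_nonneg mult_nonneg_nonneg sum_nonneg) auto
  have G: "near (54 * d) (g i) (p * N i)" if i: "i \<in> K" for i
  proof -
    have "near d (g i) ((\<Sum>j\<in>L. P i j * N i) + p * (\<Sum>j\<in>K. P i j * N i))"
      unfolding g_def using F[OF i] LM KM p by (intro near_add near_cmult near_sum) auto
    also have "(\<Sum>j\<in>L. P i j * N i) + p * (\<Sum>j\<in>K. P i j * N i) = N i * ((\<Sum>j\<in>L. P i j) + p * (\<Sum>j\<in>K. P i j))"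
      by (simp add: algebra_simps sum_distrib_left sum_distrib_right)
    finally have 1: "near d (g i) (N i * ((\<Sum>j\<in>L. P i j) + p * (\<Sum>j\<in>K. P i j)))" .
    have nn: "0 \<le> (\<Sum>j\<in>L. P i j) + p * (\<Sum>j\<in>K. P i j)"
      using P0[OF i] LM KM p by (intro add_nonneg_nonneg mult_nonneg_nonneg sum_nonneg) auto
    have "near (18 * d) (g i) (N i * ((\<Sum>j\<in>L. P i j) + p * (\<Sum>j\<in>K. P i j)))"
      by (rule near_mono[OF 1]) (use d mult_nonneg_nonneg[OF N0[OF i] nn] in auto)
    moreover have "near (18 * d) (N i * ((\<Sum>j\<in>L. P i j) + p * (\<Sum>j\<in>K. P i j))) (N i * p)"
      by (rule near_cmult[OF h[OF i] N0[OF i]])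
    ultimately have "near (3 * (18 * d)) (g i) (N i * p)" by (rule near_trans) (use d p N0[OF i] in auto)
    then show ?thesis by (simp add: mult.commute)
  qed
  have s1: "near d (\<Sum>i\<in>K. \<Sum>j\<in>L. FT i j + F' i j) A"
  proof -
    have "0 \<le> (\<Sum>i\<in>K. \<Sum>j\<in>L. FT i j)" using FT0 LM by (intro sum_nonneg) auto
    from near_add[OF near_refl[OF _ this] F'] show ?thesis using d by (simp add: A_def sum.distrib)
  qed
  have A0: "0 \<le> A" unfolding A_def using FT0 LM KM p by (intro add_nonneg_nonneg mult_nonneg_nonneg sum_nonneg) auto
  have s2: "near d A (\<Sum>i\<in>K. \<tau> i * g i)"
  proof -
    have "(\<Sum>j\<in>K. \<Sum>i\<in>K. FT i j) = (\<Sum>i\<in>K. \<Sum>j\<in>K. FT i j)" by (rule sum.swap)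
    then have A: "A = (\<Sum>i\<in>K. (\<Sum>j\<in>L. FT i j) + p * (\<Sum>j\<in>K. FT i j))"
      by (simp add: A_def sum.distrib sum_distrib_left)
    have "near d ((\<Sum>j\<in>L. FT i j) + p * (\<Sum>j\<in>K. FT i j)) (\<tau> i * g i)" if i: "i \<in> K" for i
    proof -
      have "near d ((\<Sum>j\<in>L. FT i j) + p * (\<Sum>j\<in>K. FT i j)) ((\<Sum>j\<in>L. \<tau> i * F i j) + p * (\<Sum>j\<in>K. \<tau> i * F i j))"
        using FT[OF i] LM KM p by (intro near_add near_cmult near_sum) auto
      then show ?thesis by (simp add: g_def algebra_simps sum_distrib_left)
    qed
    then show ?thesis unfolding A by (rule near_sum)
  qed
  have s3: "near (54 * d) (\<Sum>i\<in>K. \<tau> i * g i) (\<Sum>i\<in>K. \<tau> i * (p * N i))"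
    using G \<tau> by (intro near_sum near_cmult) (auto simp: less_imp_le)
  have s4: "near d (\<Sum>i\<in>K. \<tau> i * (p * N i)) (p * t)"
  proof -
    have "near d (\<Sum>i\<in>K. \<tau> i * (p * N i)) (\<Sum>i\<in>K. \<tau> i * (p * \<nu> i))"
      using N \<tau> p by (intro near_sum near_cmult) (auto simp: less_imp_le)
    then show ?thesis by (simp add: t_def sum_distrib_left mult_ac)
  qed
  \<comment> \<open>The error of \<open>G\<close> dominates those of the other steps. Four
    applications of \<open>near_trans\<close> follow, so the final constant is 81 * 54 = 4374; the
    bound on \<open>d\<close> keeps all intermediate tolerances below 1.\<close>
  define e where "e = 54 * d"
  have e: "0 \<le> e" "d \<le> e" "81 * e \<le> 1" "3 * e \<le> 1" "9 * e \<le> 1" using d by (auto simp: e_def)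
  have B0: "0 \<le> (\<Sum>i\<in>K. \<tau> i * g i)" using \<tau> g0 by (intro sum_nonneg) (simp add: less_imp_le)
  have C0: "0 \<le> (\<Sum>i\<in>K. \<tau> i * (p * N i))" using \<tau> N0 p by (intro sum_nonneg) (simp add: less_imp_le)
  have pt: "0 \<le> p * t" using p t0 by simp
  have "near (3 * e) (\<Sum>i\<in>K. \<Sum>j\<in>L. FT i j + F' i j) (\<Sum>i\<in>K. \<tau> i * g i)"
    by (rule near_trans[OF near_mono[OF s1] near_mono[OF s2]]) (use e A0 B0 in auto)
  moreover have "near (3 * e) (\<Sum>i\<in>K. \<tau> i * g i) (\<Sum>i\<in>K. \<tau> i * (p * N i))"
    using near_mono[OF s3, of "3 * e"] e C0 by (simp add: e_def)
  ultimately have "near (3 * (3 * e)) (\<Sum>i\<in>K. \<Sum>j\<in>L. FT i j + F' i j) (\<Sum>i\<in>K. \<tau> i * (p * N i))"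
    by (rule near_trans) (use e C0 in auto)
  moreover have "near (3 * (3 * e)) (\<Sum>i\<in>K. \<tau> i * (p * N i)) (p * t)"
    by (rule near_mono[OF s4]) (use e pt in auto)
  ultimately have "near (3 * (3 * (3 * e))) (\<Sum>i\<in>K. \<Sum>j\<in>L. FT i j + F' i j) (p * t)"
    by (rule near_trans) (use e pt in auto)
  then have 1: "near (27 * e) (\<Sum>i\<in>K. \<Sum>j\<in>L. FT i j + F' i j) (p * t)" by simp
  have EL0: "0 \<le> (\<Sum>i\<in>K. \<Sum>j\<in>L. F i j)" using F0 LM by (intro sum_nonneg) auto
  have "near (2 * d) p (\<Sum>i\<in>K. \<Sum>j\<in>L. F i j)" by (rule near_sym[OF EL]) (use d p in auto)
  from near_cmult[OF this t0] have "near (2 * d) (p * t) ((\<Sum>i\<in>K. \<Sum>j\<in>L. F i j) * t)" by (simp add: mult.commute)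
  then have "near (27 * e) (p * t) ((\<Sum>i\<in>K. \<Sum>j\<in>L. F i j) * t)"
    by (rule near_mono) (use d EL0 t0 in \<open>auto simp: e_def\<close>)
  with 1 have "near (3 * (27 * e)) (\<Sum>i\<in>K. \<Sum>j\<in>L. FT i j + F' i j) ((\<Sum>i\<in>K. \<Sum>j\<in>L. F i j) * t)"
    by (rule near_trans) (use e EL0 t0 in auto)
  then show ?thesis by (simp add: e_def t_def)
qed

lemma near_ratio:
  assumes "near d a b" "0 < b" "d < \<delta>"
  shows "\<bar>a / b - 1\<bar> < \<delta>"
proof -
  have "a / b - 1 = (a - b) / b" using assms(2) by (simp add: diff_divide_distrib)
  then have "\<bar>a / b - 1\<bar> = \<bar>a - b\<bar> / b" using assms(2) by simp
  also have "\<dots> \<le> d" using assms(1,2) by (simp add: near_def pos_divide_le_eq)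
  finally show ?thesis using assms(3) by linarith
qed

section \<open>The transition matrix of the original chain\<close>

lemma ratio_in_scale:
  assumes "i < M" "j < M" "l < M" "\<And>\<epsilon>. 0 < \<epsilon> \<Longrightarrow> 0 < Pm \<epsilon> i j" "\<And>\<epsilon>. 0 < \<epsilon> \<Longrightarrow> 0 < Pm \<epsilon> i l"
  shows "(\<lambda>\<epsilon>. Pm \<epsilon> i j / Pm \<epsilon> i l) \<in> ratio_scale M Pm"
proof (rule ratio_scaleI[of _ 1 _ _ "[(i, j, l)]"])
  have "\<forall>\<^sub>F \<epsilon> in at_right 0. (Pm \<epsilon> i j / Pm \<epsilon> i l) / mono_fn Pm [(i, j, l)] \<epsilon> = 1"
    using eventually_pos_at_right
  proof eventually_elim
    case (elim \<epsilon>)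
    then show ?case using assms(4,5)[OF elim] by (simp add: mono_fn_def)
  qed
  then show "((\<lambda>\<epsilon>. (Pm \<epsilon> i j / Pm \<epsilon> i l) / mono_fn Pm [(i, j, l)] \<epsilon>) \<longlongrightarrow> 1) (at_right 0)"
    by (rule tendsto_eventually)
qed (use assms in \<open>auto simp: admissible_def\<close>)

text \<open>The scale is generated by ratios only, but the row sums recover the entries themselves:
  for positive \<open>Pm \<epsilon> i j\<close> the ratios
  \<open>Pm \<epsilon> i l / Pm \<epsilon> i j\<close> add up to
  \<open>1 / Pm \<epsilon> i j\<close>.\<close>

lemma good_transition:
  fixes Pm :: "real \<Rightarrow> nat \<Rightarrow> nat \<Rightarrow> real"
  assumes sgn: "\<And>i j. i < M \<Longrightarrow> j < M \<Longrightarrow> (\<forall>\<epsilon>>0. Pm \<epsilon> i j = 0) \<or> (\<forall>\<epsilon>>0. 0 < Pm \<epsilon> i j)"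
    and diag: "\<And>\<epsilon> i. 0 < \<epsilon> \<Longrightarrow> i < M \<Longrightarrow> Pm \<epsilon> i i = 0"
    and row: "\<And>\<epsilon> i. 0 < \<epsilon> \<Longrightarrow> i < M \<Longrightarrow> (\<Sum>j<M. Pm \<epsilon> i j) = 1"
    and comm: "\<And>i j. i < M \<Longrightarrow> j < M \<Longrightarrow> (i, j) \<in> {(a, b). a < M \<and> b < M \<and> (\<forall>\<epsilon>>0. Pm \<epsilon> a b > 0)}\<^sup>*"
    and ac: "asymp_class (ratio_scale M Pm)"
  shows "asymp_class.good (ratio_scale M Pm) M Pm"
proof -
  interpret asymp_class "ratio_scale M Pm" by (rule ac)
  have "G0 (\<lambda>\<epsilon>. Pm \<epsilon> i j)" if i: "i < M" and j: "j < M" for i j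
  proof (cases "\<forall>\<epsilon>>0. Pm \<epsilon> i j = 0")
    case False
    then have pos: "\<And>\<epsilon>. 0 < \<epsilon> \<Longrightarrow> 0 < Pm \<epsilon> i j" using sgn[OF i j] by blast
    have "G0 (\<lambda>\<epsilon>. Pm \<epsilon> i l / Pm \<epsilon> i j)" if l: "l < M" for l
      using sgn[OF i l] ratio_in_scale[where Pm = Pm, OF i l j _ pos] unfolding G0_def by auto
    then have s: "G0 (\<lambda>\<epsilon>. \<Sum>l<M. Pm \<epsilon> i l / Pm \<epsilon> i j)" by (intro G0_sum) auto
    have e: "(\<Sum>l<M. Pm \<epsilon> i l / Pm \<epsilon> i j) = 1 / Pm \<epsilon> i j" if "0 < \<epsilon>" for \<epsilon>
      using row[OF that i] by (simp flip: sum_divide_distrib)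
    have "(\<lambda>\<epsilon>. \<Sum>l<M. Pm \<epsilon> i l / Pm \<epsilon> i j) \<in> ratio_scale M Pm"
      by (rule G0_in_G[OF s zero_less_one]) (simp add: e pos)
    \<comment> \<open>The constant 1, written as a ratio so as to lie in the scale, is divided by
      this sum.\<close>
    from G_divide[OF ratio_in_scale[where Pm = Pm, OF i j j pos pos] this]
    have "(\<lambda>\<epsilon>. Pm \<epsilon> i j / Pm \<epsilon> i j / (\<Sum>l<M. Pm \<epsilon> i l / Pm \<epsilon> i j)) \<in> ratio_scale M Pm" .
    then have "(\<lambda>\<epsilon>. Pm \<epsilon> i j) \<in> ratio_scale M Pm"
    proof (rule G_cong)
      fix \<epsilon> :: real assume "0 < \<epsilon>"
      then show "Pm \<epsilon> i j = Pm \<epsilon> i j / Pm \<epsilon> i j / (\<Sum>l<M. Pm \<epsilon> i l / Pm \<epsilon> i j)"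
        using pos[of \<epsilon>] by (simp add: e)
    qed
    then show ?thesis by (simp add: G0_def)
  qed (simp add: G0_def)
  then show ?thesis unfolding good_def using diag row comm by blast
qed

text \<open>With both holding-time indices in (f) set to 0 the holding times cancel, leaving the
  bare product of ratios.\<close>

lemma mono_fn_limit:
  fixes Pm :: "real \<Rightarrow> nat \<Rightarrow> nat \<Rightarrow> real" and tau :: "real \<Rightarrow> nat \<Rightarrow> real"
  assumes f_lim: "\<forall>(n::nat) ia ib idd ja jc. (\<forall>m\<in>{1..n}. ia m < M \<and> ib m < M \<and> idd m < M \<and>
            \<not> (\<forall>\<epsilon>>0. Pm \<epsilon> (ia m) (ib m) = 0) \<and> \<not> (\<forall>\<epsilon>>0. Pm \<epsilon> (ia m) (idd m) = 0)) \<longrightarrow>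
         ja < M \<longrightarrow> jc < M \<longrightarrow>
         (\<exists>L::ereal. L \<ge> 0 \<and>
            ((\<lambda>\<epsilon>. ereal ((\<Prod>m\<in>{1..n}. Pm \<epsilon> (ia m) (ib m) / Pm \<epsilon> (ia m) (idd m))
                      * tau \<epsilon> ja / tau \<epsilon> jc)) \<longlongrightarrow> L) (at_right 0))"
    and M: "0 < M" and tau: "\<And>\<epsilon>. 0 < \<epsilon> \<Longrightarrow> 0 < tau \<epsilon> 0" and adm: "admissible M Pm xs"
  shows "\<exists>L::ereal. L \<ge> 0 \<and> ((\<lambda>\<epsilon>. ereal (mono_fn Pm xs \<epsilon>)) \<longlongrightarrow> L) (at_right 0)"
proof -
  define n where "n = length xs"
  \<comment> \<open>The product in (f) is indexed from 1, list positions from 0.\<close>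
  define ia where "ia m = fst (xs ! (m - 1))" for m
  define ib where "ib m = fst (snd (xs ! (m - 1)))" for m
  define ic where "ic m = snd (snd (xs ! (m - 1)))" for m
  have "ia m < M \<and> ib m < M \<and> ic m < M \<and> \<not> (\<forall>\<epsilon>>0. Pm \<epsilon> (ia m) (ib m) = 0) \<and> \<not> (\<forall>\<epsilon>>0. Pm \<epsilon> (ia m) (ic m) = 0)"
    if "m \<in> {1..n}" for m
  proof -
    have "xs ! (m - 1) \<in> set xs" using that by (intro nth_mem) (auto simp: n_def)
    then have "ia m < M \<and> ib m < M \<and> ic m < M \<and> (\<forall>\<epsilon>>0. 0 < Pm \<epsilon> (ia m) (ib m)) \<and> (\<forall>\<epsilon>>0. 0 < Pm \<epsilon> (ia m) (ic m))"
      using adm unfolding admissible_def ia_def ib_def ic_def by (auto simp: case_prod_beta)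
    moreover have "(0::real) < 1" by simp
    ultimately show ?thesis by (metis less_irrefl)
  qed
  then obtain L :: ereal where L: "L \<ge> 0" "((\<lambda>\<epsilon>. ereal ((\<Prod>m\<in>{1..n}. Pm \<epsilon> (ia m) (ib m) / Pm \<epsilon> (ia m) (ic m))
                      * tau \<epsilon> 0 / tau \<epsilon> 0)) \<longlongrightarrow> L) (at_right 0)"
    using f_lim[rule_format, of n ia ib ic 0 0] M by blast
  have e: "(\<Prod>m\<in>{1..n}. Pm \<epsilon> (ia m) (ib m) / Pm \<epsilon> (ia m) (ic m)) = mono_fn Pm xs \<epsilon>" for \<epsilon>
  proof -
    have "mono_fn Pm xs \<epsilon> = (\<Prod>i<n. (\<lambda>(a, b, d). Pm \<epsilon> a b / Pm \<epsilon> a d) (xs ! i))"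
      unfolding mono_fn_def n_def by (simp add: prod.list_conv_set_nth atLeast0LessThan)
    also have "\<dots> = (\<Prod>i<n. Pm \<epsilon> (ia (Suc i)) (ib (Suc i)) / Pm \<epsilon> (ia (Suc i)) (ic (Suc i)))"
      by (intro prod.cong) (auto simp: ia_def ib_def ic_def case_prod_beta)
    also have "\<dots> = (\<Prod>m\<in>{1..n}. Pm \<epsilon> (ia m) (ib m) / Pm \<epsilon> (ia m) (ic m))"
      by (rule prod.reindex_bij_witness[of _ "\<lambda>m. m - 1" Suc]) auto
    finally show ?thesis by simp
  qed
  have "\<forall>\<^sub>F \<epsilon> in at_right 0. ereal ((\<Prod>m\<in>{1..n}. Pm \<epsilon> (ia m) (ib m) / Pm \<epsilon> (ia m) (ic m)) * tau \<epsilon> 0 / tau \<epsilon> 0) =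
      ereal (mono_fn Pm xs \<epsilon>)"
    using eventually_pos_at_right
  proof eventually_elim
    case (elim \<epsilon>)
    then show ?case unfolding e using tau[OF elim] by simp
  qed
  from Lim_transform_eventually[OF L(2) this] L(1) show ?thesis by blast
qed

text \<open>\<open>kerP\<close> carries no information on negative times, but there
  \<open>ennreal (snd q)\<close> is already 0.\<close>

lemma time_nn_zero:
  fixes N :: "('a::metric_space \<times> real) measure"
  assumes prob: "prob_space N" and sets: "sets N = sets (borel \<Otimes>\<^sub>M borel)" and B: "B \<in> sets borel"
    and z: "kerP N B = 0"
  shows "(\<integral>\<^sup>+q. ennreal (snd q) * indicator B (fst q) \<partial>N) = 0"
proof -
  interpret prob_space N by (rule prob)
  have "B \<times> {0..} \<in> sets N" using B by (simp add: sets)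
  moreover have "emeasure N (B \<times> {0..}) = 0" using z by (simp add: kerP_def emeasure_eq_measure)
  ultimately have "AE q in N. q \<notin> B \<times> {0..}" by (intro AE_not_in) (simp add: null_sets_def)
  then have "AE q in N. ennreal (snd q) * indicator B (fst q) = 0"
    by (rule AE_mp) (auto intro!: AE_I2 simp: indicator_def ennreal_neg mem_Times_iff)
  then have "(\<integral>\<^sup>+q. ennreal (snd q) * indicator B (fst q) \<partial>N) = (\<integral>\<^sup>+q. 0 \<partial>N)" by (rule nn_integral_cong_AE)
  then show ?thesis by simp
qed

text \<open>The bound excludes the junk value 0 of a non-integrable Bochner integral, so that the
  conditional mean is a genuine expectation.\<close>
lemma time_nn_near:
  fixes N :: "('a::metric_space \<times> real) measure"
  assumes prob: "prob_space N" and sets: "sets N = sets (borel \<Otimes>\<^sub>M borel)" and B: "B \<in> sets borel"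
    and neg: "measure N (UNIV \<times> {..<0}) = 0" and k: "0 < kerP N B" and t: "0 < t" and d: "d \<le> 1"
    and m: "\<bar>condMom N B (\<lambda>t. t) / t - 1\<bar> < d"
  shows "time_near d N B t"
proof -
  interpret prob_space N by (rule prob)
  define c where "c = (\<integral>q. indicator B (fst q) * snd q \<partial>N)"
  have tk: "0 < t * kerP N B" using t k by simp
  have e: "condMom N B (\<lambda>t. t) / t - 1 = (c - t * kerP N B) / (t * kerP N B)"
    using t k by (simp add: condMom_def c_def field_simps)
  have nr: "\<bar>c - t * kerP N B\<bar> < d * (t * kerP N B)"
    using m tk unfolding e by (simp add: pos_divide_less_eq)
  \<comment> \<open>A number whose relative distance to a positive number is strictly below 1 cannot
    be 0.\<close>
  then have "c \<noteq> 0" using mult_right_mono[OF d less_imp_le[OF tk]] by auto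
  then have int: "integrable N (\<lambda>q. indicator B (fst q) * snd q)"
    unfolding c_def using not_integrable_integral_eq by blast
  have "UNIV \<times> {..<0} \<in> sets N" by (simp add: sets)
  moreover have "emeasure N (UNIV \<times> {..<0}) = 0" using neg by (simp add: emeasure_eq_measure)
  ultimately have "AE q in N. q \<notin> UNIV \<times> {..<0}" by (intro AE_not_in) (simp add: null_sets_def)
  then have nn: "AE q in N. 0 \<le> indicator B (fst q) * snd q"
    by (rule AE_mp) (auto intro!: AE_I2 simp: indicator_def mem_Times_iff)
  have "(\<integral>\<^sup>+q. ennreal (snd q) * indicator B (fst q) \<partial>N) = (\<integral>\<^sup>+q. ennreal (indicator B (fst q) * snd q) \<partial>N)"
    by (intro nn_integral_cong) (simp add: indicator_def)
  also have "\<dots> = ennreal c" unfolding c_def by (rule nn_integral_eq_integral[OF int nn])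
  finally show ?thesis using nr unfolding time_near_def near_def by (intro exI[of _ c]) simp
qed

lemma eventually_all_less2:
  fixes M :: nat
  assumes "\<And>i j. i < M \<Longrightarrow> j < M \<Longrightarrow> \<forall>\<^sub>F \<epsilon> in F. R i j \<epsilon>"
  shows "\<forall>\<^sub>F \<epsilon> in F. \<forall>i<M. \<forall>j<M. R i j \<epsilon>"
proof -
  have "\<forall>\<^sub>F \<epsilon> in F. \<forall>q\<in>{..<M} \<times> {..<M}. R (fst q) (snd q) \<epsilon>"
    using assms by (intro eventually_ball_finite) auto
  then show ?thesis by (rule eventually_mono) auto
qed

section \<open>Mean exit time from a cluster of any rank below the top\<close>

theorem theorem6p2:
  fixes M :: nat
    and S :: "nat \<Rightarrow> 'a::metric_space set"
    and Q :: "real \<Rightarrow> 'a \<Rightarrow> ('a \<times> real) measure"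
    and Pm :: "real \<Rightarrow> nat \<Rightarrow> nat \<Rightarrow> real"
    and tau :: "real \<Rightarrow> nat \<Rightarrow> real"
    and Prb :: "real \<Rightarrow> 'a \<Rightarrow> 'w measure"
    and X :: "real \<Rightarrow> 'a \<Rightarrow> nat \<Rightarrow> 'w \<Rightarrow> 'a"
    and T :: "real \<Rightarrow> 'a \<Rightarrow> nat \<Rightarrow> 'w \<Rightarrow> real"
    and r k :: nat
  assumes S_borel: "\<forall>i<M. S i \<in> sets borel"
    and S_disj: "\<forall>i<M. \<forall>j<M. i \<noteq> j \<longrightarrow> S i \<inter> S j = {}"
    and S_cover: "(\<Union>i<M. S i) = UNIV"
    and Q_kernel: "\<forall>\<epsilon>>0. Q \<epsilon> \<in> borel \<rightarrow>\<^sub>M prob_algebra (borel \<Otimes>\<^sub>M borel)"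
    and Q_nonneg_time: "\<forall>\<epsilon>>0. \<forall>x. measure (Q \<epsilon> x) (UNIV \<times> {..<0}) = 0"
    and a_diag: "\<forall>\<epsilon>>0. \<forall>i<M. \<forall>x\<in>S i. kerP (Q \<epsilon> x) (S i) = 0"
    and a_Pdiag: "\<forall>\<epsilon>>0. \<forall>i<M. Pm \<epsilon> i i = 0"
    and a_offdiag: "\<forall>i<M. \<forall>j<M. i \<noteq> j \<longrightarrow>
         ((\<forall>\<epsilon>>0. Pm \<epsilon> i j = 0 \<and> (\<forall>x\<in>S i. kerP (Q \<epsilon> x) (S j) = 0)) \<or>
          ((\<forall>\<epsilon>>0. Pm \<epsilon> i j > 0 \<and> (\<forall>x\<in>S i. kerP (Q \<epsilon> x) (S j) > 0)) \<and>
           unif_to_one (\<lambda>\<epsilon> x. kerP (Q \<epsilon> x) (S j) / Pm \<epsilon> i j) (S i)))"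
    and a_sum: "\<forall>\<epsilon>>0. \<forall>i<M. (\<Sum>j<M. Pm \<epsilon> i j) = 1"
    and a_comm: "\<forall>i<M. \<forall>j<M. (i, j) \<in> {(a, b). a < M \<and> b < M \<and> (\<forall>\<epsilon>>0. Pm \<epsilon> a b > 0)}\<^sup>*"
    and b_pos: "\<forall>\<epsilon>>0. \<forall>i<M. tau \<epsilon> i > 0"
    and b_mean: "\<forall>i<M. \<forall>j<M. \<not> (\<forall>\<epsilon>>0. Pm \<epsilon> i j = 0) \<longrightarrow>
         unif_to_one (\<lambda>\<epsilon> x. condMom (Q \<epsilon> x) (S j) (\<lambda>t. t) / tau \<epsilon> i) (S i)"
    and c_var: "\<exists>C \<epsilon>0. \<epsilon>0 > 0 \<and> (\<forall>\<epsilon>. 0 < \<epsilon> \<and> \<epsilon> \<le> \<epsilon>0 \<longrightarrow>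
         (\<forall>i<M. \<forall>j<M. \<not> (\<forall>e>0. Pm e i j = 0) \<longrightarrow> (\<forall>x\<in>S i.
            integrable (Q \<epsilon> x) (\<lambda>p. indicator (S j) (fst p) * (snd p)\<^sup>2) \<and>
            condVar (Q \<epsilon> x) (S j) \<le> C * (tau \<epsilon> i)\<^sup>2)))"
    and f_lim: "\<forall>(n::nat) ia ib idd ja jc. (\<forall>m\<in>{1..n}. ia m < M \<and> ib m < M \<and> idd m < M \<and>
            \<not> (\<forall>\<epsilon>>0. Pm \<epsilon> (ia m) (ib m) = 0) \<and> \<not> (\<forall>\<epsilon>>0. Pm \<epsilon> (ia m) (idd m) = 0)) \<longrightarrow>
         ja < M \<longrightarrow> jc < M \<longrightarrow>
         (\<exists>L::ereal. L \<ge> 0 \<and>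
            ((\<lambda>\<epsilon>. ereal ((\<Prod>m\<in>{1..n}. Pm \<epsilon> (ia m) (ib m) / Pm \<epsilon> (ia m) (idd m))
                      * tau \<epsilon> ja / tau \<epsilon> jc)) \<longlongrightarrow> L) (at_right 0))"
    and chain: "\<forall>\<epsilon>>0. \<forall>x. MRP_chain (Q \<epsilon>) x (Prb \<epsilon> x) (X \<epsilon> x) (T \<epsilon> x)"
    and r_lt: "r < Rtop M Pm"
    and k_lt: "k < Mr M Pm r"
  shows "\<exists>taur :: real \<Rightarrow> real.
     unif_to_one (\<lambda>\<epsilon> x. taur \<epsilon> /
         (\<Sum>i\<in>{i. i < M \<and> S i \<subseteq> Sr M Pm S r k}.
            tau \<epsilon> i * ENr (Prb \<epsilon> x) (piR M Pm S r) (X \<epsilon> x) (S i)))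
       (Sr M Pm S r k) \<and>
     (\<forall>l < Mr M Pm r. \<not> (\<forall>\<epsilon>>0. Pmat M Pm r \<epsilon> k l = 0) \<longrightarrow>
        unif_to_one (\<lambda>\<epsilon> x. ETr (Prb \<epsilon> x) (piR M Pm S r) (X \<epsilon> x) (T \<epsilon> x) (Sr M Pm S r l) / taur \<epsilon>)
          (Sr M Pm S r k))"
proof -
  have M: "0 < M" using S_cover by (cases M) auto
  have sgn: "(\<forall>\<epsilon>>0. Pm \<epsilon> i j = 0) \<or> (\<forall>\<epsilon>>0. 0 < Pm \<epsilon> i j)" if "i < M" "j < M" for i j
    using a_offdiag a_Pdiag that by (cases "i = j") blast+
  have P0: "0 \<le> Pm \<epsilon> i j" if "0 < \<epsilon>" "i < M" "j < M" for \<epsilon> i j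
    using sgn[OF that(2,3)] that(1) by (metis less_imp_le order_refl)
  have ac: "asymp_class (ratio_scale M Pm)"
    by (rule asymp_class_ratio_scale, rule mono_fn_limit[OF f_lim M]) (use b_pos M in auto)
  interpret asymp_class "ratio_scale M Pm" by (rule ac)
  have g: "good M Pm"
    by (rule good_transition[OF sgn _ _ _ ac]) (use a_Pdiag a_sum a_comm in blast)+
  have Mr1: "Mr M Pm s \<noteq> 1" if "s \<le> r" for s
    using not_less_Least[of s "\<lambda>r. Mr M Pm r = 1"] that r_lt unfolding Rtop_def by linarith
  let ?c = "clus M Pm r" and ?m = "Mr M Pm r" and ?P = "Pmat M Pm r" and ?p = "piR M Pm S r"
  have m1: "1 < ?m" and gr: "good ?m ?P" and cl: "\<And>i. i < M \<Longrightarrow> ?c i < ?m"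
    and cs: "\<And>k. k < ?m \<Longrightarrow> \<exists>i<M. ?c i = k"
    and "\<exists>\<nu>. (\<forall>\<epsilon>>0. \<forall>i<M. 0 < \<nu> \<epsilon> i) \<and> rank_asymp M Pm ?m ?c ?P \<nu>"
    using hier_good[OF g M Mr1] by blast+
  then obtain \<nu> where \<nu>: "\<And>\<epsilon> i. 0 < \<epsilon> \<Longrightarrow> i < M \<Longrightarrow> 0 < \<nu> \<epsilon> i" and ra: "rank_asymp M Pm ?m ?c ?P \<nu>" by blast
  let ?Kc = "\<lambda>a. {i. i < M \<and> ?c i = a}"
  define K where "K = ?Kc k"
  have KM: "K \<subseteq> {..<M}" and finK: "finite K" by (auto simp: K_def)
  have Kne: "K \<noteq> {}" using cs[OF k_lt] by (auto simp: K_def)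
  have Sr: "Sr M Pm S r a = (\<Union>i\<in>?Kc a. S i)" for a by (simp add: Sr_def)
  \<comment> \<open>An empty \<open>S i\<close> would be contained in every cluster and offer no
    starting point. It is impossible: along a path from a nonempty set to an empty one, some edge
    would give positive probability to an empty set.\<close>
  have S_ne: "S i \<noteq> {}" if i: "i < M" for i
  proof
    assume e: "S i = {}"
    have "undefined \<in> (\<Union>i<M. S i)" unfolding S_cover by (rule UNIV_I)
    then obtain j where j: "j < M" "S j \<noteq> {}" by blast
    from rtrancl_leaves[of j i _ "{j. S j \<noteq> {}}", OF a_comm[rule_format, OF j(1) i]] j e
    obtain u v where uv: "u < M" "v < M" "\<forall>\<epsilon>>0. 0 < Pm \<epsilon> u v" "S u \<noteq> {}" "S v = {}" by auto
    then obtain y where y: "y \<in> S u" by blast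
    have "u \<noteq> v" using uv by auto
    have "0 < Pm 1 u v" using uv by simp
    then have "0 < kerP (Q 1 y) (S v)"
      using a_offdiag[rule_format, OF uv(1,2) \<open>u \<noteq> v\<close>] y zero_less_one by (metis less_irrefl)
    then show False using uv(5) by (simp add: kerP_def)
  qed
  have idx: "{i. i < M \<and> S i \<subseteq> Sr M Pm S r k} = K"
  proof (intro set_eqI iffI)
    fix i assume "i \<in> {i. i < M \<and> S i \<subseteq> Sr M Pm S r k}"
    then have i: "i < M" "S i \<subseteq> (\<Union>i\<in>K. S i)" by (auto simp: Sr K_def)
    obtain y where y: "y \<in> S i" using S_ne[OF i(1)] by blast
    then obtain j where j: "j \<in> K" "y \<in> S j" using i by blast
    then have "j = i" using S_disj i(1) y KM by blast
    then show "i \<in> K" using j by simp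
  qed (auto simp: K_def Sr)
  have piR: "?p y = ?c i" if "i < M" "y \<in> S i" for i y
  proof -
    have "(THE i. i < M \<and> y \<in> S i) = i" using that S_disj by (intro the_equality) blast+
    then show ?thesis by (simp add: piR_def)
  qed
  have ex: "\<exists>i<M. y \<in> S i" for y using S_cover by blast
  have p_iff: "?p y = ?p x \<longleftrightarrow> y \<in> (\<Union>i\<in>K. S i)" if "i0 \<in> K" "x \<in> S i0" for x y i0
  proof -
    have "?p x = k" using piR[of i0 x] that by (simp add: K_def)
    moreover obtain i where i: "i < M" "y \<in> S i" using ex by blast
    moreover have "y \<in> (\<Union>i\<in>K. S i) \<longleftrightarrow> i \<in> K" using i S_disj KM by blast
    ultimately show ?thesis using piR[OF i] by (simp add: K_def)
  qed
  \<comment> \<open>Below the top rank there are at least two clusters, and communication leads into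
    another one.\<close>
  have exit: "\<exists>l. l \<notin> K \<and> (i, l) \<in> {(a, b). a < M \<and> b < M \<and> Pm \<epsilon> a b > 0}\<^sup>*" if "i \<in> K" "0 < \<epsilon>" for i \<epsilon>
  proof -
    define k' where "k' = (if k = 0 then 1 else 0 :: nat)"
    have "k' < ?m" "k' \<noteq> k" using m1 by (auto simp: k'_def)
    then obtain l where l: "l < M" "l \<notin> K" using cs[of k'] by (auto simp: K_def)
    have iM: "i < M" using that KM by blast
    have "{(a, b). a < M \<and> b < M \<and> (\<forall>\<epsilon>>0. Pm \<epsilon> a b > 0)} \<subseteq> {(a, b). a < M \<and> b < M \<and> Pm \<epsilon> a b > 0}"
      using that(2) by auto
    from rtrancl_mono[OF this] show ?thesis using a_comm[rule_format, OF iM l(1)] l(2) by blast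
  qed
  have near_P_ev: "\<forall>\<^sub>F \<epsilon> in at_right 0. \<forall>i<M. \<forall>j<M. \<forall>y\<in>S i. near \<eta> (kerP (Q \<epsilon> y) (S j)) (Pm \<epsilon> i j)" if \<eta>: "0 < \<eta>" for \<eta>
  proof -
    have "\<forall>\<^sub>F \<epsilon> in at_right 0. \<forall>y\<in>S i. near \<eta> (kerP (Q \<epsilon> y) (S j)) (Pm \<epsilon> i j)" if ij: "i < M" "j < M" for i j
    proof (cases "\<forall>\<epsilon>>0. Pm \<epsilon> i j = 0 \<and> (\<forall>y\<in>S i. kerP (Q \<epsilon> y) (S j) = 0)")
      case True
      show ?thesis using eventually_pos_at_right by eventually_elim (use True in \<open>auto simp: near_def\<close>)
    next
      case False
      \<comment> \<open>The diagonal falls under the vanishing case by \<open>a_diag\<close> and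
        \<open>a_Pdiag\<close>.\<close>
      then have "i \<noteq> j" using a_diag a_Pdiag ij by blast
      then have pos: "\<forall>\<epsilon>>0. 0 < Pm \<epsilon> i j" and u: "unif_to_one (\<lambda>\<epsilon> x. kerP (Q \<epsilon> x) (S j) / Pm \<epsilon> i j) (S i)"
        using a_offdiag ij False by blast+
      have "\<forall>\<^sub>F \<epsilon> in at_right 0. \<forall>y\<in>S i. \<bar>kerP (Q \<epsilon> y) (S j) / Pm \<epsilon> i j - 1\<bar> < \<eta>"
        using u \<eta> unfolding unif_to_one_def by blast
      then show ?thesis using eventually_pos_at_right
      proof eventually_elim
        case (elim \<epsilon>)
        show ?case
        proof
          fix y assume "y \<in> S i"
          then have "\<bar>kerP (Q \<epsilon> y) (S j) / Pm \<epsilon> i j - 1\<bar> < \<eta>" using elim by blast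
          moreover have "0 < Pm \<epsilon> i j" using pos elim by blast
          moreover from this have "kerP (Q \<epsilon> y) (S j) / Pm \<epsilon> i j - 1 = (kerP (Q \<epsilon> y) (S j) - Pm \<epsilon> i j) / Pm \<epsilon> i j"
            by (simp add: diff_divide_distrib)
          ultimately show "near \<eta> (kerP (Q \<epsilon> y) (S j)) (Pm \<epsilon> i j)"
            by (simp add: near_def pos_divide_less_eq less_imp_le)
        qed
      qed
    qed
    then show ?thesis by (rule eventually_all_less2)
  qed
  have setsQ: "sets (Q \<epsilon> y) = sets (borel \<Otimes>\<^sub>M borel)" and probQ: "prob_space (Q \<epsilon> y)" if "0 < \<epsilon>" for \<epsilon> y
    using measurable_space[OF Q_kernel[rule_format, OF that], of y] by (simp_all add: space_prob_algebra)
  have near_T_ev: "\<forall>\<^sub>F \<epsilon> in at_right 0. \<forall>i<M. \<forall>j<M. \<forall>y\<in>S i.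
      time_near \<eta> (Q \<epsilon> y) (S j) (tau \<epsilon> i)"
    if \<eta>: "0 < \<eta>" "\<eta> \<le> 1" for \<eta>
  proof -
    have "\<forall>\<^sub>F \<epsilon> in at_right 0. \<forall>y\<in>S i.
        time_near \<eta> (Q \<epsilon> y) (S j) (tau \<epsilon> i)"
      if ij: "i < M" "j < M" for i j
    proof (cases "\<forall>\<epsilon>>0. Pm \<epsilon> i j = 0 \<and> (\<forall>y\<in>S i. kerP (Q \<epsilon> y) (S j) = 0)")
      case True
      show ?thesis using eventually_pos_at_right
      proof eventually_elim
        case (elim \<epsilon>)
        show ?case
        proof
          fix y assume "y \<in> S i"
          then have z: "kerP (Q \<epsilon> y) (S j) = 0" using True elim by blast
          show "time_near \<eta> (Q \<epsilon> y) (S j) (tau \<epsilon> i)"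
            using time_nn_zero[OF probQ[OF elim] setsQ[OF elim] S_borel[rule_format, OF ij(2)] z]
            unfolding time_near_def by (intro exI[of _ 0]) (simp add: z near_def)
        qed
      qed
    next
      case False
      then have "i \<noteq> j" using a_diag a_Pdiag ij by blast
      then have pos: "\<forall>\<epsilon>>0. 0 < Pm \<epsilon> i j \<and> (\<forall>y\<in>S i. 0 < kerP (Q \<epsilon> y) (S j))" using a_offdiag ij False by blast
      then have "0 < Pm 1 i j" by simp
      then have "\<not> (\<forall>\<epsilon>>0. Pm \<epsilon> i j = 0)" using zero_less_one by (metis less_irrefl)
      then have "\<forall>\<^sub>F \<epsilon> in at_right 0. \<forall>y\<in>S i. \<bar>condMom (Q \<epsilon> y) (S j) (\<lambda>t. t) / tau \<epsilon> i - 1\<bar> < \<eta>"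
        using b_mean ij \<eta>(1) unfolding unif_to_one_def by blast
      then show ?thesis using eventually_pos_at_right
      proof eventually_elim
        case (elim \<epsilon>)
        show ?case
        proof
          fix y assume y: "y \<in> S i"
          show "time_near \<eta> (Q \<epsilon> y) (S j) (tau \<epsilon> i)"
          proof (rule time_nn_near[OF probQ[OF elim(2)] setsQ[OF elim(2)] S_borel[rule_format, OF ij(2)] _ _ _ \<eta>(2)])
            show "measure (Q \<epsilon> y) (UNIV \<times> {..<0}) = 0" using Q_nonneg_time elim(2) by blast
            show "0 < kerP (Q \<epsilon> y) (S j)" using pos elim(2) y by blast
            show "0 < tau \<epsilon> i" using b_pos elim(2) ij by blast
            show "\<bar>condMom (Q \<epsilon> y) (S j) (\<lambda>t. t) / tau \<epsilon> i - 1\<bar> < \<eta>" using elim(1) y by blast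
          qed
        qed
      qed
    qed
    then show ?thesis by (rule eventually_all_less2)
  qed
  \<comment> \<open>The constants \<open>\<nu>\<close> replace the occupation numbers, so the
    normalisation depends neither on \<open>x\<close> nor on the exit cluster.\<close>
  define taur where "taur \<epsilon> = (\<Sum>i\<in>K. tau \<epsilon> i * \<nu> \<epsilon> i)" for \<epsilon>
  have KiM: "i < M" if "i \<in> K" for i using that KM by blast
  have main: "\<forall>\<^sub>F \<epsilon> in at_right 0. \<forall>x\<in>Sr M Pm S r k.
      \<bar>taur \<epsilon> / (\<Sum>i\<in>K. tau \<epsilon> i * ENr (Prb \<epsilon> x) ?p (X \<epsilon> x) (S i)) - 1\<bar> < \<delta> \<and>
      (\<forall>l<?m. \<not> (\<forall>\<epsilon>>0. ?P \<epsilon> k l = 0) \<longrightarrow>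
         \<bar>ETr (Prb \<epsilon> x) ?p (X \<epsilon> x) (T \<epsilon> x) (Sr M Pm S r l) / taur \<epsilon> - 1\<bar> < \<delta>)" if \<delta>: "0 < \<delta>" for \<delta>
  proof -
    \<comment> \<open>The divisor provides both the smallness demanded by
      \<open>exit_time_estimate\<close> and \<open>4374 * d < \<delta>\<close>.\<close>
    define d where "d = min \<delta> 1 / 10000"
    have d: "0 < d" "d \<le> 1/10000" "4374 * d < \<delta>" using \<delta> by (auto simp: d_def min_def)
    obtain \<eta>0 where \<eta>0: "\<eta>0 > 0" and
      ev: "\<forall>\<^sub>F \<epsilon> in at_right 0. rank_law M (Pm \<epsilon>) ?m ?c (?P \<epsilon>) (\<nu> \<epsilon>) d \<eta>0"
      using ra[unfolded rank_asymp_def, rule_format, OF d(1)] by blast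
    define \<eta> where "\<eta> = min \<eta>0 d"
    have \<eta>: "0 < \<eta>" "\<eta> \<le> \<eta>0" "\<eta> \<le> d" "\<eta> \<le> 1/2" "\<eta> \<le> 1" using \<eta>0 d by (auto simp: \<eta>_def)
    show ?thesis
      using ev near_P_ev[OF \<eta>(1)] near_T_ev[OF \<eta>(1,5)] eventually_pos_at_right
    proof eventually_elim
      case (elim \<epsilon>)
      have e0: "0 < \<epsilon>" by (rule elim(4))
      have PK0: "\<forall>i\<in>K. \<forall>j<M. 0 \<le> Pm \<epsilon> i j" using P0[OF e0] KiM by blast
      have FA: "near d (W i) (\<nu> \<epsilon> i * sum b K)" "\<And>a'. a' < ?m \<Longrightarrow> a' \<noteq> k \<Longrightarrow>
          near d (\<Sum>i\<in>K. \<Sum>j\<in>?Kc a'. F i j) (?P \<epsilon> k a' * sum b K)"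
        if fl: "flow M (Pm \<epsilon>) \<eta> K b W F" and "i \<in> K" for b W F i
        using elim(1)[unfolded rank_law_def, rule_format, OF k_lt, of b W F] flow_mono[OF fl \<eta>(2) PK0] that(2) unfolding K_def by blast+
      \<comment> \<open>One \<epsilon> serves all starting points of the cluster. The locale is used
        for the given \<open>x\<close> and, in the proof of harmonicity, for points of every
        \<open>S i\<close> with \<open>i\<close> in \<open>K\<close>.\<close>
      have ce: "cluster_exit (Q \<epsilon>) x (Prb \<epsilon> x) (X \<epsilon> x) (T \<epsilon> x) M S K i0 (Pm \<epsilon>) (tau \<epsilon>) \<eta> ?p"
        if i0: "i0 \<in> K" and x: "x \<in> S i0" for x i0
      proof
        show "near \<eta> (kerP (Q \<epsilon> y) (S j)) (Pm \<epsilon> i j)" if "i \<in> K" "j < M" "y \<in> S i" for i j y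
          using elim(2) that KiM by blast
        show "time_near \<eta> (Q \<epsilon> y) (S j) (tau \<epsilon> i)"
          if "i \<in> K" "j < M" "y \<in> S i" for i j y using elim(3) that KiM by blast
        show "?p y = ?p x \<longleftrightarrow> y \<in> (\<Union>i\<in>K. S i)" for y by (rule p_iff[OF i0 x])
        show "(\<Union>i<M. S i) = UNIV" by (rule S_cover)
        show "K \<subseteq> {..<M}" by (rule KM)
        show "\<exists>l. l \<notin> K \<and> (i, l) \<in> {(a, b). a < M \<and> b < M \<and> Pm \<epsilon> a b > 0}\<^sup>*" if "i \<in> K" for i
          by (rule exit[OF that e0])
        show "MRP_chain (Q \<epsilon>) x (Prb \<epsilon> x) (X \<epsilon> x) (T \<epsilon> x)" using chain e0 by blast
        show "Q \<epsilon> \<in> borel \<rightarrow>\<^sub>M prob_algebra (borel \<Otimes>\<^sub>M borel)" using Q_kernel e0 by blast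
        show "measure (Q \<epsilon> y) (UNIV \<times> {..<0}) = 0" for y using Q_nonneg_time e0 by blast
        show "S i \<inter> S j = {}" if "i < M" "j < M" "i \<noteq> j" for i j using S_disj that by blast
      qed (use i0 x \<eta> S_borel PK0 b_pos e0 KiM in auto)
      have nu: "0 < \<nu> \<epsilon> i" "0 < tau \<epsilon> i" if "i \<in> K" for i using \<nu>[OF e0] b_pos e0 KiM[OF that] by blast+
      have tp: "0 < taur \<epsilon>" unfolding taur_def using finK Kne nu by (intro sum_pos) auto
      show ?case
      proof
        fix x assume "x \<in> Sr M Pm S r k"
        then obtain i0 where i0: "i0 \<in> K" and x: "x \<in> S i0" by (auto simp: Sr K_def)
        let ?b = "\<lambda>j. if j = i0 then 1 else (0::real)"
        have sb: "sum ?b K = 1" using i0 finK by simp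
        obtain N F W' F' FT where fl: "flow M (Pm \<epsilon>) \<eta> K ?b N F"
          and fl': "flow M (Pm \<epsilon>) \<eta> K (\<lambda>j. \<Sum>i\<in>K. FT i j) W' F'"
          and FT: "\<forall>i\<in>K. \<forall>j<M. near \<eta> (FT i j) (tau \<epsilon> i * F i j)"
          and EN: "\<forall>i\<in>K. ENr (Prb \<epsilon> x) ?p (X \<epsilon> x) (S i) = N i"
          and EX: "\<forall>L. L \<subseteq> {..<M} \<longrightarrow> L \<inter> K = {} \<longrightarrow>
            measure (Prb \<epsilon> x) {\<omega>\<in>space (Prb \<epsilon> x). Xr1 ?p (X \<epsilon> x) \<omega> \<in> (\<Union>j\<in>L. S j)} = (\<Sum>i\<in>K. \<Sum>j\<in>L. F i j) \<and>
            (\<integral>\<omega>. Tr1 ?p (X \<epsilon> x) (T \<epsilon> x) \<omega> * indicator (\<Union>j\<in>L. S j) (Xr1 ?p (X \<epsilon> x) \<omega>) \<partial>Prb \<epsilon> x) =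
              (\<Sum>i\<in>K. \<Sum>j\<in>L. FT i j + F' i j)"
          using cluster_exit.exit_flows[OF ce[OF i0 x]] by (elim exE conjE) (rule that)
        have N: "near d (N i) (\<nu> \<epsilon> i)" if "i \<in> K" for i using FA(1)[OF fl that] by (simp add: sb)
        have sN: "near d (\<Sum>i\<in>K. tau \<epsilon> i * N i) (taur \<epsilon>)"
          unfolding taur_def using N nu(2) by (intro near_sum near_cmult) (auto simp: less_imp_le)
        have 1: "\<bar>taur \<epsilon> / (\<Sum>i\<in>K. tau \<epsilon> i * ENr (Prb \<epsilon> x) ?p (X \<epsilon> x) (S i)) - 1\<bar> < \<delta>"
        proof -
          have "(\<Sum>i\<in>K. tau \<epsilon> i * ENr (Prb \<epsilon> x) ?p (X \<epsilon> x) (S i)) = (\<Sum>i\<in>K. tau \<epsilon> i * N i)"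
            using EN by (intro sum.cong) auto
          moreover have "near (2 * d) (taur \<epsilon>) (\<Sum>i\<in>K. tau \<epsilon> i * N i)"
            using near_sym[OF sN] d tp by simp
          moreover have "0 < (\<Sum>i\<in>K. tau \<epsilon> i * N i)"
          proof -
            have "0 < (1 - d) * taur \<epsilon>" using d tp by simp
            then show ?thesis using near_lower[OF sN] by linarith
          qed
          ultimately show ?thesis using near_ratio[of "2 * d"] d by simp
        qed
        have 2: "\<bar>ETr (Prb \<epsilon> x) ?p (X \<epsilon> x) (T \<epsilon> x) (Sr M Pm S r l) / taur \<epsilon> - 1\<bar> < \<delta>"
          if l: "l < ?m" and Pl: "\<not> (\<forall>\<epsilon>>0. ?P \<epsilon> k l = 0)" for l
        proof -
          have lk: "l \<noteq> k" using Pl goodD(1)[OF gr _ k_lt] by blast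
          define p where "p = ?P \<epsilon> k l"
          have p: "0 < p" using goodD(2)[OF gr k_lt l] Pl G_pos e0 unfolding G0_def p_def by blast
          define L where "L = ?Kc l"
          have LM: "L \<subseteq> {..<M}" and LK: "L \<inter> K = {}" using lk by (auto simp: L_def K_def)
          have FA2: "near d (\<Sum>i\<in>K. \<Sum>j\<in>L. F i j) (p * sum b K)" if "flow M (Pm \<epsilon>) \<eta> K b W F" for b W F
            using FA(2)[OF that i0 l lk] by (simp add: L_def p_def)
          have EL: "near d (\<Sum>i\<in>K. \<Sum>j\<in>L. F i j) p" using FA2[OF fl] by (simp add: sb)
          \<comment> \<open>Harmonicity is derived for the kernel at an arbitrary \<open>y\<close>
            in \<open>S i\<close> and then transferred to \<open>Pm \<epsilon>\<close>. The same
            \<open>p\<close> occurs for every \<open>i\<close>, since the exit law depends only on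
            the source mass.\<close>
          have h: "near (18 * d) ((\<Sum>j\<in>L. Pm \<epsilon> i j) + p * (\<Sum>j\<in>K. Pm \<epsilon> i j)) p" if i: "i \<in> K" for i
          proof -
            obtain y where y: "y \<in> S i" using S_ne[OF KiM[OF i]] by blast
            let ?ker = "\<lambda>j. kerP (Q \<epsilon> y) (S j)"
            obtain N F N2 F2 where fl: "flow M (Pm \<epsilon>) \<eta> K (\<lambda>j. if j = i then 1 else 0) N F"
              and fl2: "flow M (Pm \<epsilon>) \<eta> K ?ker N2 F2"
              and F2: "\<forall>i'\<in>K. \<forall>j<M. F i' j = (if i' = i then ?ker j else 0) + F2 i' j"
              using cluster_exit.first_step_flows[OF ce[OF i y]] by (elim exE conjE) (rule that)
            have "(\<Sum>i'\<in>K. \<Sum>j\<in>L. F i' j) = (\<Sum>i'\<in>K. (if i' = i then (\<Sum>j\<in>L. ?ker j) else 0) + (\<Sum>j\<in>L. F2 i' j))"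
            proof (rule sum.cong[OF refl])
              fix i' assume i': "i' \<in> K"
              have "(\<Sum>j\<in>L. F i' j) = (\<Sum>j\<in>L. (if i' = i then ?ker j else 0) + F2 i' j)"
                using F2 i' LM by (intro sum.cong) auto
              then show "(\<Sum>j\<in>L. F i' j) = (if i' = i then (\<Sum>j\<in>L. ?ker j) else 0) + (\<Sum>j\<in>L. F2 i' j)"
                by (simp add: sum.distrib)
            qed
            also have "\<dots> = (\<Sum>j\<in>L. ?ker j) + (\<Sum>i'\<in>K. \<Sum>j\<in>L. F2 i' j)"
              using i finK by (simp add: sum.distrib)
            finally have "near d ((\<Sum>j\<in>L. ?ker j) + (\<Sum>i'\<in>K. \<Sum>j\<in>L. F2 i' j)) p"
              using FA2[OF fl] i finK by simp
            moreover have "near d (\<Sum>i'\<in>K. \<Sum>j\<in>L. F2 i' j) (p * (\<Sum>j\<in>K. ?ker j))" by (rule FA2[OF fl2])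
            ultimately have kh: "near (6 * d) ((\<Sum>j\<in>L. ?ker j) + p * (\<Sum>j\<in>K. ?ker j)) p"
              by (rule harmonic_estimate) (use d p in \<open>auto intro!: sum_nonneg simp: kerP_def\<close>)
            have kP: "near \<eta> (?ker j) (Pm \<epsilon> i j)" if "j < M" for j using elim(2) KiM[OF i] that y by blast
            have "near \<eta> ((\<Sum>j\<in>L. ?ker j) + p * (\<Sum>j\<in>K. ?ker j)) ((\<Sum>j\<in>L. Pm \<epsilon> i j) + p * (\<Sum>j\<in>K. Pm \<epsilon> i j))"
              using kP LM KM p by (intro near_add near_cmult near_sum) auto
            moreover have P0': "0 \<le> (\<Sum>j\<in>L. Pm \<epsilon> i j) + p * (\<Sum>j\<in>K. Pm \<epsilon> i j)"
              using PK0 i LM KM p by (intro add_nonneg_nonneg mult_nonneg_nonneg sum_nonneg) auto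
            ultimately have "near (2 * \<eta>) ((\<Sum>j\<in>L. Pm \<epsilon> i j) + p * (\<Sum>j\<in>K. Pm \<epsilon> i j)) ((\<Sum>j\<in>L. ?ker j) + p * (\<Sum>j\<in>K. ?ker j))"
              using \<eta> by (intro near_sym) auto
            then have "near (6 * d) ((\<Sum>j\<in>L. Pm \<epsilon> i j) + p * (\<Sum>j\<in>K. Pm \<epsilon> i j)) ((\<Sum>j\<in>L. ?ker j) + p * (\<Sum>j\<in>K. ?ker j))"
              by (rule near_mono) (use \<eta> d p in \<open>auto intro!: add_nonneg_nonneg mult_nonneg_nonneg sum_nonneg simp: kerP_def\<close>)
            from near_trans[OF this kh] show ?thesis using d p by simp
          qed
          have est: "near (4374 * d) (\<Sum>i\<in>K. \<Sum>j\<in>L. FT i j + F' i j) ((\<Sum>i\<in>K. \<Sum>j\<in>L. F i j) * (\<Sum>i\<in>K. tau \<epsilon> i * \<nu> \<epsilon> i))"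
          proof (rule exit_time_estimate[OF d(1,2) p KM LM N nu EL _ _ h])
            fix i j assume ij: "i \<in> K" "j < M"
            show "0 \<le> Pm \<epsilon> i j" using PK0 ij by blast
            show "near d (F i j) (Pm \<epsilon> i j * N i)"
              using near_mono[OF flowD(4)[OF fl ij] \<eta>(3)] PK0 ij flowD(2)[OF fl ij(1)] by simp
            show "near d (FT i j) (tau \<epsilon> i * F i j)"
              using near_mono[OF FT[rule_format, OF ij] \<eta>(3)] nu(2)[OF ij(1)] flowD(3)[OF fl ij] by simp
          qed (use FA2[OF fl'] in auto)
          \<comment> \<open>A positive exit probability makes the conditional expectation
            \<open>ETr\<close> a genuine quotient.\<close>
          have EL0: "0 < (\<Sum>i\<in>K. \<Sum>j\<in>L. F i j)"
          proof -
            have "0 < (1 - d) * p" using d p by simp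
            then show ?thesis using near_lower[OF EL] by linarith
          qed
          have SL: "Sr M Pm S r l = (\<Union>j\<in>L. S j)" by (simp add: Sr L_def)
          have "ETr (Prb \<epsilon> x) ?p (X \<epsilon> x) (T \<epsilon> x) (Sr M Pm S r l) / taur \<epsilon> =
              (\<Sum>i\<in>K. \<Sum>j\<in>L. FT i j + F' i j) / ((\<Sum>i\<in>K. \<Sum>j\<in>L. F i j) * (\<Sum>i\<in>K. tau \<epsilon> i * \<nu> \<epsilon> i))"
            using EX[rule_format, OF LM LK] unfolding ETr_def SL taur_def by simp
          moreover have "0 < (\<Sum>i\<in>K. \<Sum>j\<in>L. F i j) * (\<Sum>i\<in>K. tau \<epsilon> i * \<nu> \<epsilon> i)"
            using EL0 tp unfolding taur_def by simp
          ultimately show ?thesis using near_ratio[OF est _ d(3)] by simp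
        qed
        from 1 2 show "\<bar>taur \<epsilon> / (\<Sum>i\<in>K. tau \<epsilon> i * ENr (Prb \<epsilon> x) ?p (X \<epsilon> x) (S i)) - 1\<bar> < \<delta> \<and>
          (\<forall>l<?m. \<not> (\<forall>\<epsilon>>0. ?P \<epsilon> k l = 0) \<longrightarrow>
             \<bar>ETr (Prb \<epsilon> x) ?p (X \<epsilon> x) (T \<epsilon> x) (Sr M Pm S r l) / taur \<epsilon> - 1\<bar> < \<delta>)" by blast
      qed
    qed
  qed
  show ?thesis
    unfolding idx
  proof (intro exI[of _ taur] conjI allI impI)
    show "unif_to_one (\<lambda>\<epsilon> x. taur \<epsilon> / (\<Sum>i\<in>K. tau \<epsilon> i * ENr (Prb \<epsilon> x) ?p (X \<epsilon> x) (S i))) (Sr M Pm S r k)"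
      unfolding unif_to_one_def
    proof (intro allI impI)
      fix \<delta> :: real assume "0 < \<delta>"
      from main[OF this] show "\<forall>\<^sub>F \<epsilon> in at_right 0. \<forall>x\<in>Sr M Pm S r k.
          \<bar>taur \<epsilon> / (\<Sum>i\<in>K. tau \<epsilon> i * ENr (Prb \<epsilon> x) ?p (X \<epsilon> x) (S i)) - 1\<bar> < \<delta>"
        by (rule eventually_mono) blast
    qed
    fix l assume l: "l < ?m" "\<not> (\<forall>\<epsilon>>0. ?P \<epsilon> k l = 0)"
    show "unif_to_one (\<lambda>\<epsilon> x. ETr (Prb \<epsilon> x) ?p (X \<epsilon> x) (T \<epsilon> x) (Sr M Pm S r l) / taur \<epsilon>) (Sr M Pm S r k)"
      unfolding unif_to_one_def
    proof (intro allI impI)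
      fix \<delta> :: real assume "0 < \<delta>"
      from main[OF this] show "\<forall>\<^sub>F \<epsilon> in at_right 0. \<forall>x\<in>Sr M Pm S r k.
          \<bar>ETr (Prb \<epsilon> x) ?p (X \<epsilon> x) (T \<epsilon> x) (Sr M Pm S r l) / taur \<epsilon> - 1\<bar> < \<delta>"
        by (rule eventually_mono) (use l in blast)
    qed
  qed
qed

end
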